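(* Let $X$ be a locally Lipschitz vector field on an open set $\Omega\subset\mathbb{R}^n$. Assume that the function $f\in L^1_{\rm loc}(\Omega)$ admits the distributional derivative $Xf\in L^1_{\rm loc}(\Omega)$ with respect to $X$. Then $|Xf|$ is an upper gradient of $f$ along the vector field $X$, and every upper gradient $h\in L^1_{\rm loc}(\Omega)$ of $f$ along the vector field $X$ satisfies $$|Xf|\le h$$ almost everywhere on $\Omega$.
   Context: A vector field on $\Omega$ is a map $X=(a_1,\dots,a_n):\Omega\to\mathbb{R}^n$. If $X$ is locally Lipschitz, for $x\in\Omega$ let $t\mapsto\gamma^X_t(x)\in\Omega$, $t\in\Gamma^X_x$ (an open interval containing $0$), be the unique maximal solution of $\dot\gamma(t)=X(\gamma(t))$, $\gamma(0)=x$. Put $\Gamma^X=\bigcup_{x\in\Omega}\Gamma^X_x\times\{x\}$, an open subset of $\mathbb{R}\times\Omega$, and $\Gamma^X_+=\{(t,x)\in\Gamma^X: t>0\}$. "Almost all $(t,x)\in\Gamma^X_+$" refers to Lebesgue measure in $\mathbb{R}^{n+1}$. Upper gradient: a nonnegative function $h\in L^1_{\rm loc}(\Omega)$ is an upper gradient for $f\in L^1_{\rm loc}(\Omega)$ along $X$ if $|f(\gamma^X_t(x))-f(x)|\le\int_0^th(\gamma^X_s(x))\,ds$ for almost all $(t,x)\in\Gamma^X_+$. Distributional derivative: $g\in L^1_{\rm loc}(\Omega)$ is the distributional derivative of $f\in L^1_{\rm loc}(\Omega)$ with respect to $X$, written $g=Xf$, if for each $u\in C_0^\infty(\Omega)$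 $$\int_\Omega g\,u\,dx=-\int_\Omega f\,Xu\,dx-\int_\Omega f\,u\,\operatorname{div}X\,dx,$$ where $Xu=\sum_i a_i\,\partial u/\partial x_i$ and $\operatorname{div}X=\sum_i\partial a_i/\partial x_i$ (defined a.e. and locally bounded by Rademacher's theorem). *)

theory Defs
  imports "HOL-Analysis.Analysis"
begin

definition is_solution ::
  "(real ^ 'n \<Rightarrow> real ^ 'n) \<Rightarrow> (real ^ 'n) set \<Rightarrow> real ^ 'n \<Rightarrow> real set \<Rightarrow> (real \<Rightarrow> real ^ 'n) \<Rightarrow> bool"
  where "is_solution X \<Omega> x I \<gamma> \<longleftrightarrow>
    open I \<and> is_interval I \<and> 0 \<in> I \<and> \<gamma> 0 = x \<and>
    (\<forall>t\<in>I. \<gamma> t \<in> \<Omega> \<and> (\<gamma> has_vector_derivative X (\<gamma> t)) (at t))"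

definition is_maximal_solution ::
  "(real ^ 'n \<Rightarrow> real ^ 'n) \<Rightarrow> (real ^ 'n) set \<Rightarrow> real ^ 'n \<Rightarrow> real set \<Rightarrow> (real \<Rightarrow> real ^ 'n) \<Rightarrow> bool"
  where "is_maximal_solution X \<Omega> x I \<gamma> \<longleftrightarrow>
    is_solution X \<Omega> x I \<gamma> \<and>
    (\<forall>J \<delta>. is_solution X \<Omega> x J \<delta> \<and> I \<subseteq> J \<and> (\<forall>t\<in>I. \<delta> t = \<gamma> t) \<longrightarrow> J = I)"

text \<open>
  For locally Lipschitz \<open>X\<close> on open \<open>\<Omega>\<close> and \<open>x \<in> \<Omega>\<close>, the maximal solution exists and is unique
  on its interval of definition, so the descriptions below are proper. Nothing is meant by
  their values for other \<open>x\<close>, or by \<open>flow X \<Omega> t x\<close> for \<open>t\<close> outside the interval.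
\<close>

definition flow_interval ::
  "(real ^ 'n \<Rightarrow> real ^ 'n) \<Rightarrow> (real ^ 'n) set \<Rightarrow> real ^ 'n \<Rightarrow> real set"
  where "flow_interval X \<Omega> x = (THE I. \<exists>\<gamma>. is_maximal_solution X \<Omega> x I \<gamma>)"

definition flow ::
  "(real ^ 'n \<Rightarrow> real ^ 'n) \<Rightarrow> (real ^ 'n) set \<Rightarrow> real \<Rightarrow> real ^ 'n \<Rightarrow> real ^ 'n"
  where "flow X \<Omega> t x = (THE y. \<exists>I \<gamma>. is_maximal_solution X \<Omega> x I \<gamma> \<and> t \<in> I \<and> y = \<gamma> t)"

definition flow_domain ::
  "(real ^ 'n \<Rightarrow> real ^ 'n) \<Rightarrow> (real ^ 'n) set \<Rightarrow> (real \<times> (real ^ 'n)) set"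
  where "flow_domain X \<Omega> = (\<Union>x\<in>\<Omega>. flow_interval X \<Omega> x \<times> {x})"

definition flow_domain_pos ::
  "(real ^ 'n \<Rightarrow> real ^ 'n) \<Rightarrow> (real ^ 'n) set \<Rightarrow> (real \<times> (real ^ 'n)) set"
  where "flow_domain_pos X \<Omega> = {(t, x) \<in> flow_domain X \<Omega>. t > 0}"

definition locally_integrable_on :: "(real ^ 'n \<Rightarrow> real) \<Rightarrow> (real ^ 'n) set \<Rightarrow> bool"
    (infix "locally'_integrable'_on" 50)
  where "f locally_integrable_on \<Omega> \<longleftrightarrow>
    (\<forall>K. compact K \<and> K \<subseteq> \<Omega> \<longrightarrow> set_integrable lebesgue K f)"

text \<open>
  Elements of \<open>L\<^sup>1\<^sub>l\<^sub>o\<^sub>c(\<Omega>)\<close> are represented by total functions whose values off \<open>\<Omega>\<close> are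
  ignored; accordingly, nonnegativity is required almost everywhere on \<open>\<Omega>\<close>. The integral along
  the trajectory is the nonnegative one, so it is \<open>\<infinity>\<close> rather than \<open>0\<close> when it diverges.
\<close>

definition is_upper_gradient ::
  "(real ^ 'n \<Rightarrow> real ^ 'n) \<Rightarrow> (real ^ 'n) set \<Rightarrow> (real ^ 'n \<Rightarrow> real) \<Rightarrow> (real ^ 'n \<Rightarrow> real) \<Rightarrow> bool"
  where "is_upper_gradient X \<Omega> f h \<longleftrightarrow>
    h locally_integrable_on \<Omega> \<and>
    (AE x in lebesgue. x \<in> \<Omega> \<longrightarrow> 0 \<le> h x) \<and>
    (AE (t, x) in lebesgue. (t, x) \<in> flow_domain_pos X \<Omega> \<longrightarrow>
       ennreal \<bar>f (flow X \<Omega> t x) - f x\<bar>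
         \<le> (\<integral>\<^sup>+ s\<in>{0..t}. ennreal (h (flow X \<Omega> s x)) \<partial>lebesgue))"

definition partial_deriv :: "'n \<Rightarrow> (real ^ 'n \<Rightarrow> real) \<Rightarrow> real ^ 'n \<Rightarrow> real"
  where "partial_deriv i u x = deriv (\<lambda>t. u (x + t *\<^sub>R axis i 1)) 0"

primrec C_k :: "nat \<Rightarrow> (real ^ 'n \<Rightarrow> real) \<Rightarrow> bool"
  where
    "C_k 0 u \<longleftrightarrow> continuous_on UNIV u"
  | "C_k (Suc k) u \<longleftrightarrow> continuous_on UNIV u \<and>
      (\<forall>i. (\<forall>x. (\<lambda>t. u (x + t *\<^sub>R axis i 1)) differentiable (at 0)) \<and> C_k k (partial_deriv i u))"

text \<open>
  Functions in \<open>C\<^sub>0\<^sup>\<infinity>(\<Omega>)\<close> are identified with their extensions by zero to the whole space.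
\<close>

definition test_function :: "(real ^ 'n) set \<Rightarrow> (real ^ 'n \<Rightarrow> real) \<Rightarrow> bool"
  where "test_function \<Omega> u \<longleftrightarrow>
    (\<forall>k. C_k k u) \<and> compact (closure {x. u x \<noteq> 0}) \<and> closure {x. u x \<noteq> 0} \<subseteq> \<Omega>"

definition apply_field ::
  "(real ^ 'n \<Rightarrow> real ^ 'n) \<Rightarrow> (real ^ 'n \<Rightarrow> real) \<Rightarrow> real ^ 'n \<Rightarrow> real"
  where "apply_field X u x = (\<Sum>i\<in>UNIV. X x $ i * partial_deriv i u x)"

text \<open>
  For locally Lipschitz \<open>X\<close> the divergence has its intended value almost everywhere; at the
  remaining points \<^const>\<open>deriv\<close> is an unspecified number, which does not affect the integrals.
\<close>

definition divergence :: "(real ^ 'n \<Rightarrow> real ^ 'n) \<Rightarrow> real ^ 'n \<Rightarrow> real"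
  where "divergence X x = (\<Sum>i\<in>UNIV. partial_deriv i (\<lambda>y. X y $ i) x)"

definition is_distributional_derivative ::
  "(real ^ 'n \<Rightarrow> real ^ 'n) \<Rightarrow> (real ^ 'n) set \<Rightarrow> (real ^ 'n \<Rightarrow> real) \<Rightarrow> (real ^ 'n \<Rightarrow> real) \<Rightarrow> bool"
  where "is_distributional_derivative X \<Omega> f g \<longleftrightarrow>
    g locally_integrable_on \<Omega> \<and>
    (\<forall>u. test_function \<Omega> u \<longrightarrow>
      (LINT x:\<Omega>|lebesgue. g x * u x) =
        - (LINT x:\<Omega>|lebesgue. f x * apply_field X u x)
        - (LINT x:\<Omega>|lebesgue. f x * u x * divergence X x))"

end

theory Submission
  imports Defs "HOL-Computational_Algebra.Polynomial"
begin

text \<open>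
  Multiplying \<open>X\<close> by a cutoff reduces everything to a bounded, globally Lipschitz field \<open>Y\<close>,
  whose flow \<open>\<phi>\<close> consists of bi-Lipschitz maps of the whole space; these change Lebesgue measure
  by at most a constant factor. The identity \<open>f (\<phi> t x) - f x = \<integral>\<^sub>0\<^sup>t (Xf) (\<phi> s x) ds\<close> is clear
  for the mollifications of \<open>f\<close>, and it passes to the limit by Friedrichs' commutator estimate: the
  commutator of \<open>Y\<close> with mollification is an integral operator whose kernel is \<open>O(h\<^sup>-\<^sup>n)\<close> on a ball
  of radius \<open>h\<close> and has integral zero, so it is controlled by the modulus of continuity of \<open>f\<close>
  in \<open>L\<^sup>1\<close>. The kernel has integral zero because a Lipschitz function has partial derivatives
  almost everywhere which satisfy integration by parts; almost everywhere differentiability in one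
  variable follows from Vitali's covering theorem. The identity gives that \<open>|Xf|\<close> is an upper
  gradient, and dividing it by \<open>t\<close> and letting \<open>t \<rightarrow> 0\<close> gives minimality.
\<close>

section \<open>Maps of bounded compression\<close>

text \<open>Two difficulties shape the argument. The functions \<open>f\<close> and
  \<open>Xf\<close> are given modulo null sets, yet they are evaluated along trajectories. The
  one-sided bound \<open>compresses\<close>, which comes from the Lipschitz constant of the inverse
  map, carries null sets, integrals and L^1 errors through all flow maps at once. Secondly, the
  gradient of a mollifier costs a factor 1/h, which the Lipschitz bound on the field only just
  compensates, so size estimates leave the commutator bounded but not small. Since its kernel has
  integral zero, the value of the function at the centre may be subtracted, and boundedness becomes
  convergence to 0. Two tools serve twice. \<open>vitali_measure_le\<close> gives both the
  distortion of volume by Lipschitz maps and the differentiability of Lipschitz functions.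
  \<open>compresses_near_identity\<close> is applied to translations in the commutator estimate and
  to flow maps for short times in the proof of minimality.\<close>

definition compresses :: "real \<Rightarrow> ('a::euclidean_space \<Rightarrow> 'a) \<Rightarrow> bool" where
  "compresses C \<phi> \<longleftrightarrow> 0 \<le> C \<and> \<phi> \<in> borel_measurable borel \<and>
     (\<forall>A\<in>sets borel. emeasure lborel (\<phi> -` A) \<le> ennreal C * emeasure lborel A)"

lemma compressesD:
  assumes "compresses C \<phi>"
  shows "0 \<le> C" "\<phi> \<in> borel_measurable borel"
    "A \<in> sets borel \<Longrightarrow> emeasure lborel (\<phi> -` A) \<le> ennreal C * emeasure lborel A"
  using assms unfolding compresses_def by auto

text \<open>Cover \<open>A\<close> up to a null set by disjoint balls inside a slightly larger open
  set and sum the inequality over them; \<open>null\<close> disposes of the rest for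
  \<open>M1\<close>, and \<open>C\<close> makes the excess of the open set small for
  \<open>M2\<close>. The point \<open>x\<close> may lie anywhere in its ball, even on the boundary,
  which the one-dimensional application exploits.\<close>

lemma vitali_measure_le:
  fixes A :: "'a::euclidean_space set"
  assumes sets[measurable_cong]: "sets M1 = sets borel" "sets M2 = sets borel" and A: "A \<in> sets borel"
    and null: "\<And>B. B \<in> null_sets lborel \<Longrightarrow> emeasure M1 B = 0"
    and C: "0 \<le> C" "\<And>B. B \<in> sets borel \<Longrightarrow> emeasure M2 B \<le> ennreal C * emeasure lborel B"
    and fine: "\<And>x d. x \<in> A \<Longrightarrow> 0 < d \<Longrightarrow>
      \<exists>c r. 0 < r \<and> r < d \<and> x \<in> cball c r \<and> emeasure M1 (cball c r) \<le> emeasure M2 (cball c r)"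
  shows "emeasure M1 A \<le> emeasure M2 A"
proof (rule ennreal_le_epsilon)
  fix e :: real assume e: "0 < e"
  have "0 < e / (C + 1)" using e C by simp
  then obtain U where U: "open U" "A \<subseteq> U" "emeasure lborel (U - A) < ennreal (e / (C + 1))"
    by (rule outer_regular_lborel[OF A])
  let ?K = "{p. 0 < snd p \<and> cball (fst p) (snd p) \<subseteq> U \<and>
     emeasure M1 (cball (fst p) (snd p)) \<le> emeasure M2 (cball (fst p) (snd p))}"
  have cov: "\<exists>p. p \<in> ?K \<and> x \<in> cball (fst p) (snd p) \<and> snd p < d" if x: "x \<in> A" and d: "0 < d" for x d
  proof -
    obtain k where k: "0 < k" "ball x k \<subseteq> U"
      using U x open_contains_ball by blast
    \<comment> \<open>Since \<open>x\<close> may lie anywhere in the ball, points of the ball have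
      distance up to \<open>2 * r\<close> from \<open>x\<close>; hence \<open>k/2\<close>.\<close>
    obtain c r where r: "0 < r" "r < min d (k/2)" "x \<in> cball c r"
        "emeasure M1 (cball c r) \<le> emeasure M2 (cball c r)"
      using fine[OF x, of "min d (k/2)"] d k by auto
    have "cball c r \<subseteq> ball x k"
    proof
      fix y assume "y \<in> cball c r"
      then have "dist x y \<le> r + r" using r(3) dist_triangle[of x y c] by (simp add: dist_commute)
      then show "y \<in> ball x k" using r(2) by simp
    qed
    then show ?thesis using r k by (intro exI[of _ "(c, r)"]) auto
  qed
  obtain D where D: "countable D" "D \<subseteq> ?K"
     "pairwise (\<lambda>i j. disjnt (cball (fst i) (snd i)) (cball (fst j) (snd j))) D"
     "negligible (A - (\<Union>p\<in>D. cball (fst p) (snd p)))"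
    by (rule Vitali_covering_theorem_cballs[where K="?K" and a=fst and r=snd and S=A])
      (use cov in auto)
  let ?B = "\<lambda>p. cball (fst p) (snd p)"
  let ?V = "\<Union>p\<in>D. ?B p"
  have disj: "disjoint_family_on ?B D"
    using D(3) by (auto simp: disjoint_family_on_def pairwise_def disjnt_def)
  have V: "?V \<in> sets borel" using D(1) by (intro sets.countable_UN') auto
  have "A - ?V \<in> null_sets lebesgue" using D(4) by (simp add: negligible_iff_null_sets)
  then have M10: "emeasure M1 (A - ?V) = 0" using A V by (intro null) (simp add: null_sets_completion_iff)
  have "emeasure M1 A \<le> emeasure M1 (?V \<union> (A - ?V))"
    using A V sets by (intro emeasure_mono) auto
  also have "\<dots> \<le> emeasure M1 ?V + emeasure M1 (A - ?V)"
    using A V sets by (intro emeasure_subadditive) auto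
  also have "\<dots> = emeasure M1 ?V" using M10 by simp
  also have "\<dots> = (\<integral>\<^sup>+p. emeasure M1 (?B p) \<partial>count_space D)"
    by (rule emeasure_UN_countable) (use D disj sets in auto)
  also have "\<dots> \<le> (\<integral>\<^sup>+p. emeasure M2 (?B p) \<partial>count_space D)"
    using D(2) by (intro nn_integral_mono) auto
  also have "\<dots> = emeasure M2 ?V"
    by (rule emeasure_UN_countable[symmetric]) (use D disj sets in auto)
  also have "\<dots> \<le> emeasure M2 U"
    using U D(2) sets by (intro emeasure_mono) auto
  also have "\<dots> = emeasure M2 (A \<union> (U - A))" using U(2) by (simp add: Un_absorb1)
  also have "\<dots> \<le> emeasure M2 A + emeasure M2 (U - A)"
    using A U sets by (intro emeasure_subadditive) auto
  also have "emeasure M2 (U - A) \<le> ennreal C * emeasure lborel (U - A)"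
    using A U by (intro C(2)) auto
  also have "\<dots> \<le> ennreal C * ennreal (e / (C + 1))"
    using U by (intro mult_left_mono) auto
  also have "\<dots> \<le> ennreal e"
    using C(1) e by (simp add: ennreal_mult'[symmetric] ennreal_leI field_simps)
  finally show "emeasure M1 A \<le> emeasure M2 A + ennreal e" by (simp add: add_left_mono)
qed

text \<open>A preimage under \<open>\<phi>\<close> is an image under \<open>\<psi>\<close>, which
  sends a ball of radius \<open>r\<close> into a ball of radius \<open>K * r\<close> and null sets
  to null sets. The volume ratio of the two balls passes to all Borel sets by
  \<open>vitali_measure_le\<close>.\<close>

lemma compresses_lipschitz_inverse:
  fixes \<phi> \<psi> :: "'a::euclidean_space \<Rightarrow> 'a"
  assumes K: "K-lipschitz_on UNIV \<psi>" and cont: "continuous_on UNIV \<phi>"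
    and inv: "\<And>x. \<phi> (\<psi> x) = x" "\<And>x. \<psi> (\<phi> x) = x"
  shows "compresses (K ^ DIM('a)) \<phi>"
  unfolding compresses_def
proof (intro conjI ballI)
  have K0: "0 \<le> K" using K by (rule lipschitz_on_nonneg)
  then show Kn: "0 \<le> K ^ DIM('a)" by simp
  show m: "\<phi> \<in> borel_measurable borel" using cont by (rule borel_measurable_continuous_onI)
  have vim: "\<phi> -` S = \<psi> ` S" for S using inv by (auto intro: rev_image_eqI)
  let ?M1 = "distr lborel borel \<phi>" and ?M2 = "scale_measure (ennreal (K ^ DIM('a))) lborel"
  have M1: "emeasure ?M1 B = emeasure lborel (\<psi> ` B)" if "B \<in> sets borel" for B
    using that m by (simp add: emeasure_distr vim)
  fix A :: "'a set" assume A: "A \<in> sets borel"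
  have "emeasure ?M1 A \<le> emeasure ?M2 A"
  proof (rule vitali_measure_le[where C="K ^ DIM('a)"])
    fix B :: "'a set" assume B: "B \<in> null_sets lborel"
    have "negligible (\<psi> ` B)"
    proof (rule negligible_locally_Lipschitz_image)
      show "negligible B" using B by (simp add: negligible_iff_null_sets null_sets_completionI)
      show "\<exists>T b. open T \<and> x \<in> T \<and> (\<forall>y\<in>B \<inter> T. norm (\<psi> y - \<psi> x) \<le> b * norm (y - x))" for x
        using lipschitz_onD[OF K] by (intro exI[of _ UNIV] exI[of _ K]) (auto simp: dist_norm)
    qed simp
    moreover have "\<psi> ` B \<in> sets borel" using measurable_sets[OF m, of B] null_setsD2[OF B] by (simp add: vim)
    ultimately show "emeasure ?M1 B = 0" using B M1[of B]
      by (simp add: negligible_iff_null_sets null_sets_completion_iff null_sets_def)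
  next
    fix x :: 'a and d :: real assume d: "0 < d"
    have "\<psi> ` cball x (d/2) \<subseteq> cball (\<psi> x) (K * (d/2))"
    proof (rule image_subsetI)
      fix y assume "y \<in> cball x (d/2)"
      then have "K * dist x y \<le> K * (d/2)" using K0 by (intro mult_left_mono) auto
      then show "\<psi> y \<in> cball (\<psi> x) (K * (d/2))" using lipschitz_onD[OF K, of x y] by simp
    qed
    then have "emeasure ?M1 (cball x (d/2)) \<le> emeasure lborel (cball (\<psi> x) (K * (d/2)))"
      by (simp add: M1 emeasure_mono)
    also have "\<dots> = emeasure ?M2 (cball x (d/2))"
      using d K0 by (simp add: emeasure_cball ennreal_mult'[symmetric] power_mult_distrib power_divide mult_ac)
    finally show "\<exists>c r. 0 < r \<and> r < d \<and> x \<in> cball c r \<and> emeasure ?M1 (cball c r) \<le> emeasure ?M2 (cball c r)"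
      using d by (intro exI[of _ x] exI[of _ "d/2"]) simp
  qed (use A Kn in auto)
  then show "emeasure lborel (\<phi> -` A) \<le> ennreal (K ^ DIM('a)) * emeasure lborel A"
    using A by (simp add: M1 vim)
qed

lemma compresses_nn_integral:
  fixes F :: "'a::euclidean_space \<Rightarrow> ennreal"
  assumes \<phi>: "compresses C \<phi>" and F: "F \<in> borel_measurable borel"
  shows "(\<integral>\<^sup>+x. F (\<phi> x) \<partial>lborel) \<le> ennreal C * (\<integral>\<^sup>+x. F x \<partial>lborel)"
  using F
proof (induction rule: borel_measurable_induct)
  case (cong f g)
  then show ?case by simp
next
  case (set A)
  have "(\<integral>\<^sup>+x. indicator A (\<phi> x) \<partial>lborel) = (\<integral>\<^sup>+x. indicator (\<phi> -` A) x \<partial>lborel)"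
    by (intro nn_integral_cong) (auto simp: indicator_def)
  also have "\<dots> = emeasure lborel (\<phi> -` A)"
    using measurable_sets[OF compressesD(2)[OF \<phi>] set] by (intro nn_integral_indicator) simp
  finally show ?case using compressesD(3)[OF \<phi> set] set by simp
next
  case (mult u c)
  note [measurable] = compressesD(2)[OF \<phi>] mult(2)
  show ?case using mult by (simp add: nn_integral_cmult mult_left_mono mult.left_commute)
next
  case (add u v)
  note [measurable] = compressesD(2)[OF \<phi>] add(1,3)
  show ?case using add by (simp add: nn_integral_add distrib_left add_mono)
next
  case (seq U)
  note [measurable] = compressesD(2)[OF \<phi>] seq(1)
  have "(\<integral>\<^sup>+x. (SUP i. U i) (\<phi> x) \<partial>lborel) = (\<integral>\<^sup>+x. (SUP i. U i (\<phi> x)) \<partial>lborel)"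
    by (simp add: image_image)
  also have "\<dots> = (SUP i. \<integral>\<^sup>+x. U i (\<phi> x) \<partial>lborel)"
    using seq by (intro nn_integral_monotone_convergence_SUP) (auto simp: incseq_def le_fun_def)
  also have "\<dots> \<le> (SUP i. ennreal C * \<integral>\<^sup>+x. U i x \<partial>lborel)"
    using seq by (intro SUP_mono) blast
  also have "\<dots> = ennreal C * (SUP i. \<integral>\<^sup>+x. U i x \<partial>lborel)"
    by (rule SUP_mult_left_ennreal[symmetric])
  also have "(SUP i. \<integral>\<^sup>+x. U i x \<partial>lborel) = (\<integral>\<^sup>+x. (SUP i. U i x) \<partial>lborel)"
    using seq by (intro nn_integral_monotone_convergence_SUP[symmetric]) auto
  finally show ?case by (simp add: image_image)
qed

lemma compresses_AE:
  fixes \<phi> :: "'a::euclidean_space \<Rightarrow> 'a"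
  assumes \<phi>: "compresses C \<phi>" and P: "AE x in lborel. P x"
  shows "AE x in lborel. P (\<phi> x)"
proof -
  obtain N where N: "N \<in> null_sets lborel" "{x. \<not> P x} \<subseteq> N"
    using P unfolding eventually_ae_filter by auto
  have "emeasure lborel (\<phi> -` N) \<le> ennreal C * emeasure lborel N"
    using N by (intro compressesD(3)[OF \<phi>]) auto
  then have "\<phi> -` N \<in> null_sets lborel"
    using N measurable_sets[OF compressesD(2)[OF \<phi>], of N] by (auto simp: null_sets_def)
  then show ?thesis using N by (intro AE_I'[of "\<phi> -` N"]) auto
qed

section \<open>Continuity in L^1 under maps close to the identity\<close>

abbreviation near_identity_bound :: "real \<Rightarrow> ('a::euclidean_space \<Rightarrow> real) \<Rightarrow> real \<Rightarrow> real \<Rightarrow> bool" where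
  "near_identity_bound C F e d \<equiv> \<forall>\<phi>. compresses C \<phi> \<longrightarrow> (\<forall>x. dist (\<phi> x) x \<le> d) \<longrightarrow>
     (\<integral>\<^sup>+x. ennreal \<bar>F (\<phi> x) - F x\<bar> \<partial>lborel) \<le> ennreal e"

text \<open>Squeeze \<open>A\<close> between a compact \<open>K\<close> and an open
  \<open>U\<close>. If \<open>\<phi>\<close> moves points by less than the distance from
  \<open>K\<close> to the complement of \<open>U\<close>, membership in \<open>A\<close> can change
  only where \<open>x\<close> or \<open>\<phi> x\<close> lies in the small set
  \<open>U - K\<close>.\<close>

lemma compresses_near_identity_indicator:
  fixes A :: "'a::euclidean_space set"
  assumes A: "A \<in> sets borel" "emeasure lborel A < \<infinity>" and e: "0 < (e::real)" and C: "0 \<le> C"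
  shows "\<exists>d>0. near_identity_bound C (indicator A) e d"
proof -
  \<comment> \<open>\<open>U - K\<close> has measure at most \<open>2 * e'\<close>; it is counted
    once at \<open>x\<close> and with the factor \<open>C\<close> at
    \<open>\<phi> x\<close>.\<close>
  define e' where "e' = e / (2 * (C + 1))"
  have e': "0 < e'" "(C + 1) * (2 * e') = e" using e C unfolding e'_def by (auto simp: field_simps)
  obtain U where U: "open U" "A \<subseteq> U" "emeasure lborel (U - A) < e'"
    by (rule outer_regular_lborel[OF A(1) e'(1)])
  obtain K where K: "compact K" "K \<subseteq> A" "emeasure lborel (A - K) \<le> e'"
  proof -
    \<comment> \<open>Restriction to \<open>A\<close> gives a finite measure, to which inner
      regularity applies.\<close>
    let ?M = "density lborel (indicator A)"
    have em: "emeasure ?M S = emeasure lborel (A \<inter> S)" if "S \<in> sets borel" for S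
      using A that by (simp add: emeasure_density Int_commute flip: indicator_inter_arith)
    have inner: "emeasure ?M A = (SUP K \<in> {K. K \<subseteq> A \<and> compact K}. emeasure ?M K)"
      using A em[of UNIV] by (intro inner_regular) auto
    have MA: "emeasure ?M A = emeasure lborel A" using em A by auto
    show thesis
    proof (cases "emeasure lborel A = 0")
      case True
      then show thesis using that[of "{}"] by simp
    next
      case False
      obtain a where a: "emeasure lborel A = ennreal a" "0 \<le> a"
        using A(2) by (cases "emeasure lborel A") auto
      then have "ennreal (a - e') < ennreal a" using e' False
        by (intro ennreal_lessI) (auto simp: ennreal_eq_0_iff not_le)
      then have "ennreal (a - e') < (SUP K \<in> {K. K \<subseteq> A \<and> compact K}. emeasure ?M K)"
        using inner MA a by simp
      then obtain K where K: "K \<subseteq> A" "compact K" "ennreal (a - e') < emeasure ?M K"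
        unfolding less_SUP_iff by auto
      have Kb: "K \<in> sets borel" using K(2) by (rule borel_compact)
      have "emeasure ?M K = emeasure lborel K" using em[OF Kb] K by (simp add: Int_absorb1)
      then have lt: "ennreal (a - e') \<le> emeasure lborel K" using K by simp
      have "emeasure lborel (A - K) = emeasure lborel A - emeasure lborel K"
        using K Kb A by (intro emeasure_Diff) (auto simp: top_unique less_top emeasure_bounded_finite[OF compact_imp_bounded, simplified])
      also have "\<dots> \<le> ennreal a - ennreal (a - e')" using lt a(1) by (simp add: ennreal_mono_minus)
      also have "\<dots> \<le> ennreal e'"
        using e' a by (cases "a - e' \<ge> 0") (auto simp: ennreal_minus ennreal_neg intro!: ennreal_leI)
      finally show thesis using that K by blast
    qed
  qed
  have Kb[measurable]: "K \<in> sets borel" "U \<in> sets borel" "A \<in> sets borel"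
    using K(1) U(1) A(1) by (auto intro: borel_compact)
  obtain d where d: "0 < d" "(\<Union>x\<in>K. ball x d) \<subseteq> U"
    using compact_subset_open_imp_ball_epsilon_subset[of K U] K U by blast
  show ?thesis
  proof (intro exI[of _ "d/2"] conjI allI impI)
    show "0 < d/2" using d by simp
    fix \<phi> :: "'a \<Rightarrow> 'a" assume \<phi>: "compresses C \<phi>" and near: "\<forall>x. dist (\<phi> x) x \<le> d/2"
    note [measurable] = compressesD(2)[OF \<phi>]
    have kU: "x \<in> U" if "k \<in> K" "dist k x \<le> d/2" for k x
      using d that by (intro subsetD[OF d(2)]) (auto intro!: bexI[of _ k])
    have "\<bar>indicator A (\<phi> x) - indicator A x\<bar> \<le> (indicator (U - K) x :: real) + indicator (U - K) (\<phi> x)" for x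
      using kU[of x "\<phi> x"] kU[of "\<phi> x" x] near[rule_format, of x] U(2) K(2)
      by (auto simp: indicator_def dist_commute)
    then have "(\<integral>\<^sup>+x. ennreal \<bar>indicator A (\<phi> x) - indicator A x\<bar> \<partial>lborel) \<le>
        (\<integral>\<^sup>+x. indicator (U - K) x + indicator (U - K) (\<phi> x) \<partial>lborel)"
      by (intro nn_integral_mono) (auto simp: ennreal_indicator[symmetric] ennreal_plus[symmetric] simp del: ennreal_plus intro!: ennreal_leI)
    also have "\<dots> = (\<integral>\<^sup>+x. indicator (U - K) x \<partial>lborel) + (\<integral>\<^sup>+x. indicator (U - K) (\<phi> x) \<partial>lborel)"
      by (intro nn_integral_add) auto
    also have "\<dots> \<le> (\<integral>\<^sup>+x. indicator (U - K) x \<partial>lborel) + ennreal C * (\<integral>\<^sup>+x. indicator (U - K) x \<partial>lborel)"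
      by (intro add_left_mono compresses_nn_integral[OF \<phi>]) auto
    also have "\<dots> = ennreal (C + 1) * emeasure lborel (U - K)"
      using C by (simp add: distrib_right add.commute)
    also have "emeasure lborel (U - K) = emeasure lborel (U - A) + emeasure lborel (A - K)"
      using U(2) K(2) by (subst plus_emeasure) (auto intro!: arg_cong[where f="emeasure lborel"])
    also have "ennreal (C + 1) * (emeasure lborel (U - A) + emeasure lborel (A - K)) \<le> 
       ennreal (C + 1) * (ennreal e' + ennreal e')"
      using U K by (intro mult_left_mono add_mono) auto
    also have "\<dots> = ennreal e"
      using e' C by (simp add: ennreal_plus[symmetric] ennreal_mult'[symmetric] del: ennreal_plus)
    finally show "(\<integral>\<^sup>+x. ennreal \<bar>indicator A (\<phi> x) - indicator A x\<bar> \<partial>lborel) \<le> ennreal e" .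
  qed
qed

text \<open>The property passes from indicators to sums and to L^1 limits, because an approximation
  error composed with \<open>\<phi>\<close> grows at most by the factor \<open>C\<close>. The radius
  \<open>d\<close> is uniform in \<open>\<phi>\<close>, so it covers all translations by short
  vectors (\<open>C = 1\<close>) and all flow maps for short times.\<close>

proposition compresses_near_identity:
  fixes F :: "'a::euclidean_space \<Rightarrow> real"
  assumes F: "integrable lborel F" and e: "0 < (e::real)" and C: "0 \<le> C"
  shows "\<exists>d>0. near_identity_bound C F e d"
proof -
  have "\<forall>e>0::real. \<exists>d>0. near_identity_bound C F e d"
    using F
  proof (induction rule: integrable_induct)
    case (base A c)
    show ?case
    proof (intro allI impI)
      fix e :: real assume "0 < e"
      then have e1: "0 < e / (\<bar>c\<bar> + 1)" by simp
      have A: "A \<in> sets borel" using base(1) by simp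
      obtain d where d: "0 < d" and le: "near_identity_bound C (indicator A) (e / (\<bar>c\<bar> + 1)) d"
        using compresses_near_identity_indicator[OF A base(2) e1 C] by auto
      show "\<exists>d>0. near_identity_bound C (\<lambda>x. indicator A x *\<^sub>R c) e d"
      proof (intro exI[of _ d] conjI allI impI d)
        fix \<phi> :: "'a \<Rightarrow> 'a" assume \<phi>: "compresses C \<phi>" "\<forall>x. dist (\<phi> x) x \<le> d"
        note [measurable] = compressesD(2)[OF \<phi>(1)]
        have [measurable]: "A \<in> sets borel" using base by simp
        have "(\<integral>\<^sup>+x. ennreal \<bar>indicator A (\<phi> x) *\<^sub>R c - indicator A x *\<^sub>R c\<bar> \<partial>lborel) =
          (\<integral>\<^sup>+x. ennreal \<bar>c\<bar> * ennreal \<bar>indicator A (\<phi> x) - indicator A x\<bar> \<partial>lborel)"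
          by (intro nn_integral_cong) (auto simp: indicator_def)
        also have "\<dots> = ennreal \<bar>c\<bar> * (\<integral>\<^sup>+x. ennreal \<bar>indicator A (\<phi> x) - indicator A x\<bar> \<partial>lborel)"
          by (intro nn_integral_cmult) auto
        also have "\<dots> \<le> ennreal \<bar>c\<bar> * ennreal (e / (\<bar>c\<bar> + 1))"
          using \<phi> by (intro mult_left_mono le[rule_format]) auto
        also have "\<dots> = ennreal (\<bar>c\<bar> * e / (\<bar>c\<bar> + 1))"
          by (simp add: ennreal_mult'[symmetric])
        also have "\<dots> \<le> ennreal e"
          using \<open>0 < e\<close> by (intro ennreal_leI) (simp add: field_simps)
        finally show "(\<integral>\<^sup>+x. ennreal \<bar>indicator A (\<phi> x) *\<^sub>R c - indicator A x *\<^sub>R c\<bar> \<partial>lborel) \<le> ennreal e" .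
      qed
    qed
  next
    case (add f g)
    show ?case
    proof (intro allI impI)
      fix e :: real assume "0 < e"
      then have e2: "0 < e/2" by simp
      obtain d1 where d1: "d1 > 0" "near_identity_bound C f (e/2) d1"
        using add.IH(1)[rule_format, OF e2] by auto
      obtain d2 where d2: "d2 > 0" "near_identity_bound C g (e/2) d2"
        using add.IH(2)[rule_format, OF e2] by auto
      show "\<exists>d>0. near_identity_bound C (\<lambda>x. f x + g x) e d"
      proof (intro exI[of _ "min d1 d2"] conjI allI impI)
        show "0 < min d1 d2" using d1 d2 by simp
        fix \<phi> :: "'a \<Rightarrow> 'a" assume \<phi>: "compresses C \<phi>" "\<forall>x. dist (\<phi> x) x \<le> min d1 d2"
        note [measurable] = compressesD(2)[OF \<phi>(1)]
        have [measurable]: "f \<in> borel_measurable borel" "g \<in> borel_measurable borel"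
          using add.hyps by (auto dest: borel_measurable_integrable)
        have "(\<integral>\<^sup>+x. ennreal \<bar>f (\<phi> x) + g (\<phi> x) - (f x + g x)\<bar> \<partial>lborel) \<le>
          (\<integral>\<^sup>+x. ennreal \<bar>f (\<phi> x) - f x\<bar> + ennreal \<bar>g (\<phi> x) - g x\<bar> \<partial>lborel)"
          by (intro nn_integral_mono) (auto simp: ennreal_plus[symmetric] simp del: ennreal_plus intro!: ennreal_leI)
        also have "\<dots> = (\<integral>\<^sup>+x. ennreal \<bar>f (\<phi> x) - f x\<bar> \<partial>lborel) + (\<integral>\<^sup>+x. ennreal \<bar>g (\<phi> x) - g x\<bar> \<partial>lborel)"
          by (intro nn_integral_add) auto
        also have "\<dots> \<le> ennreal (e/2) + ennreal (e/2)"
          using \<phi> by (intro add_mono d1(2)[rule_format] d2(2)[rule_format]) auto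
        also have "\<dots> = ennreal e" using \<open>0 < e\<close> by (simp add: ennreal_plus[symmetric] del: ennreal_plus)
        finally show "(\<integral>\<^sup>+x. ennreal \<bar>f (\<phi> x) + g (\<phi> x) - (f x + g x)\<bar> \<partial>lborel) \<le> ennreal e" .
      qed
    qed
  next
    case (lim f s)
    show ?case
    proof (intro allI impI)
      fix e :: real assume "0 < e"
      have [measurable]: "f \<in> borel_measurable borel" "\<And>i. s i \<in> borel_measurable borel"
        using lim.hyps by (auto dest: borel_measurable_integrable)
      have "(\<lambda>i. \<integral>\<^sup>+x. ennreal (norm (f x - s i x)) \<partial>lborel) \<longlonglongrightarrow> 0"
      proof (rule nn_integral_dominated_convergence_norm[where w="\<lambda>x. 2 * norm (f x)"])
        show "(\<integral>\<^sup>+x. ennreal (2 * norm (f x)) \<partial>lborel) < \<infinity>"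
          using \<open>integrable lborel f\<close> by (simp add: integrable_iff_bounded ennreal_mult' nn_integral_cmult ennreal_mult_less_top)
      qed (use lim.hyps in auto)
      \<comment> \<open>The approximation error enters at \<open>\<phi> x\<close> with factor
        \<open>C\<close> and at \<open>x\<close> with factor 1; the displacement of
        \<open>s i\<close> takes one more share.\<close>
      moreover have "0 < e / (C + 2)" using \<open>0 < e\<close> C by simp
      ultimately have "\<forall>\<^sub>F i in sequentially. (\<integral>\<^sup>+x. ennreal (norm (f x - s i x)) \<partial>lborel) < ennreal (e / (C + 2))"
        by (intro order_tendstoD(2)) auto
      then obtain i where i: "(\<integral>\<^sup>+x. ennreal (norm (f x - s i x)) \<partial>lborel) < ennreal (e / (C + 2))"
        unfolding eventually_sequentially by blast
      obtain d where d: "d > 0" "near_identity_bound C (s i) (e / (C + 2)) d"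
        using lim.IH[of i, rule_format, OF \<open>0 < e / (C + 2)\<close>] by auto
      show "\<exists>d>0. near_identity_bound C f e d"
      proof (intro exI[of _ d] conjI allI impI d(1))
        fix \<phi> :: "'a \<Rightarrow> 'a" assume \<phi>: "compresses C \<phi>" "\<forall>x. dist (\<phi> x) x \<le> d"
        note [measurable] = compressesD(2)[OF \<phi>(1)]
        let ?r = "\<lambda>x. ennreal (norm (f x - s i x))"
        have "ennreal \<bar>f (\<phi> x) - f x\<bar> \<le> ?r (\<phi> x) + (?r x + ennreal \<bar>s i (\<phi> x) - s i x\<bar>)" for x
          by (auto simp: ennreal_plus[symmetric] simp del: ennreal_plus intro!: ennreal_leI)
        then have "(\<integral>\<^sup>+x. ennreal \<bar>f (\<phi> x) - f x\<bar> \<partial>lborel) \<le>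
          (\<integral>\<^sup>+x. ?r (\<phi> x) + (?r x + ennreal \<bar>s i (\<phi> x) - s i x\<bar>) \<partial>lborel)"
          by (intro nn_integral_mono) auto
        also have "\<dots> = (\<integral>\<^sup>+x. ?r (\<phi> x) \<partial>lborel) + ((\<integral>\<^sup>+x. ?r x \<partial>lborel) + (\<integral>\<^sup>+x. ennreal \<bar>s i (\<phi> x) - s i x\<bar> \<partial>lborel))"
          by (subst nn_integral_add, simp, simp)+ simp
        also have "\<dots> \<le> ennreal C * (\<integral>\<^sup>+x. ?r x \<partial>lborel) + ((\<integral>\<^sup>+x. ?r x \<partial>lborel) + (\<integral>\<^sup>+x. ennreal \<bar>s i (\<phi> x) - s i x\<bar> \<partial>lborel))"
          by (intro add_right_mono compresses_nn_integral[OF \<phi>(1)]) auto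
        also have "\<dots> \<le> ennreal C * ennreal (e / (C + 2)) + (ennreal (e / (C + 2)) + ennreal (e / (C + 2)))"
          using i d(2)[rule_format, OF \<phi>(1)] \<phi>(2) by (intro add_mono mult_left_mono) auto
        also have "\<dots> = ennreal (C * (e / (C + 2)) + (e / (C + 2) + e / (C + 2)))"
        proof -
          have "ennreal C * ennreal q + (ennreal q + ennreal q) = ennreal (C * q + (q + q))" if "0 \<le> q" for q
            using C that by (simp add: ennreal_plus[symmetric] ennreal_mult'[symmetric] del: ennreal_plus)
          then show ?thesis using \<open>0 < e / (C + 2)\<close> by (simp del: times_divide_eq_right)
        qed
        also have "C * (e / (C + 2)) + (e / (C + 2) + e / (C + 2)) = (C + 2) * (e / (C + 2))"
          by (simp add: distrib_right del: times_divide_eq_right)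
        also have "\<dots> = e" using C by simp
        finally show "(\<integral>\<^sup>+x. ennreal \<bar>f (\<phi> x) - f x\<bar> \<partial>lborel) \<le> ennreal e" .
      qed
    qed
  qed
  then show ?thesis using e by blast
qed

section \<open>Directional differentiability of Lipschitz functions\<close>

text \<open>Up to the case of equality, the points where the lower derivative of \<open>v\<close>
  along \<open>e\<close> is less than \<open>p\<close>; for \<open>- v\<close> and
  \<open>-q\<close>, those where the upper derivative exceeds \<open>q\<close>. As a countable
  intersection of unions over \<open>h\<close> it is a G_delta set when \<open>v\<close> is
  continuous.\<close>

definition below_set :: "('a::real_normed_vector \<Rightarrow> real) \<Rightarrow> 'a \<Rightarrow> real \<Rightarrow> 'a set" where
  "below_set v e p = (\<Inter>n. \<Union>h\<in>{h. h \<noteq> 0 \<and> \<bar>h\<bar> < 1 / real (Suc n)}. {x. (v (x + h *\<^sub>R e) - v x) / h < p})"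

lemma below_setD:
  assumes "x \<in> below_set v e p" "0 < d"
  obtains h where "h \<noteq> 0" "\<bar>h\<bar> < d" "(v (x + h *\<^sub>R e) - v x) / h < p"
proof -
  obtain n where n: "1 / real (Suc n) < d" using nat_approx_posE[OF assms(2)] by blast
  have "x \<in> (\<Union>h\<in>{h. h \<noteq> 0 \<and> \<bar>h\<bar> < 1 / real (Suc n)}. {x. (v (x + h *\<^sub>R e) - v x) / h < p})"
    using assms(1) unfolding below_set_def by blast
  then obtain h where "h \<noteq> 0" "\<bar>h\<bar> < 1 / real (Suc n)" "(v (x + h *\<^sub>R e) - v x) / h < p"
    by blast
  then show thesis using n by (intro that[of h]) auto
qed

lemma not_below_setD:
  assumes "x \<notin> below_set v e p"
  shows "\<forall>\<^sub>F h in at 0. p \<le> (v (x + h *\<^sub>R e) - v x) / h"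
proof -
  obtain n where n: "\<And>h. h \<noteq> 0 \<Longrightarrow> \<bar>h\<bar> < 1 / real (Suc n) \<Longrightarrow> \<not> (v (x + h *\<^sub>R e) - v x) / h < p"
    using assms unfolding below_set_def by blast
  show ?thesis
    unfolding eventually_at using n
    by (intro exI[of _ "1 / real (Suc n)"]) (auto simp: not_less)
qed

lemma below_set_borel:
  fixes v :: "'a::euclidean_space \<Rightarrow> real"
  assumes "continuous_on UNIV v"
  shows "below_set v e p \<in> sets borel"
proof -
  have "open {x. (v (x + h *\<^sub>R e) - v x) / h < p}" if "h \<noteq> 0" for h
    by (intro open_Collect_less continuous_intros continuous_on_compose2[OF assms]) (use that in auto)
  then have "open (\<Union>h\<in>{h. h \<noteq> 0 \<and> \<bar>h\<bar> < 1 / real (Suc n)}. {x. (v (x + h *\<^sub>R e) - v x) / h < p})" for n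
    by (intro open_UN) auto
  then show ?thesis unfolding below_set_def by (intro sets.countable_INT') auto
qed

lemma below_set_shift:
  "below_set (\<lambda>x::real. v x + c * x) 1 p = below_set v 1 (p - c)"
  unfolding below_set_def
proof (rule INF_cong[OF refl], rule SUP_cong[OF refl])
  fix n h assume "h \<in> {h. h \<noteq> 0 \<and> \<bar>h\<bar> < 1 / real (Suc n)}"
  then have "(v (x + h *\<^sub>R 1) + c * (x + h *\<^sub>R 1) - (v x + c * x)) / h = (v (x + h *\<^sub>R 1) - v x) / h + c" for x
    by (simp add: field_simps)
  then show "{x. (v (x + h *\<^sub>R 1) + c * (x + h *\<^sub>R 1) - (v x + c * x)) / h < p} =
      {x. (v (x + h *\<^sub>R 1) - v x) / h < p - c}" by auto
qed

text \<open>The image measure of \<open>G\<close> is compared with multiples of Lebesgue measure by Vitali coverings.\<close>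

lemma below_above_null_bilipschitz:
  fixes G :: "real \<Rightarrow> real"
  assumes G: "\<And>x y. x \<le> y \<Longrightarrow> y - x \<le> G y - G x" "\<And>x y. x \<le> y \<Longrightarrow> G y - G x \<le> K * (y - x)"
    and pq: "p < q"
  shows "below_set G 1 p \<inter> below_set (\<lambda>x. - G x) 1 (-q) \<in> null_sets lborel"
proof -
  have K: "1 \<le> K" using G(1)[of 0 1] G(2)[of 0 1] by simp
  have absG: "\<bar>y - x\<bar> \<le> \<bar>G y - G x\<bar>" "\<bar>G y - G x\<bar> \<le> K * \<bar>y - x\<bar>" for x y
    using G[of x y] G[of y x] by (cases "x \<le> y"; simp add: abs_if split: if_splits)+
  have lipG: "K-lipschitz_on UNIV G"
    by (rule lipschitz_onI) (use absG(2) K in \<open>auto simp: dist_real_def\<close>)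
  have contG: "continuous_on UNIV G" using lipG by (rule lipschitz_on_continuous_on)
  have inj: "inj G"
  proof (rule injI)
    fix x y assume "G x = G y" then show "x = y" using absG(1)[of x y] by simp
  qed
  have surj: "\<exists>x. G x = z" for z
  proof -
    let ?m = "\<bar>z - G 0\<bar>"
    have "\<exists>x\<ge>-?m. x \<le> ?m \<and> G x = z"
    proof (rule IVT')
      have "?m \<le> G 0 - G (- ?m)" using G(1)[of "-?m" 0] by simp
      then show "G (- ?m) \<le> z" by linarith
      have "?m \<le> G ?m - G 0" using G(1)[of 0 ?m] by simp
      then show "z \<le> G ?m" by linarith
    qed (use contG continuous_on_subset in auto)
    then show ?thesis by blast
  qed
  define \<phi> where "\<phi> = inv G"
  have inv: "\<phi> (G x) = x" "G (\<phi> x) = x" for x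
    using inj surj[of x] unfolding \<phi>_def by (auto simp: f_inv_into_f)
  have "1-lipschitz_on UNIV \<phi>"
    by (rule lipschitz_onI) (use absG(1)[of "\<phi> _" "\<phi> _"] in \<open>auto simp: dist_real_def inv\<close>)
  then have cont\<phi>: "continuous_on UNIV \<phi>" by (rule lipschitz_on_continuous_on)
  have comp: "compresses K \<phi>"
    using compresses_lipschitz_inverse[OF lipG cont\<phi>] inv by simp
  have mono: "G x \<le> G y \<longleftrightarrow> x \<le> y" for x y
    using G(1)[of x y] G(1)[of y x] by (cases "x \<le> y") auto
  \<comment> \<open>This is the Stieltjes measure of \<open>G\<close>: a ball is an interval, and
    its mass is the increment of \<open>G\<close> across it.\<close>
  define M where "M = distr lborel borel \<phi>"
  have Ms: "sets M = sets borel" unfolding M_def by simp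
  have emM: "emeasure M B = emeasure lborel (\<phi> -` B)" if "B \<in> sets borel" for B
    unfolding M_def using that compressesD(2)[OF comp] by (simp add: emeasure_distr)
  have Mball: "emeasure M (cball c r) = ennreal (G (c + r) - G (c - r))" if "0 \<le> r" for c r
  proof -
    have "\<phi> x \<in> cball c r \<longleftrightarrow> x \<in> {G (c - r)..G (c + r)}" for x
    proof -
      have "\<phi> x \<in> cball c r \<longleftrightarrow> c - r \<le> \<phi> x \<and> \<phi> x \<le> c + r"
        by (auto simp: dist_real_def)
      then show ?thesis using mono[of "c-r" "\<phi> x"] mono[of "\<phi> x" "c+r"] by (simp add: inv)
    qed
    then have "\<phi> -` cball c r = {G (c - r)..G (c + r)}"
      by (intro set_eqI) (simp only: vimage_eq)
    then show ?thesis using that mono by (simp add: emM)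
  qed
  have lball: "emeasure lborel (cball c r) = ennreal (2 * r)" if "0 \<le> r" for c r :: real
    using that by (simp add: cball_eq_atLeastAtMost)
  have MK: "emeasure M B \<le> ennreal K * emeasure lborel B" if "B \<in> sets borel" for B
    using compressesD(3)[OF comp that] by (simp add: emM that)
  let ?E = "below_set G 1 p \<inter> below_set (\<lambda>x. - G x) 1 (-q)"
  have E: "?E \<in> sets borel" using contG by (intro sets.Int below_set_borel continuous_intros)
  have sl: "1 \<le> (G (x + h) - G x) / h" if "h \<noteq> 0" for x h
    using G(1)[of x "x+h"] G(1)[of "x+h" x] that by (cases "0 < h") (simp_all add: le_divide_eq)
  show ?thesis
  \<comment> \<open>All difference quotients of \<open>G\<close> are at least 1, so the set is empty
    for \<open>p < 1\<close>. Otherwise \<open>p\<close> and \<open>q\<close> are positive, and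
    \<open>ennreal\<close> does not truncate them.\<close>
  proof (cases "1 \<le> p")
    case False
    have "x \<notin> below_set G 1 p" for x
    proof
      assume "x \<in> below_set G 1 p"
      then obtain h where "h \<noteq> 0" "(G (x + h *\<^sub>R 1) - G x) / h < p"
        using zero_less_one by (rule below_setD)
      then show False using sl[of h x] False by simp
    qed
    then have "below_set G 1 p = {}" by blast
    then show ?thesis by simp
  next
    case True
    \<comment> \<open>On a bounded piece the measure \<open>a\<close> is finite, so that
      \<open>q * a \<le> p * a\<close> with \<open>p < q\<close> forces
      \<open>a = 0\<close>.\<close>
    have "emeasure lborel (?E \<inter> {-real n..real n}) = 0" for n
    proof -
      let ?A = "?E \<inter> {-real n..real n}"
      have A: "?A \<in> sets borel" using E by auto
      let ?C = "K + \<bar>p\<bar> + \<bar>q\<bar>"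
      have C: "0 \<le> ?C" "K \<le> ?C" "p \<le> ?C" "q \<le> ?C" using K by auto
      \<comment> \<open>The ball with end points \<open>x\<close> and \<open>x + h\<close> turns the
        difference quotient at \<open>x\<close> into the ratio of the \<open>M\<close>-mass of the
        ball to its length.\<close>
      have fine: "\<exists>c r. 0 < r \<and> r < d \<and> x \<in> cball c r \<and> (G (c + r) - G (c - r)) / (2 * r) = (G (x + h) - G x) / h"
        if "h \<noteq> 0" "\<bar>h\<bar> < d" for x h d
      proof (intro exI conjI)
        show "0 < \<bar>h\<bar>/2" "\<bar>h\<bar>/2 < d" "x \<in> cball (x + h/2) (\<bar>h\<bar>/2)" using that by (auto simp: dist_real_def)
        show "(G (x + h/2 + \<bar>h\<bar>/2) - G (x + h/2 - \<bar>h\<bar>/2)) / (2 * (\<bar>h\<bar>/2)) = (G (x + h) - G x) / h"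
        proof (cases "0 < h")
          case True
          have "x + h/2 + h/2 = x + h" by simp
          then show ?thesis using True by (simp add: add.commute)
        next
          case False
          have "x + h/2 - - h/2 = x + h" by simp
          then have "(G (x + h/2 + \<bar>h\<bar>/2) - G (x + h/2 - \<bar>h\<bar>/2)) / (2 * (\<bar>h\<bar>/2)) = (G x - G (x + h)) / (- h)"
            using False by (simp add: add.commute)
          also have "\<dots> = (G (x + h) - G x) / h"
            using \<open>h \<noteq> 0\<close> by (simp add: field_simps)
          finally show ?thesis .
        qed
      qed
      have "emeasure M ?A \<le> emeasure (scale_measure (ennreal p) lborel) ?A"
      proof (rule vitali_measure_le[where C="?C"])
        show "emeasure M B = 0" if "B \<in> null_sets lborel" for B
          using MK[of B] null_setsD1[OF that] null_setsD2[OF that] by simp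
        show "emeasure (scale_measure (ennreal p) lborel) B \<le> ennreal ?C * emeasure lborel B" for B :: "real set"
          using C by (auto intro!: mult_right_mono ennreal_leI)
        fix x d :: real assume x: "x \<in> ?A" and d: "0 < d"
        obtain h where h: "h \<noteq> 0" "\<bar>h\<bar> < d" "(G (x + h *\<^sub>R 1) - G x) / h < p"
          using below_setD[of x G 1 p d] x d by blast
        obtain c r where r: "0 < r" "r < d" "x \<in> cball c r" "(G (c + r) - G (c - r)) / (2 * r) < p"
          using fine[OF h(1,2), of x] h(3) by auto
        then have "G (c + r) - G (c - r) \<le> p * (2 * r)" by (simp add: field_simps)
        then have "emeasure M (cball c r) \<le> emeasure (scale_measure (ennreal p) lborel) (cball c r)"
          using r True by (simp add: Mball lball ennreal_mult'[symmetric] ennreal_leI)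
        then show "\<exists>c r. 0 < r \<and> r < d \<and> x \<in> cball c r \<and>
            emeasure M (cball c r) \<le> emeasure (scale_measure (ennreal p) lborel) (cball c r)"
          using r by blast
      qed (use A Ms C in auto)
      moreover have "emeasure (scale_measure (ennreal q) lborel) ?A \<le> emeasure M ?A"
      proof (rule vitali_measure_le[where C="?C"])
        show "emeasure M B \<le> ennreal ?C * emeasure lborel B" if "B \<in> sets borel" for B
          by (rule order_trans[OF MK[OF that]]) (use C in \<open>auto intro!: mult_right_mono ennreal_leI\<close>)
        show "emeasure (scale_measure (ennreal q) lborel) B = 0" if "B \<in> null_sets lborel" for B
          using that by auto
        fix x d :: real assume x: "x \<in> ?A" and d: "0 < d"
        obtain h where h: "h \<noteq> 0" "\<bar>h\<bar> < d" "(- G (x + h *\<^sub>R 1) - - G x) / h < - q"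
          using below_setD[of x "\<lambda>x. - G x" 1 "- q" d] x d by blast
        have "(- G (x + h *\<^sub>R 1) - - G x) / h = - ((G (x + h) - G x) / h)"
          by (simp add: minus_divide_left)
        then obtain c r where r: "0 < r" "r < d" "x \<in> cball c r" "q < (G (c + r) - G (c - r)) / (2 * r)"
          using fine[OF h(1,2), of x] h(3) by auto
        then have "q * (2 * r) \<le> G (c + r) - G (c - r)" by (simp add: field_simps)
        then have "emeasure (scale_measure (ennreal q) lborel) (cball c r) \<le> emeasure M (cball c r)"
          using r True pq by (simp add: Mball lball ennreal_mult'[symmetric] ennreal_leI)
        then show "\<exists>c r. 0 < r \<and> r < d \<and> x \<in> cball c r \<and>
            emeasure (scale_measure (ennreal q) lborel) (cball c r) \<le> emeasure M (cball c r)"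
          using r by blast
      qed (use A Ms C in auto)
      ultimately have le: "ennreal q * emeasure lborel ?A \<le> ennreal p * emeasure lborel ?A" by simp
      have "emeasure lborel ?A < \<infinity>"
        by (intro emeasure_bounded_finite bounded_Int) simp
      then obtain a where a: "emeasure lborel ?A = ennreal a" "0 \<le> a" by (cases "emeasure lborel ?A") auto
      have "q * a \<le> p * a" using le a True pq by (simp add: ennreal_mult'[symmetric])
      then have "a = 0" using pq a(2) by (simp add: mult_le_cancel_right)
      then show ?thesis using a by simp
    qed
    then have "?E \<inter> {-real n..real n} \<in> null_sets lborel" for n using E by auto
    then have "(\<Union>n. ?E \<inter> {-real n..real n}) \<in> null_sets lborel" by (intro null_sets_UN) auto
    moreover have "(\<Union>n. ?E \<inter> {-real n..real n}) = ?E"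
    proof -
      have "\<exists>n. x \<in> {-real n..real n}" for x :: real
        using real_arch_simple[of "\<bar>x\<bar>"] by (auto simp: abs_le_iff intro: minus_le_iff[THEN iffD1])
      then show ?thesis by blast
    qed
    ultimately show ?thesis by simp
  qed
qed

text \<open>Adding \<open>(L + 1) * x\<close> makes the function increasing with slopes between 1
  and \<open>2 * L + 1\<close>, hence invertible. It shifts all difference quotients, and so both
  thresholds, by \<open>L + 1\<close>.\<close>

lemma below_above_null_real:
  fixes F :: "real \<Rightarrow> real"
  assumes F: "L-lipschitz_on UNIV F" and pq: "p < q"
  shows "below_set F 1 p \<inter> below_set (\<lambda>x. - F x) 1 (-q) \<in> null_sets lborel"
proof -
  let ?c = "L + 1"
  have ab: "\<bar>F y - F x\<bar> \<le> L * (y - x)" if "x \<le> y" for x y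
    using lipschitz_onD[OF F, of y x] that by (simp add: dist_real_def)
  have "below_set (\<lambda>x. F x + ?c * x) 1 (p + ?c) \<inter> below_set (\<lambda>x. - (F x + ?c * x)) 1 (-(q + ?c)) \<in> null_sets lborel"
  proof (rule below_above_null_bilipschitz[of _ "2 * L + 1"])
    fix x y :: real assume "x \<le> y"
    then show "y - x \<le> F y + ?c * y - (F x + ?c * x)"
      and "F y + ?c * y - (F x + ?c * x) \<le> (2 * L + 1) * (y - x)"
      using ab[of x y] by (auto simp: algebra_simps abs_le_iff)
  qed (use pq in auto)
  moreover have "(\<lambda>x. - (F x + ?c * x)) = (\<lambda>x. - F x + (- ?c) * x)" by (auto simp: algebra_simps)
  ultimately show ?thesis
    by (simp only: below_set_shift) (simp add: algebra_simps)
qed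

lemma nn_integral_lborel_translate:
  fixes F :: "'a::euclidean_space \<Rightarrow> ennreal"
  assumes [measurable]: "F \<in> borel_measurable borel"
  shows "(\<integral>\<^sup>+x. F (x + c) \<partial>lborel) = (\<integral>\<^sup>+x. F x \<partial>lborel)"
proof -
  have "(\<integral>\<^sup>+x. F x \<partial>lborel) = (\<integral>\<^sup>+x. F x \<partial>distr lborel borel ((+) c))"
    by (simp add: lborel_distr_plus)
  also have "\<dots> = (\<integral>\<^sup>+x. F (c + x) \<partial>lborel)" by (rule nn_integral_distr) auto
  finally show ?thesis by (simp add: add.commute)
qed

text \<open>By translation invariance, the measure of a set is the average over \<open>t\<close> of the measures
  of its translates by \<open>t *\<^sub>R e\<close>, so it vanishes when all sections along \<open>e\<close> are null.\<close>

lemma null_set_of_line_sections: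
  fixes E :: "'a::euclidean_space set"
  assumes [measurable]: "E \<in> sets borel" and sec: "\<And>x. {t. x + t *\<^sub>R e \<in> E} \<in> null_sets lborel"
  shows "E \<in> null_sets lborel"
proof -
  have "emeasure lborel E = (\<integral>\<^sup>+t. indicator {0..1::real} t * emeasure lborel E \<partial>lborel)"
    by (simp add: nn_integral_multc)
  also have "\<dots> = (\<integral>\<^sup>+t. indicator {0..1::real} t * (\<integral>\<^sup>+x. indicator E (x + t *\<^sub>R e) \<partial>lborel) \<partial>lborel)"
    by (simp add: nn_integral_lborel_translate)
  also have "\<dots> = (\<integral>\<^sup>+t. (\<integral>\<^sup>+x. indicator {0..1::real} t * indicator E (x + t *\<^sub>R e) \<partial>lborel) \<partial>lborel)"
    by (simp add: nn_integral_cmult)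
  also have "\<dots> = (\<integral>\<^sup>+x. (\<integral>\<^sup>+t. indicator {0..1::real} t * indicator E (x + t *\<^sub>R e) \<partial>lborel) \<partial>lborel)"
    by (rule lborel_pair.Fubini') measurable
  also have "\<dots> = (\<integral>\<^sup>+x. 0 \<partial>(lborel :: 'a measure))"
  proof (rule nn_integral_cong)
    fix x :: 'a
    have "AE t in lborel. t \<notin> {t. x + t *\<^sub>R e \<in> E}" using sec by (rule AE_not_in)
    then have "AE t in lborel. indicator {0..1::real} t * indicator E (x + t *\<^sub>R e) = (0::ennreal)"
      by eventually_elim auto
    then show "(\<integral>\<^sup>+t. indicator {0..1::real} t * indicator E (x + t *\<^sub>R e) \<partial>lborel) = 0"
      by (subst nn_integral_0_iff_AE) auto
  qed
  finally show ?thesis by (auto simp: null_sets_def)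
qed

text \<open>Restricted to a line in direction \<open>e\<close>, \<open>v\<close> becomes a Lipschitz
  function of one real variable, whose \<open>below_set\<close> is the section of the
  \<open>below_set\<close> of \<open>v\<close>.\<close>

lemma below_above_null:
  fixes v :: "'a::euclidean_space \<Rightarrow> real"
  assumes v: "L-lipschitz_on UNIV v" and pq: "p < q"
  shows "below_set v e p \<inter> below_set (\<lambda>x. - v x) e (-q) \<in> null_sets lborel"
proof (rule null_set_of_line_sections[where e=e])
  have "continuous_on UNIV v" using v by (rule lipschitz_on_continuous_on)
  then show "below_set v e p \<inter> below_set (\<lambda>x. - v x) e (-q) \<in> sets borel"
    by (intro sets.Int below_set_borel continuous_intros)
  fix x :: 'a
  have sec: "t \<in> below_set (\<lambda>t. w (x + t *\<^sub>R e)) 1 p \<longleftrightarrow> x + t *\<^sub>R e \<in> below_set w e p" for t p and w :: "'a \<Rightarrow> real"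
    unfolding below_set_def by (simp add: algebra_simps)
  have L0: "0 \<le> L" using v by (rule lipschitz_on_nonneg)
  have "(L * norm e)-lipschitz_on UNIV (\<lambda>t. v (x + t *\<^sub>R e))"
  proof (rule lipschitz_onI)
    fix s t :: real
    have "dist (v (x + s *\<^sub>R e)) (v (x + t *\<^sub>R e)) \<le> L * dist (x + s *\<^sub>R e) (x + t *\<^sub>R e)"
      by (rule lipschitz_onD[OF v]) auto
    also have "dist (x + s *\<^sub>R e) (x + t *\<^sub>R e) = norm e * dist s t"
      by (simp add: dist_norm scaleR_diff_left[symmetric])
    finally show "dist (v (x + s *\<^sub>R e)) (v (x + t *\<^sub>R e)) \<le> L * norm e * dist s t" by simp
  qed (use L0 in simp)
  from below_above_null_real[OF this pq]
  show "{t. x + t *\<^sub>R e \<in> below_set v e p \<inter> below_set (\<lambda>x. - v x) e (-q)} \<in> null_sets lborel"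
    by (simp add: sec[of _ v] sec[of _ "\<lambda>x. - v x"] Int_def)
qed

text \<open>The limit is the supremum of the eventual lower bounds. Between it and any larger number
  fit two rationals \<open>p < q\<close>; as \<open>p\<close> is no eventual lower bound,
  \<open>q\<close> is an eventual upper bound. Rational thresholds keep the number of exceptional
  null sets countable.\<close>

lemma tendsto_if_no_oscillation:
  fixes f :: "'a \<Rightarrow> real"
  assumes F: "F \<noteq> bot" and bd: "\<forall>\<^sub>F x in F. \<bar>f x\<bar> \<le> B"
    and osc: "\<And>p q. p \<in> \<rat> \<Longrightarrow> q \<in> \<rat> \<Longrightarrow> p < q \<Longrightarrow> (\<forall>\<^sub>F x in F. p \<le> f x) \<or> (\<forall>\<^sub>F x in F. f x \<le> q)"
  shows "\<exists>l. (f \<longlongrightarrow> l) F"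
proof -
  define S where "S = {p. \<forall>\<^sub>F x in F. p \<le> f x}"
  have "-B \<in> S" unfolding S_def using bd by (auto elim: eventually_mono)
  have le: "p \<le> B" if "p \<in> S" for p
  proof -
    have "\<forall>\<^sub>F x in F. p \<le> B"
      using that bd unfolding S_def mem_Collect_eq by eventually_elim auto
    then show ?thesis using F by (simp add: eventually_const)
  qed
  then have bdd: "bdd_above S" by (rule bdd_aboveI)
  have "(f \<longlongrightarrow> Sup S) F"
  proof (rule order_tendstoI)
    fix a assume "a < Sup S"
    then obtain p where "p \<in> S" "a < p" using \<open>-B \<in> S\<close> less_cSupE[of a S] by blast
    then show "\<forall>\<^sub>F x in F. a < f x" unfolding S_def by (auto elim: eventually_mono)
  next
    fix a assume "Sup S < a"
    then obtain q where q: "q \<in> \<rat>" "Sup S < q" "q < a" using Rats_dense_in_real by blast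
    then obtain p where p: "p \<in> \<rat>" "Sup S < p" "p < q" using Rats_dense_in_real by blast
    have "p \<notin> S" using p bdd cSup_upper[of p S] by auto
    then have "\<forall>\<^sub>F x in F. f x \<le> q" using osc[of p q] p q unfolding S_def by auto
    then show "\<forall>\<^sub>F x in F. f x < a" using q by (auto elim: eventually_mono)
  qed
  then show ?thesis by blast
qed

lemma lipschitz_quotient_bound:
  fixes v :: "'a::real_normed_vector \<Rightarrow> real"
  assumes v: "L-lipschitz_on UNIV v"
  shows "\<bar>(v (x + h *\<^sub>R e) - v x) / h\<bar> \<le> L * norm e"
proof (cases "h = 0")
  case True
  then show ?thesis using lipschitz_on_nonneg[OF v] by simp
next
  case False
  have "\<bar>v (x + h *\<^sub>R e) - v x\<bar> \<le> L * norm (h *\<^sub>R e)"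
    using lipschitz_onD[OF v, of "x + h *\<^sub>R e" x] by (simp add: dist_real_def dist_norm)
  then show ?thesis using False by (simp add: field_simps)
qed

proposition lipschitz_directional_derivative:
  fixes v :: "'a::euclidean_space \<Rightarrow> real"
  assumes v: "L-lipschitz_on UNIV v"
  obtains D where "D \<in> borel_measurable borel" "\<forall>x. \<bar>D x\<bar> \<le> L * norm e"
    "AE x in lborel. ((\<lambda>t. v (x + t *\<^sub>R e)) has_real_derivative D x) (at 0)"
proof -
  have L0: "0 \<le> L" using v by (rule lipschitz_on_nonneg)
  have contv: "continuous_on UNIV v" using v by (rule lipschitz_on_continuous_on)
  note [measurable] = borel_measurable_continuous_onI[OF contv]
  let ?q = "\<lambda>x h. (v (x + h *\<^sub>R e) - v x) / h"
  note bd = lipschitz_quotient_bound[OF v]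
  have "AE x in lborel. \<forall>p\<in>\<rat>. \<forall>q\<in>\<rat>. p < q \<longrightarrow> x \<notin> below_set v e p \<inter> below_set (\<lambda>x. - v x) e (-q)"
    by (intro AE_ball_countable[THEN iffD2] ballI countable_rat AE_impI AE_not_in below_above_null[OF v])
  then have lim: "AE x in lborel. \<exists>l. (?q x \<longlongrightarrow> l) (at 0)"
  proof eventually_elim
    case (elim x)
    show ?case
    proof (rule tendsto_if_no_oscillation[where B="L * norm e"])
      fix p q :: real assume "p \<in> \<rat>" "q \<in> \<rat>" "p < q"
      then have "x \<notin> below_set v e p \<or> x \<notin> below_set (\<lambda>x. - v x) e (-q)" using elim by blast
      then show "(\<forall>\<^sub>F h in at 0. p \<le> ?q x h) \<or> (\<forall>\<^sub>F h in at 0. ?q x h \<le> q)"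
      proof
        assume "x \<notin> below_set (\<lambda>x. - v x) e (-q)"
        from not_below_setD[OF this] have "\<forall>\<^sub>F h in at 0. ?q x h \<le> q"
          by (rule eventually_mono) (simp add: diff_divide_distrib)
        then show ?thesis ..
      qed (use not_below_setD in blast)
    qed (use bd in auto)
  qed
  \<comment> \<open>The limit is taken along \<open>h = 1 / real (Suc n)\<close> and clamped, so
    \<open>D\<close> is Borel and obeys the bound everywhere, also where there is no derivative and
    \<open>lim\<close> is an arbitrary value.\<close>
  define D where "D x = max (- (L * norm e)) (min (L * norm e) (lim (\<lambda>n. ?q x (1 / real (Suc n)))))" for x
  show thesis
  proof (rule that)
    show "D \<in> borel_measurable borel" unfolding D_def by measurable
    show "\<forall>x. \<bar>D x\<bar> \<le> L * norm e" unfolding D_def using L0 by (auto simp: abs_le_iff min_def max_def)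
    show "AE x in lborel. ((\<lambda>t. v (x + t *\<^sub>R e)) has_real_derivative D x) (at 0)"
      using lim
    proof eventually_elim
      case (elim x)
      then obtain l where l: "(?q x \<longlongrightarrow> l) (at 0)" by blast
      have "filterlim (\<lambda>n. 1 / real (Suc n)) (at 0) sequentially"
        unfolding filterlim_at using LIMSEQ_Suc[OF lim_1_over_n] by auto
      then have "(\<lambda>n. ?q x (1 / real (Suc n))) \<longlonglongrightarrow> l" by (rule filterlim_compose[OF l])
      then have "lim (\<lambda>n. ?q x (1 / real (Suc n))) = l" by (rule limI)
      moreover have "\<bar>l\<bar> \<le> L * norm e"
        by (rule tendsto_upperbound[OF tendsto_rabs[OF l]]) (use bd in auto)
      ultimately have "D x = l" unfolding D_def by (auto simp: abs_le_iff)
      then show ?case using l by (simp add: DERIV_def)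
    qed
  qed
qed

text \<open>By translation invariance every difference quotient of \<open>v\<close> has integral
  zero. The Lipschitz bound on the ball of radius \<open>R + norm e\<close>, which contains the
  supports for increments up to 1, dominates them, so the limit has integral zero as well.\<close>

lemma integral_directional_derivative:
  fixes v :: "'a::euclidean_space \<Rightarrow> real"
  assumes v: "L-lipschitz_on UNIV v" and supp: "\<And>x. R < norm x \<Longrightarrow> v x = 0"
    and D[measurable]: "D \<in> borel_measurable borel"
    and deriv: "AE x in lborel. ((\<lambda>t. v (x + t *\<^sub>R e)) has_real_derivative D x) (at 0)"
  shows "integrable lborel D" "integral\<^sup>L lborel D = 0"
proof -
  have contv: "continuous_on UNIV v" using v by (rule lipschitz_on_continuous_on)
  note [measurable] = borel_measurable_continuous_onI[OF contv]
  let ?q = "\<lambda>n x. (v (x + (1 / real (Suc n)) *\<^sub>R e) - v x) / (1 / real (Suc n))"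
  let ?w = "\<lambda>x. L * norm e * indicator (cball 0 (R + norm e)) x"
  have w: "integrable lborel ?w"
    using emeasure_lborel_cball_finite by (intro integrable_mult_right integrable_real_indicator) auto
  have "integrable lborel (\<lambda>x. indicator (cball 0 R) x *\<^sub>R v x)"
    by (rule borel_integrable_compact) (auto intro: continuous_on_subset[OF contv])
  then have iv: "integrable lborel v"
    by (rule Bochner_Integration.integrable_cong[THEN iffD1, rotated 2])
      (use supp in \<open>auto simp: indicator_def not_le\<close>)
  have bd: "norm (?q n x) \<le> ?w x" for n x
  proof (cases "x \<in> cball 0 (R + norm e)")
    case True
    then show ?thesis
      using lipschitz_quotient_bound[OF v, of x "1 / real (Suc n)" e] by simp
  next
    case False
    then have 1: "R < norm x" using norm_ge_zero[of e] by (simp del: norm_ge_zero)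
    have "norm x \<le> norm (x + (1 / real (Suc n)) *\<^sub>R e) + norm ((1 / real (Suc n)) *\<^sub>R e)"
      by (metis add_diff_cancel norm_triangle_ineq4)
    moreover have "norm ((1 / real (Suc n)) *\<^sub>R e) \<le> norm e"
      by (simp add: field_simps mult_left_le)
    ultimately have "R < norm (x + (1 / real (Suc n)) *\<^sub>R e)" using False by simp
    then show ?thesis using 1 False by (simp add: supp)
  qed
  have lim: "AE x in lborel. (\<lambda>n. ?q n x) \<longlonglongrightarrow> D x"
    using deriv
  proof eventually_elim
    case (elim x)
    have "filterlim (\<lambda>n. 1 / real (Suc n)) (at 0) sequentially"
      unfolding filterlim_at using LIMSEQ_Suc[OF lim_1_over_n] by auto
    moreover have "((\<lambda>h. (v (x + h *\<^sub>R e) - v x) / h) \<longlongrightarrow> D x) (at 0)"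
      using elim by (simp add: DERIV_def)
    ultimately show ?case by (rule filterlim_compose[rotated])
  qed
  have int0: "integral\<^sup>L lborel (?q n) = 0" for n
  proof -
    have iv': "integrable lborel (\<lambda>x. v (c + x))" for c
      using lborel_integrable_real_affine iv integrable_distr_eq[of "(+) c" lborel borel v]
      by (simp add: lborel_distr_plus)
    have "integral\<^sup>L lborel v = integral\<^sup>L lborel (\<lambda>x. v (c + x))" for c
      using integral_distr[of "(+) c" lborel borel v] by (simp add: lborel_distr_plus)
    from this[symmetric] have "integral\<^sup>L lborel (\<lambda>x. v (x + c)) = integral\<^sup>L lborel v" for c
      by (subst add.commute)
    moreover have "integrable lborel (\<lambda>x. v (x + c))" for c
      using iv'[of c] by (subst add.commute)
    ultimately show ?thesis using iv by simp
  qed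
  show "integrable lborel D"
    by (rule integrable_dominated_convergence[OF _ _ w lim]) (use bd in auto)
  have "(\<lambda>n. integral\<^sup>L lborel (?q n)) \<longlonglongrightarrow> integral\<^sup>L lborel D"
    by (rule integral_dominated_convergence[OF _ _ w lim]) (use bd in auto)
  then show "integral\<^sup>L lborel D = 0" using int0 by (simp add: LIMSEQ_const_iff)
qed

section \<open>A smooth mollifier\<close>

text \<open>The function \<open>exp (- (1 / t))\<close>, flat at 0, with polynomial factors in
  \<open>1 / t\<close> adjoined so that the family is closed under differentiation.\<close>

definition exp_recip :: "real poly \<Rightarrow> real \<Rightarrow> real" where
  "exp_recip p t = (if 0 < t then poly p (1 / t) * exp (- (1 / t)) else 0)"

text \<open>With \<open>s = 1 / t\<close>, whose derivative is \<open>- (s ^ 2)\<close>, the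
  derivative of \<open>poly p s * exp (- s)\<close> in \<open>t\<close> is
  \<open>s ^ 2 * poly (p - pderiv p) s * exp (- s)\<close>.\<close>

definition exp_recip_deriv :: "real poly \<Rightarrow> real poly" where
  "exp_recip_deriv p = [:0, 0, 1:] * (p - pderiv p)"

lemma poly_times_exp_tendsto_0:
  "((\<lambda>s::real. poly p s * exp (- s)) \<longlongrightarrow> 0) at_top"
proof -
  have "((\<lambda>s. \<Sum>i\<le>degree p. coeff p i * (s ^ i / exp s)) \<longlongrightarrow> (\<Sum>i\<le>degree p. coeff p i * 0)) at_top"
    by (intro tendsto_intros tendsto_power_div_exp_0)
  then show ?thesis
    by (simp add: poly_altdef sum_distrib_right exp_minus divide_inverse mult.assoc)
qed

lemma exp_recip_has_derivative:
  "(exp_recip p has_real_derivative exp_recip (exp_recip_deriv p) t) (at t)"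
proof -
  consider "0 < t" | "t < 0" | "t = 0" by linarith
  then show ?thesis
  proof cases
    case 1
    have "((\<lambda>t. poly p (1 / t) * exp (- (1 / t))) has_real_derivative exp_recip (exp_recip_deriv p) t) (at t)"
      using 1 unfolding exp_recip_def exp_recip_deriv_def
      by (auto intro!: derivative_eq_intros DERIV_chain2[OF poly_DERIV] simp: field_simps power2_eq_square)
    moreover have "\<forall>\<^sub>F s in nhds t. exp_recip p s = poly p (1 / s) * exp (- (1 / s))"
      using eventually_nhds_in_open[of "{0<..}" t] 1
      by (auto simp: exp_recip_def elim: eventually_mono)
    ultimately show ?thesis by (subst DERIV_cong_ev[OF refl _ refl])
  next
    case 2
    have "\<forall>\<^sub>F s in nhds t. exp_recip p s = 0"
      using eventually_nhds_in_open[of "{..<0}" t] 2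
      by (auto simp: exp_recip_def elim: eventually_mono)
    then have "(exp_recip p has_real_derivative 0) (at t)" by (subst DERIV_cong_ev[OF refl _ refl]) auto
    then show ?thesis using 2 by (simp add: exp_recip_def)
  next
    case 3
    \<comment> \<open>The right difference quotient at 0 is \<open>s * poly p s * exp (- s)\<close>
      with \<open>s = 1 / h\<close> tending to infinity; the left one vanishes.\<close>
    have "((\<lambda>h. poly ([:0, 1:] * p) (inverse h) * exp (- inverse h)) \<longlongrightarrow> 0) (at_right 0)"
      by (rule filterlim_compose[OF poly_times_exp_tendsto_0 filterlim_inverse_at_top_right])
    then have "((\<lambda>h. exp_recip p h / h) \<longlongrightarrow> 0) (at_right 0)"
      by (rule tendsto_cong[THEN iffD1, rotated])
        (auto simp: eventually_at_filter exp_recip_def divide_inverse mult_ac)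
    moreover have "((\<lambda>h. exp_recip p h / h) \<longlongrightarrow> 0) (at_left 0)"
      by (rule tendsto_cong[THEN iffD1, OF _ tendsto_const])
        (auto simp: eventually_at_filter exp_recip_def)
    ultimately have "((\<lambda>h. exp_recip p h / h) \<longlongrightarrow> 0) (at 0)"
      by (rule filterlim_split_at[rotated])
    then show ?thesis using 3 by (simp add: DERIV_def exp_recip_def)
  qed
qed

lemma exp_recip_continuous: "continuous_on UNIV (exp_recip p)"
  by (meson DERIV_isCont continuous_at_imp_continuous_on exp_recip_has_derivative)

lemma exp_recip_bounded: "\<exists>B. \<forall>t\<le>1. \<bar>exp_recip p t\<bar> \<le> B"
proof -
  have "compact (exp_recip p ` {0..1})"
    by (intro compact_continuous_image continuous_on_subset[OF exp_recip_continuous]) auto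
  then obtain B where B: "\<And>t. t \<in> {0..1} \<Longrightarrow> \<bar>exp_recip p t\<bar> \<le> B"
    using compact_imp_bounded bounded_iff by (metis imageI real_norm_def)
  have "\<bar>exp_recip p t\<bar> \<le> B" if "t \<le> 1" for t
    using B[of t] B[of 0] that by (cases "0 < t") (auto simp: exp_recip_def)
  then show ?thesis by blast
qed

section \<open>Calculus of the classes \<open>C_k\<close>\<close>

lemma partial_deriv_eqI:
  "((\<lambda>t. u (x + t *\<^sub>R axis i 1)) has_real_derivative d) (at 0) \<Longrightarrow> partial_deriv i u x = d"
  unfolding partial_deriv_def by (rule DERIV_imp_deriv)

lemma C_k_SucI:
  assumes "continuous_on UNIV u"
    and "\<And>i x. ((\<lambda>t. u (x + t *\<^sub>R axis i 1)) has_real_derivative d i x) (at 0)"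
    and "\<And>i. C_k k (d i)"
  shows "C_k (Suc k) u"
proof -
  have "partial_deriv i u = d i" for i by (rule ext) (rule partial_deriv_eqI[OF assms(2)])
  then show ?thesis using assms by (auto simp: real_differentiable_def)
qed

lemma C_k_SucD:
  assumes "C_k (Suc k) u"
  shows "continuous_on UNIV u" "C_k k (partial_deriv i u)"
    "((\<lambda>t. u (x + t *\<^sub>R axis i 1)) has_real_derivative partial_deriv i u x) (at 0)"
  using assms by (auto simp: partial_deriv_def DERIV_deriv_iff_real_differentiable)

text \<open>The product rule leaves one factor undifferentiated, and the induction for products then
  uses that factor at one order less.\<close>

lemma C_k_Suc_imp: "C_k (Suc k) u \<Longrightarrow> C_k k u"
proof (induction k arbitrary: u)
  case (Suc k)
  show ?case
    by (rule C_k_SucI[OF C_k_SucD(1)[OF Suc.prems] C_k_SucD(3)[OF Suc.prems]])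
      (rule Suc.IH[OF C_k_SucD(2)[OF Suc.prems]])
qed auto

lemma C_k_const: "C_k k (\<lambda>x. c)"
proof (induction k arbitrary: c)
  case (Suc k)
  show ?case by (rule C_k_SucI[where d="\<lambda>_ _. 0"]) (use Suc in auto)
qed auto

lemma C_k_coord: "C_k k (\<lambda>x. x $ j)"
proof (cases k)
  case (Suc l)
  have "((\<lambda>t. (x + t *\<^sub>R axis i 1) $ j) has_real_derivative axis i 1 $ j) (at 0)" for x i
    by (auto intro!: derivative_eq_intros)
  then show ?thesis unfolding Suc
    by (intro C_k_SucI[where d="\<lambda>i _. axis i 1 $ j"] C_k_const continuous_intros)
qed (auto intro!: continuous_intros)

lemma C_k_add:
  assumes "C_k k u" "C_k k v"
  shows "C_k k (\<lambda>x. u x + v x)"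
  using assms
proof (induction k arbitrary: u v)
  case (Suc k)
  note u = C_k_SucD[OF Suc.prems(1)] and v = C_k_SucD[OF Suc.prems(2)]
  show ?case
    by (rule C_k_SucI[where d="\<lambda>i x. partial_deriv i u x + partial_deriv i v x"])
      (auto intro!: Suc.IH u v continuous_intros derivative_eq_intros)
qed (auto intro!: continuous_intros)

lemma C_k_mult:
  assumes "C_k k u" "C_k k v"
  shows "C_k k (\<lambda>x. u x * v x)"
  using assms
proof (induction k arbitrary: u v)
  case (Suc k)
  note u = C_k_SucD[OF Suc.prems(1)] and v = C_k_SucD[OF Suc.prems(2)]
  have uk: "C_k k u" "C_k k v" using Suc.prems by (auto intro!: C_k_Suc_imp simp del: C_k.simps)
  have d: "((\<lambda>t. u (x + t *\<^sub>R axis i 1) * v (x + t *\<^sub>R axis i 1)) has_real_derivative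
      (partial_deriv i u x * v x + u x * partial_deriv i v x)) (at 0)" for i x
    by (rule DERIV_cong[OF DERIV_mult[OF u(3) v(3)]]) (simp add: algebra_simps)
  show ?case
    by (rule C_k_SucI[where d="\<lambda>i x. partial_deriv i u x * v x + u x * partial_deriv i v x"])
      (auto intro!: d C_k_add Suc.IH u(1,2) v(1,2) uk continuous_intros)
qed (auto intro!: continuous_intros)

section \<open>The bump function and its size\<close>

definition bump_arg :: "real \<Rightarrow> real ^ 'n \<Rightarrow> real" where
  "bump_arg h z = 1 - (norm z)\<^sup>2 / h\<^sup>2"

text \<open>The standard bump \<open>exp (- 1 / (1 - (norm z / h) ^ 2))\<close> on the ball of
  radius \<open>h\<close>. The inner function is quadratic in the coordinates, so the corner of the
  norm at 0 does not appear.\<close>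

definition bump :: "real \<Rightarrow> real ^ 'n \<Rightarrow> real" where
  "bump h z = exp_recip 1 (bump_arg h z)"

definition bump_grad :: "real \<Rightarrow> real ^ 'n \<Rightarrow> real ^ 'n" where
  "bump_grad h z = (exp_recip (exp_recip_deriv 1) (bump_arg h z) * (- 2 / h\<^sup>2)) *\<^sub>R z"

lemma bump_arg_has_derivative:
  fixes z :: "real ^ 'n"
  shows "(bump_arg h has_derivative (\<lambda>w. (- 2 / h\<^sup>2) * (z \<bullet> w))) (at z)"
proof -
  have "((\<lambda>z :: real ^ 'n. 1 - (z \<bullet> z) / h\<^sup>2) has_derivative (\<lambda>w. (- 2 / h\<^sup>2) * (z \<bullet> w))) (at z)"
    by (auto intro!: derivative_eq_intros simp: inner_commute divide_inverse algebra_simps)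
  then show ?thesis unfolding bump_arg_def[abs_def] power2_norm_eq_inner .
qed

lemma bump_has_derivative: "(bump h has_derivative (\<lambda>w. bump_grad h z \<bullet> w)) (at z)"
proof -
  have "((\<lambda>z. exp_recip 1 (bump_arg h z)) has_derivative
      (\<lambda>w. (- 2 / h\<^sup>2) * (z \<bullet> w) * exp_recip (exp_recip_deriv 1) (bump_arg h z))) (at z)"
    by (rule has_derivative_compose[OF bump_arg_has_derivative,
          OF exp_recip_has_derivative[unfolded has_field_derivative_def], THEN has_derivative_eq_rhs])
      (auto simp: mult_ac)
  then show ?thesis
    unfolding bump_def[abs_def] bump_grad_def by (simp add: mult_ac)
qed

lemma bump_arg_le: "bump_arg h z \<le> 1"
  unfolding bump_arg_def by simp

lemma bump_outside:
  assumes "0 < h" "h \<le> norm z"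
  shows "bump h z = 0" "bump_grad h z = 0"
proof -
  have "h\<^sup>2 \<le> (norm z)\<^sup>2" using assms by (intro power_mono) auto
  then have "bump_arg h z \<le> 0" using assms unfolding bump_arg_def by (simp add: field_simps)
  then show "bump h z = 0" "bump_grad h z = 0" unfolding bump_def bump_grad_def exp_recip_def by auto
qed

lemma bump_arg_continuous: "continuous_on UNIV (bump_arg h)"
  by (rule has_derivative_continuous_on) (rule has_derivative_at_withinI[OF bump_arg_has_derivative])

lemma bump_continuous: "continuous_on UNIV (bump h)"
  unfolding bump_def
  by (rule continuous_on_compose2[OF exp_recip_continuous bump_arg_continuous]) auto

lemma bump_grad_continuous: "continuous_on UNIV (bump_grad h)"
  unfolding bump_grad_def
  by (intro continuous_intros continuous_on_compose2[OF exp_recip_continuous bump_arg_continuous]) auto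

text \<open>The constant is independent of \<open>h\<close>: the values depend only on
  \<open>bump_arg\<close>, which is at most 1, and in the gradient the factor
  \<open>2 / h ^ 2\<close> meets \<open>norm z < h\<close>.\<close>

lemma bump_bounds:
  "\<exists>B>0. \<forall>h>0. \<forall>z :: real ^ 'n. \<bar>bump h z\<bar> \<le> B \<and> norm (bump_grad h z) \<le> B / h"
proof -
  obtain B0 where B0: "\<And>t. t \<le> 1 \<Longrightarrow> \<bar>exp_recip 1 t\<bar> \<le> B0" using exp_recip_bounded by blast
  obtain B1 where B1: "\<And>t. t \<le> 1 \<Longrightarrow> \<bar>exp_recip (exp_recip_deriv 1) t\<bar> \<le> B1" using exp_recip_bounded by blast
  have B1p: "0 \<le> B1" using B1[of 0] by (simp add: exp_recip_def)
  let ?B = "max 1 (max B0 (2 * B1))"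
  show ?thesis
  proof (intro exI[of _ ?B] conjI allI impI)
    fix h :: real and z :: "real ^ 'n" assume h: "0 < h"
    show "\<bar>bump h z\<bar> \<le> ?B" using B0[OF bump_arg_le, of h z] unfolding bump_def by linarith
    show "norm (bump_grad h z) \<le> ?B / h"
    proof (cases "h \<le> norm z")
      case True
      then show ?thesis using bump_outside[OF h True] h by simp
    next
      case False
      have "norm (bump_grad h z) = \<bar>exp_recip (exp_recip_deriv 1) (bump_arg h z)\<bar> * (2 / h\<^sup>2) * norm z"
        unfolding bump_grad_def by (simp add: abs_mult)
      also have "\<dots> \<le> B1 * (2 / h\<^sup>2) * h"
        using False h B1[OF bump_arg_le, of h z] B1p by (intro mult_mono) auto
      also have "\<dots> = (2 * B1) / h" using h by (simp add: power2_eq_square field_simps)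
      also have "\<dots> \<le> ?B / h" using h by (intro divide_right_mono) auto
      finally show ?thesis .
    qed
  qed simp
qed

lemma bump_integrable:
  assumes "0 < h"
  shows "integrable lborel (bump h :: real ^ 'n \<Rightarrow> real)"
proof -
  have "integrable lborel (\<lambda>z :: real ^ 'n. indicator (cball 0 h) z *\<^sub>R bump h z)"
    by (rule borel_integrable_compact) (auto intro: continuous_on_subset[OF bump_continuous])
  then show ?thesis
    by (rule Bochner_Integration.integrable_cong[THEN iffD1, rotated 2])
      (auto simp: indicator_def not_le intro!: bump_outside(1)[OF assms])
qed

text \<open>On the ball of radius \<open>h / 2\<close> the argument is at least 3/4, so the bump is
  at least \<open>exp (- 4 / 3)\<close>, and halving the radius divides the volume by
  \<open>2 ^ CARD('n)\<close>. This ties the normalising constant to the volume of the ball.\<close>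

lemma bump_integral_ge:
  assumes h: "0 < h"
  shows "exp (- 4 / 3) / 2 ^ CARD('n) * measure lborel (cball (0 :: real ^ 'n) h) \<le> integral\<^sup>L lborel (bump h :: real ^ 'n \<Rightarrow> real)"
proof -
  let ?b = "cball (0 :: real ^ 'n) (h / 2)"
  have ge: "exp (- 4 / 3) * indicator ?b z \<le> bump h z" for z :: "real ^ 'n"
  proof (cases "z \<in> ?b")
    case True
    then have "(norm z)\<^sup>2 \<le> (h / 2)\<^sup>2" by (intro power_mono) auto
    then have "3 / 4 \<le> bump_arg h z" using h unfolding bump_arg_def by (simp add: field_simps power2_eq_square)
    then have "1 / bump_arg h z \<le> 4 / 3" "0 < bump_arg h z" by (auto simp: field_simps)
    then show ?thesis using True unfolding bump_def exp_recip_def by simp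
  qed (simp add: bump_def exp_recip_def)
  have "exp (- 4 / 3) * measure lborel ?b = (LBINT z. exp (- 4 / 3) * indicator ?b z)"
    by simp
  also have "\<dots> \<le> integral\<^sup>L lborel (bump h :: real ^ 'n \<Rightarrow> real)"
    using emeasure_lborel_cball_finite[of "0 :: real ^ 'n" "h/2"]
    by (intro integral_mono bump_integrable[OF h] integrable_mult_right integrable_real_indicator ge) auto
  also have "measure lborel ?b = measure lborel (cball (0 :: real ^ 'n) h) / 2 ^ CARD('n)"
    using h by (simp add: content_cball power_divide)
  finally show ?thesis by simp
qed

lemma ball_vol_pos: "0 < h \<Longrightarrow> 0 < measure lborel (cball (0 :: real ^ 'n) h)"
  by (rule content_cball_pos)

lemma bump_integral_pos:
  assumes h: "0 < h"
  shows "0 < integral\<^sup>L lborel (bump h :: real ^ 'n \<Rightarrow> real)"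
  by (rule less_le_trans[OF _ bump_integral_ge[OF h]]) (use ball_vol_pos[OF h] in simp)

definition mollifier :: "real \<Rightarrow> real ^ 'n \<Rightarrow> real" where
  "mollifier h z = bump h z / integral\<^sup>L lborel (bump h :: real ^ 'n \<Rightarrow> real)"

definition mollifier_grad :: "real \<Rightarrow> real ^ 'n \<Rightarrow> real ^ 'n" where
  "mollifier_grad h z = bump_grad h z /\<^sub>R integral\<^sup>L lborel (bump h :: real ^ 'n \<Rightarrow> real)"

text \<open>One \<open>B\<close> serves all \<open>h\<close>: values are of the order of the inverse
  ball volume, and a gradient costs one further factor \<open>1 / h\<close>.\<close>

lemma mollifier_bounds:
  "\<exists>B>0. \<forall>h>0. \<forall>z :: real ^ 'n. \<bar>mollifier h z\<bar> \<le> B / measure lborel (cball (0 :: real ^ 'n) h) \<and>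
    h * norm (mollifier_grad h z) \<le> B / measure lborel (cball (0 :: real ^ 'n) h)"
proof -
  obtain B where B0: "B > 0" "\<forall>h>0. \<forall>z :: real ^ 'n. \<bar>bump h z\<bar> \<le> B \<and> norm (bump_grad h z) \<le> B / h"
    using bump_bounds[where 'n='n] by blast
  note B = B0(1) B0(2)[rule_format, THEN conjunct1] B0(2)[rule_format, THEN conjunct2]
  define c :: real where "c = exp (- 4 / 3) / 2 ^ CARD('n)"
  have c: "0 < c" unfolding c_def by simp
  have I: "B / integral\<^sup>L lborel (bump h :: real ^ 'n \<Rightarrow> real) \<le> (B / c) / measure lborel (cball (0 :: real ^ 'n) h)"
    if "0 < h" for h
  proof -
    have "B / integral\<^sup>L lborel (bump h :: real ^ 'n \<Rightarrow> real) \<le> B / (c * measure lborel (cball (0 :: real ^ 'n) h))"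
      using bump_integral_ge[OF that, where 'n='n] ball_vol_pos[OF that, where 'n='n] B(1) c
      unfolding c_def[symmetric] by (intro frac_le mult_pos_pos) auto
    then show ?thesis by simp
  qed
  show ?thesis
  proof (intro exI[of _ "B / c"] conjI allI impI)
    show "0 < B / c" using B c by simp
    fix h :: real and z :: "real ^ 'n" assume h: "0 < h"
    note J = bump_integral_pos[OF h, where 'n='n]
    have "\<bar>mollifier h z\<bar> \<le> B / integral\<^sup>L lborel (bump h :: real ^ 'n \<Rightarrow> real)"
      unfolding mollifier_def using J B(2)[OF h] by (simp add: divide_right_mono)
    then show "\<bar>mollifier h z\<bar> \<le> B / c / measure lborel (cball (0 :: real ^ 'n) h)" using I[OF h] by linarith
    have "h * norm (bump_grad h z) \<le> B" using B(3)[OF h, of z] h by (simp add: field_simps)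
    then have "h * norm (mollifier_grad h z) \<le> B / integral\<^sup>L lborel (bump h :: real ^ 'n \<Rightarrow> real)"
      unfolding mollifier_grad_def using J by (simp add: field_simps)
    then show "h * norm (mollifier_grad h z) \<le> B / c / measure lborel (cball (0 :: real ^ 'n) h)" using I[OF h] by linarith
  qed
qed

lemma mollifier_outside:
  assumes "0 < h" "h \<le> norm z"
  shows "mollifier h z = 0" "mollifier_grad h z = 0"
  using bump_outside[OF assms] by (simp_all add: mollifier_def mollifier_grad_def)

lemma mollifier_has_derivative: "(mollifier h has_derivative (\<lambda>w. mollifier_grad h z \<bullet> w)) (at z)"
  unfolding mollifier_def[abs_def] mollifier_grad_def divide_inverse
  by (rule has_derivative_eq_rhs[OF has_derivative_mult_left[OF bump_has_derivative]]) (simp add: mult.commute)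

lemma mollifier_continuous: "continuous_on UNIV (mollifier h)"
  unfolding mollifier_def divide_inverse by (intro continuous_intros bump_continuous)

lemma mollifier_grad_continuous: "continuous_on UNIV (mollifier_grad h)"
  unfolding mollifier_grad_def by (intro continuous_intros bump_grad_continuous)

lemma mollifier_integral:
  assumes "0 < h"
  shows "integral\<^sup>L lborel (mollifier h :: real ^ 'n \<Rightarrow> real) = 1"
  unfolding mollifier_def using bump_integral_pos[OF assms, where 'n='n] by simp

text \<open>The induction on \<open>k\<close> runs over all polynomials at once: a partial
  derivative of \<open>exp_recip p\<close> composed with the quadratic is of the same type for
  another polynomial, times an affine function of one coordinate.\<close>

lemma C_k_mollifier:
  fixes x :: "real ^ 'n"
  shows "C_k k (\<lambda>y. mollifier h (x - y))"
proof -
  let ?q = "\<lambda>y :: real ^ 'n. bump_arg h (x - y)"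
  have eq: "?q = (\<lambda>y. 1 + (- 1 / h\<^sup>2) * (\<Sum>j\<in>UNIV. (y $ j + - x $ j) * (y $ j + - x $ j)))"
  proof
    fix y
    have "(norm (x - y))\<^sup>2 = (\<Sum>j\<in>UNIV. (y $ j + - x $ j) * (y $ j + - x $ j))"
      unfolding power2_norm_eq_inner inner_vec_def by (intro sum.cong) (auto simp: algebra_simps)
    then show "?q y = 1 + (- 1 / h\<^sup>2) * (\<Sum>j\<in>UNIV. (y $ j + - x $ j) * (y $ j + - x $ j))"
      by (simp add: bump_arg_def)
  qed
  have "continuous_on UNIV ?q"
    unfolding eq by (intro continuous_intros)
  have dq: "((\<lambda>t. ?q (y + t *\<^sub>R axis i 1)) has_real_derivative (- 2 / h\<^sup>2) * (y $ i + - x $ i)) (at 0)" for i and y :: "real ^ 'n"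
  proof -
    have "((\<lambda>t. x - (y + t *\<^sub>R axis i 1)) has_derivative (\<lambda>t. - (t *\<^sub>R axis i 1))) (at 0)"
      by (auto intro!: derivative_eq_intros)
    moreover have "(bump_arg h has_derivative (\<lambda>w. (- 2 / h\<^sup>2) * ((x - y) \<bullet> w))) (at (x - (y + 0 *\<^sub>R axis i 1)))"
      using bump_arg_has_derivative[of h "x - y"] by simp
    ultimately have "((\<lambda>t. ?q (y + t *\<^sub>R axis i 1)) has_derivative (\<lambda>t. (- 2 / h\<^sup>2) * ((x - y) \<bullet> (- (t *\<^sub>R axis i 1))))) (at 0)"
      by (rule has_derivative_compose)
    then show ?thesis
      unfolding has_field_derivative_def
      by (rule has_derivative_eq_rhs) (auto simp: inner_axis fun_eq_iff algebra_simps diff_divide_distrib)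
  qed
  have "C_k k (\<lambda>y. exp_recip p (?q y))" for p
  proof (induction k arbitrary: p)
    case 0
    show ?case using continuous_on_compose2[OF exp_recip_continuous \<open>continuous_on UNIV ?q\<close>] by simp
  next
    case (Suc k)
    have "((\<lambda>t. exp_recip p (?q (y + t *\<^sub>R axis i 1))) has_real_derivative
        exp_recip (exp_recip_deriv p) (?q y) * ((- 2 / h\<^sup>2) * (y $ i + - x $ i))) (at 0)" for i y
      using DERIV_chain2[OF exp_recip_has_derivative dq, of p y i] by simp
    moreover have "C_k k (\<lambda>y. exp_recip (exp_recip_deriv p) (?q y) * ((- 2 / h\<^sup>2) * (y $ i + - x $ i)))" for i
      by (intro C_k_mult Suc.IH C_k_const C_k_add C_k_coord)
    ultimately show ?case
      using continuous_on_compose2[OF exp_recip_continuous \<open>continuous_on UNIV ?q\<close>]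
      by (intro C_k_SucI[where d="\<lambda>i y. exp_recip (exp_recip_deriv p) (?q y) * ((- 2 / h\<^sup>2) * (y $ i + - x $ i))"]) auto
  qed
  then show ?thesis
    unfolding mollifier_def bump_def divide_inverse by (intro C_k_mult C_k_const)
qed

lemma test_function_mollifier:
  assumes h: "0 < h" and sub: "cball x h \<subseteq> \<Omega>"
  shows "test_function \<Omega> (\<lambda>y. mollifier h (x - y))"
proof -
  have "{y. mollifier h (x - y) \<noteq> 0} \<subseteq> cball x h"
    using mollifier_outside(1)[OF h] by (force simp: dist_norm)
  then have cl: "closure {y. mollifier h (x - y) \<noteq> 0} \<subseteq> cball x h"
    by (rule closure_minimal) simp
  then have "compact (closure {y. mollifier h (x - y) \<noteq> 0})"
    by (meson bounded_cball bounded_subset closed_closure compact_eq_bounded_closed)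
  then show ?thesis unfolding test_function_def using C_k_mollifier cl sub by blast
qed

lemma mollifier_directional:
  "((\<lambda>t. mollifier h (x - (y + t *\<^sub>R e))) has_real_derivative - (mollifier_grad h (x - y) \<bullet> e)) (at 0)"
proof -
  have "((\<lambda>t. x - (y + t *\<^sub>R e)) has_derivative (\<lambda>t. - (t *\<^sub>R e))) (at 0)"
    by (auto intro!: derivative_eq_intros)
  moreover have "(mollifier h has_derivative (\<lambda>w. mollifier_grad h (x - y) \<bullet> w)) (at (x - (y + 0 *\<^sub>R e)))"
    using mollifier_has_derivative[of h "x - y"] by simp
  ultimately have "((\<lambda>t. mollifier h (x - (y + t *\<^sub>R e))) has_derivative (\<lambda>t. mollifier_grad h (x - y) \<bullet> (- (t *\<^sub>R e)))) (at 0)"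
    by (rule has_derivative_compose)
  then show ?thesis
    unfolding has_field_derivative_def by (rule has_derivative_eq_rhs) (auto simp: mult.commute)
qed

lemma partial_deriv_mollifier:
  "partial_deriv i (\<lambda>y. mollifier h (x - y)) y = - (mollifier_grad h (x - y) $ i)"
  by (rule partial_deriv_eqI[OF mollifier_directional, THEN trans]) (simp add: inner_axis)

lemma mollifier_lipschitz:
  assumes "0 < h"
  shows "\<exists>L. L-lipschitz_on UNIV (mollifier h :: real ^ 'n \<Rightarrow> real)"
proof -
  obtain B where B0: "B > 0" "\<forall>h>0. \<forall>z :: real ^ 'n.
      \<bar>mollifier h z\<bar> \<le> B / measure lborel (cball (0 :: real ^ 'n) h) \<and>
      h * norm (mollifier_grad h z) \<le> B / measure lborel (cball (0 :: real ^ 'n) h)"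
    using mollifier_bounds[where 'n='n] by blast
  note B = B0(1) B0(2)[rule_format, THEN conjunct2]
  let ?L = "B / measure lborel (cball (0 :: real ^ 'n) h) / h"
  have "?L-lipschitz_on UNIV (mollifier h :: real ^ 'n \<Rightarrow> real)"
  proof (rule bounded_derivative_imp_lipschitz[OF has_derivative_at_withinI[OF mollifier_has_derivative]])
    fix z :: "real ^ 'n"
    have "norm (mollifier_grad h z) \<le> ?L" using B(2)[OF assms, of z] assms by (simp add: field_simps)
    from mult_right_mono[OF this norm_ge_zero]
    have "\<bar>mollifier_grad h z \<bullet> w\<bar> \<le> ?L * norm w" for w
      by (rule order_trans[OF Cauchy_Schwarz_ineq2])
    then show "onorm (\<lambda>w. mollifier_grad h z \<bullet> w) \<le> ?L"
      by (intro onorm_le) simp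
  qed (use assms B(1) in \<open>auto intro!: divide_nonneg_nonneg\<close>)
  then show ?thesis by blast
qed

section \<open>Flows of bounded Lipschitz fields\<close>

text \<open>The function \<open>exp (- (2 * L * s)) * norm (\<gamma> s - \<delta> s) ^ 2\<close> is
  nonincreasing. The square keeps it differentiable where the two curves meet.\<close>

lemma lipschitz_gronwall:
  fixes Y :: "'a::euclidean_space \<Rightarrow> 'a"
  assumes Y: "L-lipschitz_on UNIV Y" and T: "0 \<le> T"
    and \<gamma>: "\<And>s. s \<in> {0..T} \<Longrightarrow> (\<gamma> has_vector_derivative Y (\<gamma> s)) (at s)"
    and \<delta>: "\<And>s. s \<in> {0..T} \<Longrightarrow> (\<delta> has_vector_derivative Y (\<delta> s)) (at s)"
  shows "norm (\<gamma> T - \<delta> T) \<le> exp (L * T) * norm (\<gamma> 0 - \<delta> 0)"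
proof -
  define w where "w s = exp (- (2 * L * s)) * ((\<gamma> s - \<delta> s) \<bullet> (\<gamma> s - \<delta> s))" for s
  define w' where "w' s = exp (- (2 * L * s)) * (2 * ((\<gamma> s - \<delta> s) \<bullet> (Y (\<gamma> s) - Y (\<delta> s))) - 2 * L * ((\<gamma> s - \<delta> s) \<bullet> (\<gamma> s - \<delta> s)))" for s
  have dw: "(w has_real_derivative w' s) (at s)" if "s \<in> {0..T}" for s
  proof -
    have d: "((\<lambda>s. \<gamma> s - \<delta> s) has_vector_derivative (Y (\<gamma> s) - Y (\<delta> s))) (at s)"
      by (intro has_vector_derivative_diff \<gamma> \<delta> that)
    have "((\<lambda>s. (\<gamma> s - \<delta> s) \<bullet> (\<gamma> s - \<delta> s)) has_derivative
        (\<lambda>h. (\<gamma> s - \<delta> s) \<bullet> (h *\<^sub>R (Y (\<gamma> s) - Y (\<delta> s))) + (h *\<^sub>R (Y (\<gamma> s) - Y (\<delta> s))) \<bullet> (\<gamma> s - \<delta> s))) (at s)"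
      using d unfolding has_vector_derivative_def by (intro has_derivative_inner)
    then have "((\<lambda>s. (\<gamma> s - \<delta> s) \<bullet> (\<gamma> s - \<delta> s)) has_real_derivative 2 * ((\<gamma> s - \<delta> s) \<bullet> (Y (\<gamma> s) - Y (\<delta> s)))) (at s)"
      unfolding has_field_derivative_def
      by (rule has_derivative_eq_rhs) (simp add: fun_eq_iff inner_commute algebra_simps)
    moreover have "((\<lambda>s. exp (- (2 * L * s))) has_real_derivative exp (- (2 * L * s)) * - (2 * L)) (at s)"
      by (auto intro!: derivative_eq_intros)
    ultimately show ?thesis unfolding w_def[abs_def] w'_def
      by (rule DERIV_cong[OF DERIV_mult[rotated]]) (simp add: algebra_simps)
  qed
  have w'_le: "w' s \<le> 0" for s
  proof -
    have "(\<gamma> s - \<delta> s) \<bullet> (Y (\<gamma> s) - Y (\<delta> s)) \<le> norm (\<gamma> s - \<delta> s) * norm (Y (\<gamma> s) - Y (\<delta> s))"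
      by (rule norm_cauchy_schwarz)
    also have "\<dots> \<le> norm (\<gamma> s - \<delta> s) * (L * norm (\<gamma> s - \<delta> s))"
      using lipschitz_onD[OF Y, of "\<gamma> s" "\<delta> s"] by (intro mult_left_mono) (auto simp: dist_norm)
    also have "\<dots> = L * ((\<gamma> s - \<delta> s) \<bullet> (\<gamma> s - \<delta> s))"
      by (simp add: power2_norm_eq_inner[symmetric] power2_eq_square)
    finally show ?thesis unfolding w'_def by (simp add: mult_nonneg_nonpos)
  qed
  have "w T \<le> w 0"
  proof (rule DERIV_nonpos_imp_decreasing_open[OF T])
    show "\<exists>y. (w has_real_derivative y) (at s) \<and> y \<le> 0" if "0 < s" "s < T" for s
      using dw[of s] w'_le[of s] that by (intro exI[of _ "w' s"]) simp
    show "continuous_on {0..T} w"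
      by (rule DERIV_continuous_on[OF has_field_derivative_at_within[OF dw]])
  qed
  then have "exp (- (2 * L * T)) * (norm (\<gamma> T - \<delta> T))\<^sup>2 \<le> (norm (\<gamma> 0 - \<delta> 0))\<^sup>2"
    by (simp add: w_def power2_norm_eq_inner)
  then have "(norm (\<gamma> T - \<delta> T))\<^sup>2 \<le> exp (2 * L * T) * (norm (\<gamma> 0 - \<delta> 0))\<^sup>2"
    by (simp add: exp_minus field_simps)
  also have "\<dots> = (exp (L * T) * norm (\<gamma> 0 - \<delta> 0))\<^sup>2"
    by (simp add: power_mult_distrib exp_double[symmetric] mult.assoc)
  finally show ?thesis by (rule power2_le_imp_le) simp
qed

lemma lipschitz_gronwall_abs:
  fixes Y :: "'a::euclidean_space \<Rightarrow> 'a"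
  assumes Y: "L-lipschitz_on UNIV Y"
    and \<gamma>: "\<And>s. s \<in> closed_segment 0 t \<Longrightarrow> (\<gamma> has_vector_derivative Y (\<gamma> s)) (at s)"
    and \<delta>: "\<And>s. s \<in> closed_segment 0 t \<Longrightarrow> (\<delta> has_vector_derivative Y (\<delta> s)) (at s)"
  shows "norm (\<gamma> t - \<delta> t) \<le> exp (L * \<bar>t\<bar>) * norm (\<gamma> 0 - \<delta> 0)"
proof (cases "0 \<le> t")
  case True
  then show ?thesis
    using lipschitz_gronwall[OF Y True, of \<gamma> \<delta>] \<gamma> \<delta> by (simp add: closed_segment_eq_real_ivl)
next
  case False
  have Y': "L-lipschitz_on UNIV (\<lambda>x. - Y x)" using Y by simp
  \<comment> \<open>Running time backwards turns solutions for \<open>Y\<close> into solutions for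
    \<open>- Y\<close>, which has the same Lipschitz constant.\<close>
  have refl: "((\<lambda>s. \<eta> (- s)) has_vector_derivative - Y (\<eta> (- s))) (at s)"
    if "(\<eta> has_vector_derivative Y (\<eta> (- s))) (at (- s))" for \<eta> s
  proof -
    have "(uminus has_vector_derivative (-1)) (at s)" for s :: real
      by (auto intro!: derivative_eq_intros simp: has_real_derivative_iff_has_vector_derivative[symmetric])
    from vector_diff_chain_at[OF this that] show ?thesis by (simp add: o_def)
  qed
  have "norm (\<gamma> (- (- t)) - \<delta> (- (- t))) \<le> exp (L * (- t)) * norm (\<gamma> (- 0) - \<delta> (- 0))"
    using False \<gamma> \<delta> by (intro lipschitz_gronwall[OF Y', of "-t" "\<lambda>s. \<gamma> (- s)" "\<lambda>s. \<delta> (- s)"] refl)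
      (auto simp: closed_segment_eq_real_ivl)
  then show ?thesis using False by simp
qed

lemma antiderivative_exists:
  fixes g :: "real \<Rightarrow> 'a::euclidean_space"
  assumes g: "continuous_on UNIV g"
  shows "\<exists>G. G 0 = 0 \<and> (\<forall>t. (G has_vector_derivative g t) (at t))"
proof (intro exI[of _ "\<lambda>t. LBINT s=ereal 0..ereal t. g s"] conjI allI)
  show "(LBINT s=ereal 0..ereal 0. g s) = 0" by (rule interval_integral_endpoints_same)
  fix t :: real
  let ?b = "\<bar>t\<bar> + 1"
  have "((\<lambda>u. LBINT s=ereal 0..ereal u. g s) has_vector_derivative g t) (at t within {-?b..?b})"
    by (rule interval_integral_FTC2) (use continuous_on_subset[OF g] in auto)
  moreover have "t \<in> interior {-?b..?b}" unfolding interior_atLeastAtMost_real greaterThanLessThan_iff by linarith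
  ultimately show "((\<lambda>t. LBINT s=ereal 0..ereal t. g s) has_vector_derivative g t) (at t)"
    by (simp only: at_within_interior)
qed

lemma antiderivative_bound:
  fixes G :: "real \<Rightarrow> 'a::euclidean_space"
  assumes G: "G 0 = 0" "\<And>s. (G has_vector_derivative g s) (at s)"
    and \<beta>: "\<beta> 0 = 0" "\<And>s. (\<beta> has_vector_derivative \<beta>' s) (at s)"
    and le: "\<And>s. 0 \<le> s \<Longrightarrow> norm (g s) \<le> \<beta>' s" "\<And>s. 0 \<le> s \<Longrightarrow> norm (g (- s)) \<le> \<beta>' s"
  shows "norm (G t) \<le> \<beta> \<bar>t\<bar>"
proof -
  have *: "norm (H t) \<le> \<beta> t" if H: "H 0 = 0" "\<And>s. (H has_vector_derivative h s) (at s)"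
    and h: "\<And>s. 0 \<le> s \<Longrightarrow> norm (h s) \<le> \<beta>' s" and t: "0 \<le> t" for H h t
  proof (cases "t = 0")
    case False
    have "norm (H t - H 0) \<le> \<beta> t - \<beta> 0"
      by (rule differentiable_bound_general[of 0 t H \<beta> h \<beta>'])
        (use False t h H(2) \<beta>(2) in \<open>auto intro!: continuous_at_imp_continuous_on has_vector_derivative_continuous\<close>)
    then show ?thesis using H \<beta> by simp
  qed (use H \<beta> in simp)
  show ?thesis
  proof (cases "0 \<le> t")
    case True
    then show ?thesis using *[OF G le(1)] by simp
  next
    case False
    have "(uminus has_vector_derivative (-1)) (at s)" for s :: real
      by (auto intro!: derivative_eq_intros simp: has_real_derivative_iff_has_vector_derivative[symmetric])
    from vector_diff_chain_at[OF this G(2)]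
    have "((\<lambda>s. G (- s)) has_vector_derivative - g (- s)) (at s)" for s by (simp add: o_def)
    then have "norm (G (- (- t))) \<le> \<beta> (- t)"
      using *[of "\<lambda>s. G (- s)" "\<lambda>s. - g (- s)" "- t"] G le(2) False by simp
    then show ?thesis using False by simp
  qed
qed

text \<open>Picard iteration for \<open>\<gamma> t = x + exp (2 * K * \<bar>t\<bar>) *\<^sub>R d t\<close>: the exponential weight makes
  it a contraction of the bounded continuous functions on the whole line.\<close>

lemma global_solution_exists:
  fixes Y :: "'a::euclidean_space \<Rightarrow> 'a"
  assumes Y: "L-lipschitz_on UNIV Y" and M: "\<And>x. norm (Y x) \<le> M"
  shows "\<exists>\<gamma>. \<gamma> 0 = x \<and> (\<forall>t. (\<gamma> has_vector_derivative Y (\<gamma> t)) (at t))"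
proof -
  \<comment> \<open>The increase by 1 gives \<open>K \<ge> 1\<close>, so that the weight absorbs the
    linear growth of the antiderivatives:
    \<open>\<bar>t\<bar> \<le> exp (2 * K * \<bar>t\<bar>)\<close>.\<close>
  define K where "K = L + 1"
  have K: "1 \<le> K" using lipschitz_on_nonneg[OF Y] unfolding K_def by simp
  have YK: "norm (Y y - Y z) \<le> K * norm (y - z)" for y z
    using lipschitz_onD[OF Y, of y z] unfolding K_def dist_norm by (simp add: distrib_right add_increasing2)
  have contY: "continuous_on UNIV Y" using Y by (rule lipschitz_on_continuous_on)
  have M0: "0 \<le> M" using M[of x] norm_ge_zero order_trans by blast
  define c where "c d s = x + exp (2 * K * \<bar>s\<bar>) *\<^sub>R apply_bcontfun d s" for d :: "real \<Rightarrow>\<^sub>C 'a" and s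
  have contc: "continuous_on UNIV (\<lambda>s. Y (c d s))" for d
    unfolding c_def
    by (intro continuous_on_compose2[OF contY] continuous_intros continuous_on_apply_bcontfun) auto
  define A where "A d = (SOME G. G 0 = 0 \<and> (\<forall>t. (G has_vector_derivative Y (c d t)) (at t)))" for d
  have A: "A d 0 = 0" "(A d has_vector_derivative Y (c d t)) (at t)" for d t
    using someI_ex[OF antiderivative_exists[OF contc], of d] unfolding A_def by auto
  \<comment> \<open>One Picard step in the variable \<open>d\<close>: a fixed point satisfies
    \<open>c d t = x + A d t\<close>.\<close>
  define P where "P d t = exp (- (2 * K * \<bar>t\<bar>)) *\<^sub>R A d t" for d t
  have contA: "continuous_on UNIV (A d)" for d
    by (intro continuous_at_imp_continuous_on ballI has_vector_derivative_continuous[OF A(2)])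
  have bdP: "norm (P d t) \<le> M" for d t
  proof -
    have "norm (A d t) \<le> M * \<bar>t\<bar>"
      by (rule antiderivative_bound[where \<beta>'="\<lambda>_. M", OF A])
        (use M in \<open>auto intro!: derivative_eq_intros simp: has_real_derivative_iff_has_vector_derivative[symmetric]\<close>)
    then have "norm (P d t) \<le> exp (- (2 * K * \<bar>t\<bar>)) * (M * \<bar>t\<bar>)"
      unfolding P_def by (simp add: mult_left_mono)
    also have "\<dots> = M * (exp (- (2 * K * \<bar>t\<bar>)) * \<bar>t\<bar>)" by simp
    also have "\<dots> \<le> M * 1"
    proof (intro mult_left_mono M0)
      have "1 * \<bar>t\<bar> \<le> (2 * K) * \<bar>t\<bar>" using K by (intro mult_right_mono) auto
      also have "\<dots> \<le> exp (2 * K * \<bar>t\<bar>)" using exp_ge_add_one_self[of "2 * K * \<bar>t\<bar>"] by linarith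
      finally show "exp (- (2 * K * \<bar>t\<bar>)) * \<bar>t\<bar> \<le> 1" by (simp add: exp_minus field_simps)
    qed
    finally show ?thesis by simp
  qed
  have P_bc: "P d \<in> bcontfun" for d
    unfolding bcontfun_def
  proof (intro CollectI conjI)
    show "continuous_on UNIV (P d)" unfolding P_def by (intro continuous_intros contA)
    show "bounded (range (P d))" using bdP[of d] by (auto simp: bounded_iff)
  qed
  define T where "T d = Bcontfun (P d)" for d
  have T: "apply_bcontfun (T d) = P d" for d unfolding T_def using P_bc by (rule Bcontfun_inverse)
  have contr: "dist (T d) (T d') \<le> (1/2) * dist d d'" for d d'
  proof (rule dist_bound)
    fix t
    have dd: "norm (Y (c d s) - Y (c d' s)) \<le> K * exp (2 * K * \<bar>s\<bar>) * dist d d'" for s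
    proof -
      have "norm (Y (c d s) - Y (c d' s)) \<le> K * norm (c d s - c d' s)" by (rule YK)
      also have "norm (c d s - c d' s) = exp (2 * K * \<bar>s\<bar>) * dist (apply_bcontfun d s) (apply_bcontfun d' s)"
        by (simp add: c_def dist_norm scaleR_diff_right[symmetric])
      also have "\<dots> \<le> exp (2 * K * \<bar>s\<bar>) * dist d d'" by (intro mult_left_mono dist_bounded) auto
      finally show ?thesis using K by (simp add: mult.assoc)
    qed
    have dd1: "norm (Y (c d s) - Y (c d' s)) \<le> K * exp (2 * K * s) * dist d d'"
      and dd2: "norm (Y (c d (- s)) - Y (c d' (- s))) \<le> K * exp (2 * K * s) * dist d d'" if "0 \<le> s" for s
      using dd[of s] dd[of "- s"] that by simp_all
    \<comment> \<open>Integrating \<open>K * exp (2 * K * s)\<close> gives at most half the weight;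
      this is the source of the contraction factor 1/2.\<close>
    have "norm (A d t - A d' t) \<le> (exp (2 * K * \<bar>t\<bar>) - 1) / 2 * dist d d'"
      by (rule antiderivative_bound[where \<beta>="\<lambda>t. (exp (2 * K * t) - 1) / 2 * dist d d'" and
            \<beta>'="\<lambda>s. K * exp (2 * K * s) * dist d d'" and g="\<lambda>s. Y (c d s) - Y (c d' s)"])
        (auto intro!: derivative_eq_intros has_vector_derivative_diff A dd1 dd2
            simp: A(1) has_real_derivative_iff_has_vector_derivative[symmetric])
    also have "\<dots> \<le> exp (2 * K * \<bar>t\<bar>) / 2 * dist d d'" by (intro mult_right_mono) auto
    finally have "exp (- (2 * K * \<bar>t\<bar>)) * norm (A d t - A d' t) \<le> exp (- (2 * K * \<bar>t\<bar>)) * (exp (2 * K * \<bar>t\<bar>) / 2 * dist d d')"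
      by (intro mult_left_mono) auto
    also have "\<dots> = 1/2 * dist d d'" by (simp add: exp_minus)
    finally show "dist (apply_bcontfun (T d) t) (apply_bcontfun (T d') t) \<le> (1/2) * dist d d'"
      unfolding T P_def dist_norm by (simp add: scaleR_diff_right[symmetric])
  qed
  obtain d where d: "T d = d"
    using banach_fix_type[of "1/2" T] contr by auto
  have "apply_bcontfun d t = exp (- (2 * K * \<bar>t\<bar>)) *\<^sub>R A d t" for t
    using T[of d] unfolding d P_def by (auto simp: fun_eq_iff)
  then have cA: "c d t = x + A d t" for t
    by (simp add: c_def exp_minus)
  show ?thesis
  proof (intro exI[of _ "\<lambda>t. x + A d t"] conjI allI)
    show "x + A d 0 = x" by (simp add: A)
    show "((\<lambda>t. x + A d t) has_vector_derivative Y (x + A d t)) (at t)" for t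
      using has_vector_derivative_add[OF has_vector_derivative_const A(2)[of d t], of x] by (simp add: cA)
  qed
qed

locale bounded_lipschitz_flow =
  fixes Y :: "'a::euclidean_space \<Rightarrow> 'a" and \<phi> :: "real \<Rightarrow> 'a \<Rightarrow> 'a" and L M :: real
  assumes lip: "L-lipschitz_on UNIV Y" and bound: "\<And>x. norm (Y x) \<le> M"
    and flow_0: "\<And>x. \<phi> 0 x = x"
    and flow_deriv: "\<And>t x. ((\<lambda>t. \<phi> t x) has_vector_derivative Y (\<phi> t x)) (at t)"
begin

text \<open>A Bochner integral: it is 0 for \<open>t < 0\<close>, and also where the integrand fails
  to be integrable, so integrability along trajectories has to be tracked separately.\<close>

abbreviation path_integral :: "('a \<Rightarrow> real) \<Rightarrow> real \<Rightarrow> 'a \<Rightarrow> real" where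
  "path_integral H t x \<equiv> (LBINT s. indicator {0..t} s * H (\<phi> s x))"

lemma L_nonneg: "0 \<le> L" using lip by (rule lipschitz_on_nonneg)

lemma M_nonneg: "0 \<le> M" using bound[of undefined] norm_ge_zero order_trans by blast

lemma flow_unique:
  assumes "\<And>s. s \<in> closed_segment 0 t \<Longrightarrow> (\<gamma> has_vector_derivative Y (\<gamma> s)) (at s)"
  shows "\<gamma> t = \<phi> t (\<gamma> 0)"
  using lipschitz_gronwall_abs[OF lip assms flow_deriv, of t "\<gamma> 0"] by (simp add: flow_0)

lemma flow_lipschitz: "(exp (L * \<bar>t\<bar>))-lipschitz_on UNIV (\<phi> t)"
  by (rule lipschitz_onI)
    (use lipschitz_gronwall_abs[OF lip flow_deriv flow_deriv, of t] in \<open>auto simp: dist_norm flow_0\<close>)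

lemma flow_add: "\<phi> s (\<phi> t x) = \<phi> (s + t) x"
proof -
  have "((\<lambda>s. \<phi> (s + t) x) has_vector_derivative Y (\<phi> (s + t) x)) (at s)" for s
  proof -
    have "((\<lambda>s. s + t) has_vector_derivative 1) (at s)"
      by (auto intro!: derivative_eq_intros simp: has_real_derivative_iff_has_vector_derivative[symmetric])
    from vector_diff_chain_at[OF this flow_deriv[of x "s + t"]] show ?thesis by (simp add: o_def)
  qed
  from flow_unique[of s "\<lambda>s. \<phi> (s + t) x", OF this] show ?thesis by simp
qed

lemma flow_minus [simp]: "\<phi> (- t) (\<phi> t x) = x" "\<phi> t (\<phi> (- t) x) = x"
  by (simp_all add: flow_add flow_0)

lemma flow_time_lipschitz: "dist (\<phi> t x) (\<phi> s x) \<le> M * \<bar>t - s\<bar>"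
proof -
  have "norm (\<phi> t x - \<phi> s x) \<le> M * norm (t - s)"
  proof (rule differentiable_bound[of UNIV])
    show "((\<lambda>t. \<phi> t x) has_derivative (\<lambda>h. h *\<^sub>R Y (\<phi> t x))) (at t within UNIV)" for t
      using flow_deriv[of x t] by (simp add: has_vector_derivative_def)
    show "onorm (\<lambda>h. h *\<^sub>R Y (\<phi> t x)) \<le> M" for t
      using mult_right_mono[OF bound abs_ge_zero] by (intro onorm_le) (simp add: mult.commute)
  qed auto
  then show ?thesis by (simp add: dist_norm)
qed

lemma flow_near: "dist (\<phi> t x) x \<le> M * \<bar>t\<bar>"
  using flow_time_lipschitz[of t x 0] by (simp add: flow_0)

lemma flow_continuous: "continuous_on UNIV (\<lambda>(t, x). \<phi> t x)"
proof (rule continuous_at_imp_continuous_on, rule ballI, clarify)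
  fix t :: real and x :: 'a
  have "((\<lambda>p. exp (L * \<bar>fst p\<bar>) * dist (snd p) x + M * \<bar>fst p - t\<bar>) \<longlongrightarrow>
      exp (L * \<bar>fst (t, x)\<bar>) * dist (snd (t, x)) x + M * \<bar>fst (t, x) - t\<bar>) (at (t, x))"
    by (intro tendsto_intros)
  then have lim: "((\<lambda>p. exp (L * \<bar>fst p\<bar>) * dist (snd p) x + M * \<bar>fst p - t\<bar>) \<longlongrightarrow> 0) (at (t, x))"
    by simp
  have "dist (\<phi> (fst p) (snd p)) (\<phi> t x) \<le> exp (L * \<bar>fst p\<bar>) * dist (snd p) x + M * \<bar>fst p - t\<bar>" for p
    using dist_triangle[of "\<phi> (fst p) (snd p)" "\<phi> t x" "\<phi> (fst p) x"]
      lipschitz_onD[OF flow_lipschitz[of "fst p"], of "snd p" x] flow_time_lipschitz[of "fst p" x t] by simp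
  then have "((\<lambda>p. dist (\<phi> (fst p) (snd p)) (\<phi> t x)) \<longlongrightarrow> 0) (at (t, x))"
    by (intro tendsto_sandwich[OF _ _ tendsto_const lim]) auto
  then show "isCont (\<lambda>(t, x). \<phi> t x) (t, x)"
    unfolding isCont_def case_prod_beta by (subst tendsto_dist_iff) simp
qed

lemma flow_measurable [measurable]: "(\<lambda>(t, x). \<phi> t x) \<in> borel_measurable (borel \<Otimes>\<^sub>M borel)"
  unfolding borel_prod by (rule borel_measurable_continuous_onI[OF flow_continuous])

lemma flow_space_continuous: "continuous_on UNIV (\<phi> t)"
  by (rule lipschitz_on_continuous_on[OF flow_lipschitz])

lemma flow_compresses: "compresses (exp (L * \<bar>t\<bar>) ^ DIM('a)) (\<phi> t)"
  using compresses_lipschitz_inverse[OF flow_lipschitz[of "- t"] flow_space_continuous] by simp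

text \<open>One constant for all times up to \<open>T\<close> makes
  \<open>compresses_near_identity\<close> and the integrals over time uniform in
  \<open>t\<close>.\<close>

lemma flow_compresses_le:
  assumes "\<bar>t\<bar> \<le> T"
  shows "compresses (exp (L * T) ^ DIM('a)) (\<phi> t)"
proof -
  have le: "exp (L * \<bar>t\<bar>) ^ DIM('a) \<le> exp (L * T) ^ DIM('a)"
    using assms L_nonneg by (intro power_mono) (auto intro: mult_left_mono)
  have "emeasure lborel (\<phi> t -` A) \<le> ennreal (exp (L * T) ^ DIM('a)) * emeasure lborel A" if "A \<in> sets borel" for A
    by (rule order_trans[OF compressesD(3)[OF flow_compresses that] mult_right_mono])
      (use le in \<open>auto intro: ennreal_leI\<close>)
  then show ?thesis using compressesD(2)[OF flow_compresses] unfolding compresses_def by auto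
qed

lemma flow_compose_measurable [measurable (raw)]:
  assumes [measurable]: "f \<in> borel_measurable N'" "g \<in> borel_measurable N'"
  shows "(\<lambda>z. \<phi> (f z) (g z)) \<in> borel_measurable N'"
proof -
  have "(\<lambda>z. (f z, g z)) \<in> N' \<rightarrow>\<^sub>M borel \<Otimes>\<^sub>M borel" by measurable
  from measurable_compose[OF this flow_measurable] show ?thesis by simp
qed

text \<open>By Tonelli, the integral of \<open>\<bar>H (\<phi> s x)\<bar>\<close> over times in
  \<open>{0..t}\<close> and all \<open>x\<close> is at most \<open>t\<close> times the compression
  constant times the L^1 norm of \<open>H\<close>. Hence the inner time integral is finite for
  almost every \<open>x\<close>.\<close>

lemma flow_integrable_AE:
  fixes H :: "'a \<Rightarrow> real"
  assumes t: "0 \<le> t" and H: "integrable lborel H"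
  shows "AE x in lborel. integrable lborel (\<lambda>s. indicator {0..t} s * H (\<phi> s x))"
proof -
  let ?C = "exp (L * t) ^ DIM('a)"
  have [measurable]: "H \<in> borel_measurable borel" using borel_measurable_integrable[OF H] by simp
  have fin: "(\<integral>\<^sup>+x. ennreal \<bar>H x\<bar> \<partial>lborel) < \<infinity>" using H by (simp add: integrable_iff_bounded)
  have "(\<integral>\<^sup>+x. \<integral>\<^sup>+s. indicator {0..t} s * ennreal \<bar>H (\<phi> s x)\<bar> \<partial>lborel \<partial>lborel) =
      (\<integral>\<^sup>+s. \<integral>\<^sup>+x. indicator {0..t} s * ennreal \<bar>H (\<phi> s x)\<bar> \<partial>lborel \<partial>lborel)"
    by (rule lborel_pair.Fubini'[symmetric]) measurable
  also have "\<dots> = (\<integral>\<^sup>+s. indicator {0..t} s * (\<integral>\<^sup>+x. ennreal \<bar>H (\<phi> s x)\<bar> \<partial>lborel) \<partial>lborel)"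
    by (intro nn_integral_cong nn_integral_cmult) measurable
  also have "\<dots> \<le> (\<integral>\<^sup>+s. indicator {0..t} s * (ennreal ?C * (\<integral>\<^sup>+x. ennreal \<bar>H x\<bar> \<partial>lborel)) \<partial>lborel)"
  proof (rule nn_integral_mono)
    fix s
    show "indicator {0..t} s * (\<integral>\<^sup>+x. ennreal \<bar>H (\<phi> s x)\<bar> \<partial>lborel) \<le>
        indicator {0..t} s * (ennreal ?C * (\<integral>\<^sup>+x. ennreal \<bar>H x\<bar> \<partial>lborel))"
      using compresses_nn_integral[OF flow_compresses_le[of s t], of "\<lambda>x. ennreal \<bar>H x\<bar>"]
      by (cases "s \<in> {0..t}") auto
  qed
  also have "\<dots> = ennreal t * (ennreal ?C * (\<integral>\<^sup>+x. ennreal \<bar>H x\<bar> \<partial>lborel))"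
    using t by (simp add: nn_integral_multc)
  also have "\<dots> < \<infinity>" using fin by (simp add: ennreal_mult_less_top)
  finally have "(\<integral>\<^sup>+x. \<integral>\<^sup>+s. indicator {0..t} s * ennreal \<bar>H (\<phi> s x)\<bar> \<partial>lborel \<partial>lborel) \<noteq> \<infinity>" by simp
  then have "AE x in lborel. (\<integral>\<^sup>+s. indicator {0..t} s * ennreal \<bar>H (\<phi> s x)\<bar> \<partial>lborel) \<noteq> \<infinity>"
    by (intro nn_integral_noteq_infinite) measurable
  then show ?thesis
  proof eventually_elim
    case (elim x)
    have "ennreal (norm (indicator {0..t} s * H (\<phi> s x))) = indicator {0..t} s * ennreal \<bar>H (\<phi> s x)\<bar>" for s
      by (auto simp: indicator_def)
    then show ?case using elim by (simp add: integrable_iff_bounded less_top)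
  qed
qed

end

lemma bounded_lipschitz_flow_exists:
  fixes Y :: "'a::euclidean_space \<Rightarrow> 'a"
  assumes Y: "L-lipschitz_on UNIV Y" and M: "\<And>x. norm (Y x) \<le> M"
  shows "\<exists>\<phi>. bounded_lipschitz_flow Y \<phi> L M"
proof -
  obtain g :: "'a \<Rightarrow> real \<Rightarrow> 'a" where "\<forall>x. g x 0 = x \<and> (\<forall>t. (g x has_vector_derivative Y (g x t)) (at t))"
    using global_solution_exists[OF Y M] by metis
  then have "bounded_lipschitz_flow Y (\<lambda>t x. g x t) L M"
    by unfold_locales (use Y M in auto)
  then show ?thesis by (rule exI[of _ "\<lambda>t x. g x t"])
qed

section \<open>Mollification and the commutator estimate\<close>

lemma integrable_mult_bounded:
  fixes F k :: "'a \<Rightarrow> real"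
  assumes F: "integrable M F" and k: "k \<in> borel_measurable M" and c: "\<And>y. \<bar>k y\<bar> \<le> c"
  shows "integrable M (\<lambda>y. F y * k y)"
proof (rule Bochner_Integration.integrable_bound[of M "\<lambda>y. c * F y"])
  show "AE y in M. norm (F y * k y) \<le> norm (c * F y)"
  proof (rule AE_I2)
    fix y
    have "\<bar>F y\<bar> * \<bar>k y\<bar> \<le> \<bar>F y\<bar> * \<bar>c\<bar>"
      using c[of y] by (intro mult_left_mono) auto
    then show "norm (F y * k y) \<le> norm (c * F y)" by (simp add: abs_mult mult.commute)
  qed
  show "(\<lambda>y. F y * k y) \<in> borel_measurable M"
    using borel_measurable_integrable[OF F] k by (rule borel_measurable_times)
qed (use F in simp)

lemma integrable_bounded_support:
  fixes k :: "'a::euclidean_space \<Rightarrow> real"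
  assumes k: "k \<in> borel_measurable borel" and c: "\<And>y. \<bar>k y\<bar> \<le> c" and supp: "\<And>y. r < dist x y \<Longrightarrow> k y = 0"
  shows "integrable lborel k"
proof -
  have "integrable lborel (\<lambda>y. indicator (cball x r) y * k y)"
    using emeasure_lborel_cball_finite[of x r] k c
    by (intro integrable_mult_bounded[where c=c] integrable_real_indicator) auto
  moreover have "indicator (cball x r) y * k y = k y" for y
    using supp[of y] by (cases "dist x y \<le> r") auto
  ultimately show ?thesis by simp
qed

lemma integral_lborel_translate:
  fixes F :: "'a::euclidean_space \<Rightarrow> real"
  assumes "F \<in> borel_measurable borel"
  shows "(LBINT x. F (x + c)) = integral\<^sup>L lborel F"
proof -
  have "integral\<^sup>L lborel F = integral\<^sup>L (distr lborel borel ((+) c)) F"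
    by (simp add: lborel_distr_plus)
  also have "\<dots> = (LBINT x. F (c + x))"
    by (rule integral_distr) (use assms in auto)
  finally show ?thesis by (simp add: add.commute[of c])
qed

lemma compresses_translation: "compresses 1 (\<lambda>x::'a::euclidean_space. x + c)"
proof -
  have "1-lipschitz_on UNIV (\<lambda>x. x - c)" by (rule lipschitz_onI) (auto simp: dist_norm)
  then have "compresses (1 ^ DIM('a)) (\<lambda>x. x + c)"
    by (rule compresses_lipschitz_inverse) (auto intro!: continuous_intros)
  then show ?thesis by simp
qed

lemma ennreal_le_add3:
  assumes "u \<le> p + (q + r)" "0 \<le> p" "0 \<le> q" "0 \<le> r"
  shows "ennreal u \<le> ennreal p + (ennreal q + ennreal r)"
  using assms by (simp add: ennreal_plus[symmetric] ennreal_leI del: ennreal_plus)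

text \<open>Up to division by the ball volume, the mean oscillation about \<open>F x\<close> on the
  ball of radius \<open>h\<close>; the missing factor is supplied by the bounds on the
  kernels.\<close>

definition osc :: "real \<Rightarrow> ('a::euclidean_space \<Rightarrow> real) \<Rightarrow> 'a \<Rightarrow> ennreal" where
  "osc h F x = (\<integral>\<^sup>+w. indicator (cball 0 h) w * ennreal \<bar>F (x + w) - F x\<bar> \<partial>lborel)"

lemma cball_borel [measurable]: "cball x r \<in> sets borel" for x :: "'a::euclidean_space"
  by (rule borel_closed) simp

lemma vec_nth_borel [measurable]: "(\<lambda>x :: real ^ 'n. x $ i) \<in> borel_measurable borel"
  by (intro borel_measurable_continuous_onI continuous_intros)

lemma osc_measurable [measurable]:
  assumes [measurable]: "F \<in> borel_measurable borel"
  shows "osc h F \<in> borel_measurable borel"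
  unfolding osc_def by measurable

text \<open>After exchanging the integrals, each \<open>w\<close> in the ball contributes the L^1
  distance between \<open>F\<close> and its translate by \<open>w\<close>, which is at most
  \<open>e\<close> once \<open>h \<le> d\<close>.\<close>

lemma osc_small:
  fixes F :: "'a::euclidean_space \<Rightarrow> real"
  assumes F: "integrable lborel F" and e: "0 < e"
  shows "\<exists>d>0. \<forall>h. 0 < h \<longrightarrow> h \<le> d \<longrightarrow>
    (\<integral>\<^sup>+x. osc h F x \<partial>lborel) \<le> ennreal (e * measure lborel (cball (0::'a) h))"
proof -
  have [measurable]: "F \<in> borel_measurable borel" using borel_measurable_integrable[OF F] by simp
  obtain d where d: "d > 0" "\<And>\<phi>. compresses 1 \<phi> \<Longrightarrow> (\<forall>x. dist (\<phi> x) x \<le> d) \<Longrightarrow>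
      (\<integral>\<^sup>+x. ennreal \<bar>F (\<phi> x) - F x\<bar> \<partial>lborel) \<le> ennreal e"
    using compresses_near_identity[OF F e, of 1] by auto
  show ?thesis
  proof (intro exI[of _ d] conjI allI impI d(1))
    fix h :: real assume h: "0 < h" "h \<le> d"
    have "(\<integral>\<^sup>+x. osc h F x \<partial>lborel) = (\<integral>\<^sup>+w. \<integral>\<^sup>+x. indicator (cball 0 h) w * ennreal \<bar>F (x + w) - F x\<bar> \<partial>lborel \<partial>lborel)"
      unfolding osc_def by (rule lborel_pair.Fubini'[symmetric]) measurable
    also have "\<dots> = (\<integral>\<^sup>+w. indicator (cball 0 h) w * (\<integral>\<^sup>+x. ennreal \<bar>F (x + w) - F x\<bar> \<partial>lborel) \<partial>lborel)"
      by (intro nn_integral_cong nn_integral_cmult) auto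
    also have "\<dots> \<le> (\<integral>\<^sup>+w. indicator (cball (0::'a) h) w * ennreal e \<partial>lborel)"
    proof (rule nn_integral_mono)
      fix w :: 'a
      show "indicator (cball 0 h) w * (\<integral>\<^sup>+x. ennreal \<bar>F (x + w) - F x\<bar> \<partial>lborel) \<le> indicator (cball 0 h) w * ennreal e"
        using d(2)[OF compresses_translation[of w]] h by (auto simp: indicator_def dist_norm)
    qed
    also have "\<dots> = emeasure lborel (cball (0::'a) h) * ennreal e"
      by (simp add: nn_integral_multc)
    also have "\<dots> = ennreal (e * measure lborel (cball (0::'a) h))"
      using emeasure_lborel_cball_finite[of "0::'a" h] e
      by (simp add: emeasure_eq_ennreal_measure ennreal_mult mult.commute)
    finally show "(\<integral>\<^sup>+x. osc h F x \<partial>lborel) \<le> ennreal (e * measure lborel (cball (0::'a) h))" .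
  qed
qed

text \<open>Both terms combine into the integral of \<open>(F y - F x) * k y\<close>, where
  \<open>k\<close> is at most \<open>c\<close> on the ball and 0 outside. A kernel with integral 1
  yields the mollification error, one with integral 0 the commutator estimate.\<close>

lemma kernel_osc:
  fixes F k :: "'a::euclidean_space \<Rightarrow> real"
  assumes F: "integrable lborel F" and k[measurable]: "k \<in> borel_measurable borel"
    and c: "0 \<le> c" "\<And>y. \<bar>k y\<bar> \<le> c" and supp: "\<And>y. h < dist x y \<Longrightarrow> k y = 0"
  shows "ennreal \<bar>(LBINT y. F y * k y) - F x * integral\<^sup>L lborel k\<bar> \<le> ennreal c * osc h F x"
proof -
  have [measurable]: "F \<in> borel_measurable borel" using borel_measurable_integrable[OF F] by simp
  have i1: "integrable lborel (\<lambda>y. F y * k y)" by (rule integrable_mult_bounded[OF F _ c(2)]) simp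
  have i2: "integrable lborel (\<lambda>y. F x * k y)"
    using integrable_bounded_support[OF k c(2) supp] by simp
  have "(LBINT y. F y * k y) - F x * integral\<^sup>L lborel k = (LBINT y. F y * k y - F x * k y)"
    using i1 i2 by simp
  also have "ennreal \<bar>\<dots>\<bar> \<le> (\<integral>\<^sup>+y. ennreal (norm (F y * k y - F x * k y)) \<partial>lborel)"
    using integral_norm_bound_ennreal[OF Bochner_Integration.integrable_diff[OF i1 i2]] by simp
  also have "\<dots> \<le> (\<integral>\<^sup>+y. ennreal c * (indicator (cball 0 h) (y - x) * ennreal \<bar>F y - F x\<bar>) \<partial>lborel)"
  proof (rule nn_integral_mono)
    fix y
    show "ennreal (norm (F y * k y - F x * k y)) \<le> ennreal c * (indicator (cball 0 h) (y - x) * ennreal \<bar>F y - F x\<bar>)"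
    proof (cases "h < dist x y")
      case True
      then show ?thesis by (simp add: supp)
    next
      case False
      have "norm (F y * k y - F x * k y) = \<bar>k y\<bar> * \<bar>F y - F x\<bar>"
        by (simp add: abs_mult[symmetric] algebra_simps)
      also have "\<dots> \<le> c * \<bar>F y - F x\<bar>" using c(2) by (intro mult_right_mono) auto
      finally show ?thesis using False c(1)
        by (simp add: dist_norm norm_minus_commute ennreal_mult[symmetric] ennreal_leI)
    qed
  qed
  also have "\<dots> = ennreal c * (\<integral>\<^sup>+y. indicator (cball 0 h) (y - x) * ennreal \<bar>F y - F x\<bar> \<partial>lborel)"
    by (rule nn_integral_cmult) measurable
  also have "(\<integral>\<^sup>+y. indicator (cball 0 h) (y - x) * ennreal \<bar>F y - F x\<bar> \<partial>lborel) =
      (\<integral>\<^sup>+w. indicator (cball 0 h) (w + x - x) * ennreal \<bar>F (w + x) - F x\<bar> \<partial>lborel)"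
    by (rule nn_integral_lborel_translate[symmetric]) measurable
  also have "\<dots> = osc h F x" unfolding osc_def by (simp add: add.commute)
  finally show ?thesis .
qed

lemma mollifier_borel [measurable]: "mollifier h \<in> borel_measurable borel"
  by (rule borel_measurable_continuous_onI[OF mollifier_continuous])

lemma mollifier_grad_borel [measurable]: "mollifier_grad h \<in> borel_measurable borel"
  by (rule borel_measurable_continuous_onI[OF mollifier_grad_continuous])

lemma mollifier_integral_shifted:
  fixes x :: "real ^ 'n"
  assumes "0 < h"
  shows "(LBINT y. mollifier h (x - y)) = 1"
proof -
  have "mollifier h (x - y) = mollifier h (y + - x)" for y
    by (simp add: mollifier_def bump_def bump_arg_def norm_minus_commute)
  then show ?thesis
    using integral_lborel_translate[OF mollifier_borel, of h "- x"] mollifier_integral[OF assms, where 'n='n] by simp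
qed

text \<open>The product of \<open>w\<close> with the shifted mollifier is Lipschitz with bounded
  support, so \<open>integral_directional_derivative\<close> applies to it. The minus sign is due to
  the argument \<open>x - y\<close>.\<close>

lemma mollifier_integration_by_parts:
  fixes w d :: "real ^ 'n \<Rightarrow> real" and x :: "real ^ 'n"
  assumes h: "0 < h" and w: "L-lipschitz_on UNIV w" "\<And>y. \<bar>w y\<bar> \<le> M"
    and d[measurable]: "d \<in> borel_measurable borel"
    and deriv: "AE y in lborel. ((\<lambda>t. w (y + t *\<^sub>R axis i 1)) has_real_derivative d y) (at 0)"
  shows "integrable lborel (\<lambda>y. d y * mollifier h (x - y) - w y * mollifier_grad h (x - y) $ i)"
    "(LBINT y. d y * mollifier h (x - y) - w y * mollifier_grad h (x - y) $ i) = 0"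
proof -
  obtain l where l: "l-lipschitz_on UNIV (mollifier h :: real ^ 'n \<Rightarrow> real)" using mollifier_lipschitz[OF h] by blast
  obtain B where B: "\<And>z :: real ^ 'n. \<bar>mollifier h z\<bar> \<le> B" using mollifier_bounds[where 'n='n] h by blast
  have B0: "0 \<le> B" using B[of 0] by linarith
  have M0: "0 \<le> M" using w(2)[of 0] by linarith
  have [measurable]: "w \<in> borel_measurable borel"
    by (rule borel_measurable_continuous_onI[OF lipschitz_on_continuous_on[OF w(1)]])
  let ?v = "\<lambda>y. w y * mollifier h (x - y)"
  have v: "(M * l + L * B)-lipschitz_on UNIV ?v"
  proof (rule lipschitz_onI)
    fix y z
    have "dist (?v y) (?v z) = \<bar>w y * (mollifier h (x - y) - mollifier h (x - z)) + (w y - w z) * mollifier h (x - z)\<bar>"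
      by (simp add: dist_real_def algebra_simps)
    also have "\<dots> \<le> \<bar>w y\<bar> * \<bar>mollifier h (x - y) - mollifier h (x - z)\<bar> + \<bar>w y - w z\<bar> * \<bar>mollifier h (x - z)\<bar>"
      by (metis abs_mult abs_triangle_ineq)
    also have "\<dots> \<le> M * (l * dist y z) + (L * dist y z) * B"
    proof (intro add_mono mult_mono w(2) B)
      show "\<bar>mollifier h (x - y) - mollifier h (x - z)\<bar> \<le> l * dist y z"
        using lipschitz_onD[OF l, of "x - y" "x - z"] by (simp add: dist_real_def dist_norm norm_minus_commute)
      show "\<bar>w y - w z\<bar> \<le> L * dist y z" using lipschitz_onD[OF w(1), of y z] by (simp add: dist_real_def)
    qed (use M0 lipschitz_on_nonneg[OF w(1)] in auto)
    finally show "dist (?v y) (?v z) \<le> (M * l + L * B) * dist y z" by (simp add: algebra_simps)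
  qed (use M0 B0 lipschitz_on_nonneg[OF l] lipschitz_on_nonneg[OF w(1)] in auto)
  have supp: "?v y = 0" if "norm x + h < norm y" for y
  proof -
    have "h \<le> norm (x - y)" using that norm_triangle_ineq2[of y x] by (simp add: norm_minus_commute)
    then show ?thesis by (simp add: mollifier_outside[OF h])
  qed
  have "AE y in lborel. ((\<lambda>t. ?v (y + t *\<^sub>R axis i 1)) has_real_derivative
      d y * mollifier h (x - y) - w y * mollifier_grad h (x - y) $ i) (at 0)"
    using deriv
  proof eventually_elim
    case (elim y)
    show ?case
      by (rule DERIV_cong[OF DERIV_mult[OF elim mollifier_directional]]) (simp add: inner_axis)
  qed
  note deriv' = this
  have m: "(\<lambda>y. d y * mollifier h (x - y) - w y * mollifier_grad h (x - y) $ i) \<in> borel_measurable borel"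
    by measurable
  show "integrable lborel (\<lambda>y. d y * mollifier h (x - y) - w y * mollifier_grad h (x - y) $ i)"
    using supp by (rule integral_directional_derivative(1)[OF v _ m deriv'])
  show "(LBINT y. d y * mollifier h (x - y) - w y * mollifier_grad h (x - y) $ i) = 0"
    using supp by (rule integral_directional_derivative(2)[OF v _ m deriv'])
qed

text \<open>The situation after localization, freed from \<open>\<Omega>\<close>: \<open>F\<close>
  and \<open>G\<close> stand for integrable representatives of \<open>f\<close> and
  \<open>Xf\<close> near \<open>K\<close>, and \<open>D\<close> for a bounded Borel version of the
  divergence of \<open>Y\<close>. \<open>weak\<close> is the distributional identity tested with
  \<open>\<lambda>y. mollifier h (x - y)\<close>, whose derivative along \<open>Y\<close> is
  \<open>- (Y y \<bullet> mollifier_grad h (x - y))\<close>.\<close>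

locale transport = bounded_lipschitz_flow Y \<phi> L M
  for Y :: "real ^ 'n \<Rightarrow> real ^ 'n" and \<phi> L M +
  fixes F G D :: "real ^ 'n \<Rightarrow> real" and N :: real and K :: "(real ^ 'n) set" and \<delta> :: real
  assumes F: "integrable lborel F" and G: "integrable lborel G"
    and D [measurable]: "D \<in> borel_measurable borel" and D_bound: "\<And>x. \<bar>D x\<bar> \<le> N"
    and K: "compact K" and \<delta>: "0 < \<delta>"
    and divergence_theorem: "\<And>x h. 0 < h \<Longrightarrow>
      (LBINT y. D y * mollifier h (x - y) - Y y \<bullet> mollifier_grad h (x - y)) = 0"
    and weak: "\<And>x h. x \<in> K \<Longrightarrow> 0 < h \<Longrightarrow> h \<le> \<delta> \<Longrightarrow>
      (LBINT y. G y * mollifier h (x - y)) =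
      (LBINT y. F y * (Y y \<bullet> mollifier_grad h (x - y))) - (LBINT y. F y * (mollifier h (x - y) * D y))"
begin

lemma F_borel [measurable]: "F \<in> borel_measurable borel" using borel_measurable_integrable[OF F] by simp
lemma G_borel [measurable]: "G \<in> borel_measurable borel" using borel_measurable_integrable[OF G] by simp
lemma K_borel [measurable]: "K \<in> sets borel" using K by (rule borel_compact)
lemma Y_continuous: "continuous_on UNIV Y" by (rule lipschitz_on_continuous_on[OF lip])
lemma Y_borel [measurable]: "Y \<in> borel_measurable borel" by (rule borel_measurable_continuous_onI[OF Y_continuous])
lemma N_nonneg: "0 \<le> N" using D_bound[of 0] by linarith

definition mollified :: "real \<Rightarrow> real ^ 'n \<Rightarrow> real" where
  "mollified h x = (LBINT y. F y * mollifier h (x - y))"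

text \<open>This is \<open>Y\<close> applied to the mollification of \<open>F\<close>.\<close>

definition mollified_deriv :: "real \<Rightarrow> real ^ 'n \<Rightarrow> real" where
  "mollified_deriv h x = (LBINT y. F y * (Y x \<bullet> mollifier_grad h (x - y)))"

lemma mollified_borel [measurable]: "mollified h \<in> borel_measurable borel"
  unfolding mollified_def by measurable

lemma mollified_deriv_borel [measurable]: "mollified_deriv h \<in> borel_measurable borel"
  unfolding mollified_deriv_def by measurable

definition V :: "real \<Rightarrow> real" where "V h = measure lborel (cball (0 :: real ^ 'n) h)"

lemma V_pos: "0 < h \<Longrightarrow> 0 < V h" unfolding V_def by (rule ball_vol_pos)

definition B :: real where
  "B = (SOME B. 0 < B \<and> (\<forall>h>0. \<forall>z :: real ^ 'n. \<bar>mollifier h z\<bar> \<le> B / V h \<and> h * norm (mollifier_grad h z) \<le> B / V h))"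

lemma B: "0 < B" "0 < h \<Longrightarrow> \<bar>mollifier h (z :: real ^ 'n)\<bar> \<le> B / V h"
  "0 < h \<Longrightarrow> h * norm (mollifier_grad h (z :: real ^ 'n)) \<le> B / V h"
  using someI_ex[OF mollifier_bounds[where 'n='n]] unfolding B_def V_def by blast+

lemma mollifier_grad_le: "0 < h \<Longrightarrow> norm (mollifier_grad h (z :: real ^ 'n)) \<le> B / V h / h"
  using B(3)[of h z] by (subst pos_le_divide_eq) (auto simp: mult.commute)

lemma inner_grad_le:
  fixes z v :: "real ^ 'n"
  assumes "0 < h" "norm v \<le> M'"
  shows "\<bar>v \<bullet> mollifier_grad h z\<bar> \<le> M' * (B / V h / h)"
  using assms mollifier_grad_le[OF assms(1), of z] order_trans[OF norm_ge_zero assms(2)]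
  by (intro order_trans[OF Cauchy_Schwarz_ineq2 mult_mono]) auto

lemma mollified_osc:
  assumes h: "0 < h"
  shows "ennreal \<bar>mollified h x - F x\<bar> \<le> ennreal (B / V h) * osc h F x"
  using kernel_osc[OF F, of "\<lambda>y. mollifier h (x - y)" "B / V h" h x] B V_pos[OF h] h
    mollifier_outside[OF h, of "x - _"] mollifier_integral_shifted[OF h, of x]
  unfolding mollified_def by (simp add: dist_norm)

text \<open>By \<open>weak\<close>, the difference between \<open>mollified_deriv\<close> and the
  mollification of \<open>G\<close> has the kernel \<open>?k\<close> acting on \<open>F\<close>. On
  its support \<open>Y x - Y y\<close> has size at most \<open>L * h\<close>, which cancels the
  extra \<open>1 / h\<close> of the gradient. The last term of the bound is the mollification error
  of \<open>G\<close>.\<close>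

lemma commutator_osc:
  assumes x: "x \<in> K" and h: "0 < h" "h \<le> \<delta>"
  shows "ennreal \<bar>mollified_deriv h x - G x\<bar> \<le>
    ennreal ((L + N) * (B / V h)) * osc h F x + ennreal (B / V h) * osc h G x"
proof -
  let ?m = "\<lambda>y. mollifier h (x - y)" and ?g = "\<lambda>y. mollifier_grad h (x - y)"
  let ?k = "\<lambda>y. (Y x - Y y) \<bullet> ?g y + ?m y * D y"
  have BV: "0 \<le> B / V h" using B(1) V_pos[OF h(1)] by simp
  have out: "?m y = 0" "?g y = 0" if "h < dist x y" for y
    using mollifier_outside[OF h(1), of "x - y"] that by (auto simp: dist_norm)
  have CB: "0 \<le> (L + N) * (B / V h)" using BV L_nonneg N_nonneg by (intro mult_nonneg_nonneg) auto
  have kb: "\<bar>?k y\<bar> \<le> (L + N) * (B / V h)" for y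
  proof (cases "h < dist x y")
    case True
    then show ?thesis using out[of y] CB by (simp del: times_divide_eq_right)
  next
    case False
    have "\<bar>(Y x - Y y) \<bullet> ?g y\<bar> \<le> norm (Y x - Y y) * norm (?g y)" by (rule Cauchy_Schwarz_ineq2)
    also have "\<dots> \<le> (L * h) * norm (?g y)"
    proof (intro mult_right_mono)
      have "norm (Y x - Y y) \<le> L * dist x y" using lipschitz_onD[OF lip, of x y] by (simp add: dist_norm)
      also have "\<dots> \<le> L * h" using False L_nonneg by (intro mult_left_mono) auto
      finally show "norm (Y x - Y y) \<le> L * h" .
    qed simp
    also have "\<dots> = L * (h * norm (?g y))" by simp
    also have "\<dots> \<le> L * (B / V h)" using B(3)[OF h(1), of "x - y"] L_nonneg by (intro mult_left_mono) auto
    finally have 1: "\<bar>(Y x - Y y) \<bullet> ?g y\<bar> \<le> L * (B / V h)" .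
    have 2: "\<bar>?m y * D y\<bar> \<le> (B / V h) * N"
      unfolding abs_mult using B(2)[OF h(1), of "x - y"] D_bound[of y] BV by (intro mult_mono) auto
    have "\<bar>?k y\<bar> \<le> L * (B / V h) + (B / V h) * N"
      by (rule order_trans[OF abs_triangle_ineq add_mono[OF 1 2]])
    then show ?thesis by (simp only: distrib_right mult.commute[of N])
  qed
  have kint: "integral\<^sup>L lborel ?k = 0"
  proof -
    have "integrable lborel (\<lambda>y. Y x \<bullet> ?g y)"
      by (rule integrable_bounded_support[where x=x and r=h, OF _ inner_grad_le[OF h(1) bound]]) (use out in auto)
    \<comment> \<open>Integration by parts for the constant field with value \<open>Y x\<close>,
      whose derivatives are 0; \<open>divergence_theorem\<close> handles the variable part.\<close>
    moreover have "(LBINT y. Y x \<bullet> ?g y) = 0"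
    proof -
      have "integrable lborel (\<lambda>y. 0 * ?m y - Y x $ i * ?g y $ i)"
        "(LBINT y. 0 * ?m y - Y x $ i * ?g y $ i) = 0" for i
        by (rule mollifier_integration_by_parts[OF h(1), of 0 "\<lambda>_. Y x $ i" "\<bar>Y x $ i\<bar>" "\<lambda>_. 0"];
            auto intro!: lipschitz_intros)+
      then show ?thesis by (auto simp: inner_vec_def intro!: sum.neutral)
    qed
    moreover have "integrable lborel (\<lambda>y. D y * ?m y - Y y \<bullet> ?g y)"
    proof (rule integrable_bounded_support[where x=x and r=h])
      show "\<bar>D y * ?m y - Y y \<bullet> ?g y\<bar> \<le> N * (B / V h) + M * (B / V h / h)" for y
      proof -
        have "\<bar>D y * ?m y\<bar> \<le> N * (B / V h)"
          unfolding abs_mult using B(2)[OF h(1), of "x - y"] D_bound[of y] N_nonneg by (intro mult_mono) auto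
        then show ?thesis using inner_grad_le[OF h(1) bound[of y], of "x - y"] by linarith
      qed
    qed (use out in auto)
    ultimately have "(LBINT y. Y x \<bullet> ?g y + (D y * ?m y - Y y \<bullet> ?g y)) = 0"
      using divergence_theorem[OF h(1), of x] by simp
    then show ?thesis by (simp add: inner_diff_left algebra_simps)
  qed
  have "ennreal \<bar>(LBINT y. F y * ?k y) - F x * integral\<^sup>L lborel ?k\<bar> \<le> ennreal ((L + N) * (B / V h)) * osc h F x"
    by (rule kernel_osc[OF F]) (use kb out CB in \<open>auto simp del: times_divide_eq_right\<close>)
  then have 1: "ennreal \<bar>(LBINT y. F y * ?k y)\<bar> \<le> ennreal ((L + N) * (B / V h)) * osc h F x"
    using kint by simp
  have 2: "ennreal \<bar>(LBINT y. G y * ?m y) - G x\<bar> \<le> ennreal (B / V h) * osc h G x"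
    using kernel_osc[OF G, of ?m "B / V h" h x] B(2)[OF h(1)] BV out mollifier_integral_shifted[OF h(1), of x]
    by simp
  have "mollified_deriv h x - (LBINT y. G y * ?m y) = (LBINT y. F y * ?k y)"
  proof -
    have i: "integrable lborel (\<lambda>y. F y * (Y x \<bullet> ?g y))" "integrable lborel (\<lambda>y. F y * (Y y \<bullet> ?g y))"
      by (rule integrable_mult_bounded[OF F _ inner_grad_le[OF h(1) bound]]; simp)+
    have "integrable lborel (\<lambda>y. F y * (?m y * D y))"
    proof (rule integrable_mult_bounded[OF F])
      show "\<bar>?m y * D y\<bar> \<le> (B / V h) * N" for y
        unfolding abs_mult using B(2)[OF h(1), of "x - y"] D_bound[of y] BV by (intro mult_mono) auto
    qed simp
    with i have "(LBINT y. F y * (Y x \<bullet> ?g y) - F y * (Y y \<bullet> ?g y) + F y * (?m y * D y)) =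
        mollified_deriv h x - (LBINT y. F y * (Y y \<bullet> ?g y)) + (LBINT y. F y * (?m y * D y))"
      unfolding mollified_deriv_def by simp
    moreover have "F y * (Y x \<bullet> ?g y) - F y * (Y y \<bullet> ?g y) + F y * (?m y * D y) = F y * ?k y" for y
      by (simp add: inner_diff_left algebra_simps)
    ultimately show ?thesis using weak[OF x h] by simp
  qed
  then have "\<bar>mollified_deriv h x - G x\<bar> \<le> \<bar>(LBINT y. F y * ?k y)\<bar> + \<bar>(LBINT y. G y * ?m y) - G x\<bar>"
    by linarith
  then have "ennreal \<bar>mollified_deriv h x - G x\<bar> \<le> ennreal \<bar>(LBINT y. F y * ?k y)\<bar> + ennreal \<bar>(LBINT y. G y * ?m y) - G x\<bar>"
    by (simp add: ennreal_plus[symmetric] ennreal_leI del: ennreal_plus)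
  also have "\<dots> \<le> ennreal ((L + N) * (B / V h)) * osc h F x + ennreal (B / V h) * osc h G x"
    by (intro add_mono 1 2)
  finally show ?thesis .
qed

lemma mollified_deriv_bound:
  assumes h: "0 < h"
  shows "\<bar>mollified_deriv h x\<bar> \<le> (LBINT y. \<bar>F y\<bar>) * (M * (B / V h / h))"
proof -
  have "\<bar>mollified_deriv h x\<bar> \<le> (LBINT y. \<bar>F y * (Y x \<bullet> mollifier_grad h (x - y))\<bar>)"
    unfolding mollified_deriv_def using integral_norm_bound[of lborel "\<lambda>y. F y * (Y x \<bullet> mollifier_grad h (x - y))"] by simp
  also have "\<dots> \<le> (LBINT y. \<bar>F y\<bar> * (M * (B / V h / h)))"
  proof (rule integral_mono)
    show "integrable lborel (\<lambda>y. \<bar>F y * (Y x \<bullet> mollifier_grad h (x - y))\<bar>)"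
      by (intro integrable_abs integrable_mult_bounded[OF F _ inner_grad_le[OF h bound]]) simp
    show "\<bar>F y * (Y x \<bullet> mollifier_grad h (x - y))\<bar> \<le> \<bar>F y\<bar> * (M * (B / V h / h))" for y
      unfolding abs_mult by (intro mult_left_mono inner_grad_le[OF h bound]) simp
  qed (use F in auto)
  finally show ?thesis by simp
qed

text \<open>For each fixed \<open>y\<close> the fundamental theorem of calculus is applied to the
  kernel along the trajectory; Fubini then interchanges the integrals over \<open>y\<close> and
  time.\<close>

lemma mollified_flow:
  assumes h: "0 < h" and t: "0 \<le> t"
  shows "mollified h (\<phi> t x) - mollified h x = path_integral (mollified_deriv h) t x"
proof -
  let ?q = "\<lambda>s y. Y (\<phi> s x) \<bullet> mollifier_grad h (\<phi> s x - y)"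
  have cont\<phi>: "continuous_on UNIV (\<lambda>s. \<phi> s x)"
    by (intro continuous_at_imp_continuous_on ballI has_vector_derivative_continuous[OF flow_deriv])
  note [measurable] = borel_measurable_continuous_onI[OF cont\<phi>]
  have ftc: "(LBINT s. indicator {0..t} s * ?q s y) = mollifier h (\<phi> t x - y) - mollifier h (x - y)" for y
  proof -
    have "(LBINT s. ?q s y * indicator {0..t} s) = mollifier h (\<phi> t x - y) - mollifier h (\<phi> 0 x - y)"
    proof (rule integral_FTC_Icc_real[OF t])
      fix s
      have "((\<lambda>s. \<phi> s x - y) has_derivative (\<lambda>h. h *\<^sub>R Y (\<phi> s x))) (at s)"
        using flow_deriv[of x s] unfolding has_vector_derivative_def by (auto intro!: derivative_eq_intros)
      from has_derivative_compose[OF this mollifier_has_derivative]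
      show "((\<lambda>s. mollifier h (\<phi> s x - y)) has_real_derivative ?q s y) (at s)"
        unfolding has_field_derivative_def by (rule has_derivative_eq_rhs) (simp add: fun_eq_iff inner_commute mult.commute)
      have "continuous_on UNIV (\<lambda>s. ?q s y)"
        by (intro continuous_intros continuous_on_compose2[OF Y_continuous cont\<phi>]
            continuous_on_compose2[OF mollifier_grad_continuous] cont\<phi>) auto
      then show "isCont (\<lambda>s. ?q s y) s" by (simp add: continuous_on_eq_continuous_at)
    qed
    then show ?thesis by (simp add: flow_0 mult.commute)
  qed
  let ?f = "\<lambda>s y. indicator {0..t} s * (F y * ?q s y)"
  let ?c = "M * (B / V h / h)"
  have c0: "0 \<le> ?c" using M_nonneg B(1) V_pos[OF h] h by simp
  have int: "integrable (lborel \<Otimes>\<^sub>M lborel) (\<lambda>(s, y). ?f s y)"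
  proof (rule integrableI_bounded)
    show "(\<lambda>(s, y). ?f s y) \<in> borel_measurable (lborel \<Otimes>\<^sub>M lborel)" by measurable
    have "(\<integral>\<^sup>+p. ennreal (norm (case p of (s, y) \<Rightarrow> ?f s y)) \<partial>(lborel \<Otimes>\<^sub>M lborel)) =
        (\<integral>\<^sup>+s. \<integral>\<^sup>+y. ennreal (norm (?f s y)) \<partial>lborel \<partial>lborel)"
      by (subst lborel.nn_integral_fst[symmetric]) (auto, measurable)
    also have "\<dots> \<le> (\<integral>\<^sup>+s. \<integral>\<^sup>+y. indicator {0..t} s * (ennreal ?c * ennreal (norm (F y))) \<partial>lborel \<partial>lborel)"
    proof (intro nn_integral_mono)
      fix s y
      have "norm (F y * ?q s y) \<le> ?c * norm (F y)"
        using mult_left_mono[OF inner_grad_le[OF h bound, of "\<phi> s x" "\<phi> s x - y"], of "\<bar>F y\<bar>"]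
        by (simp add: abs_mult mult_ac)
      then show "ennreal (norm (?f s y)) \<le> indicator {0..t} s * (ennreal ?c * ennreal (norm (F y)))"
        using c0 by (auto simp: indicator_def ennreal_mult[symmetric] intro!: ennreal_leI)
    qed
    also have "\<dots> = (\<integral>\<^sup>+s. indicator {0..t} s * (ennreal ?c * (\<integral>\<^sup>+y. ennreal (norm (F y)) \<partial>lborel)) \<partial>lborel)"
      by (simp add: nn_integral_cmult)
    also have "\<dots> = ennreal t * (ennreal ?c * (\<integral>\<^sup>+y. ennreal (norm (F y)) \<partial>lborel))"
      using t by (simp add: nn_integral_multc)
    also have "\<dots> < \<infinity>" using F by (simp add: integrable_iff_bounded ennreal_mult_less_top)
    finally show "(\<integral>\<^sup>+p. ennreal (norm (case p of (s, y) \<Rightarrow> ?f s y)) \<partial>(lborel \<Otimes>\<^sub>M lborel)) < \<infinity>" .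
  qed
  have im: "integrable lborel (\<lambda>y. F y * mollifier h (z - y))" for z
    by (rule integrable_mult_bounded[OF F _ B(2)[OF h]]) simp
  have "mollified h (\<phi> t x) - mollified h x = (LBINT y. F y * mollifier h (\<phi> t x - y) - F y * mollifier h (x - y))"
    unfolding mollified_def using im by simp
  also have "\<dots> = (LBINT y. (LBINT s. ?f s y))"
  proof (rule Bochner_Integration.integral_cong[OF refl])
    fix y
    have "(LBINT s. ?f s y) = (LBINT s. F y * (indicator {0..t} s * ?q s y))"
      by (simp add: mult_ac)
    also have "\<dots> = F y * (mollifier h (\<phi> t x - y) - mollifier h (x - y))"
      by (simp add: ftc)
    finally show "F y * mollifier h (\<phi> t x - y) - F y * mollifier h (x - y) = (LBINT s. ?f s y)"
      by (simp add: algebra_simps)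
  qed
  also have "\<dots> = (LBINT s. (LBINT y. ?f s y))"
    by (rule lborel_pair.Fubini_integral[OF int])
  also have "\<dots> = path_integral (mollified_deriv h) t x"
    unfolding mollified_deriv_def by simp
  finally show ?thesis .
qed

lemma confined_closed: "closed {x. \<forall>s\<in>{0..t}. \<phi> s x \<in> K}"
proof -
  have "{x. \<forall>s\<in>{0..t}. \<phi> s x \<in> K} = (\<Inter>s\<in>{0..t}. \<phi> s -` K)" by auto
  moreover have "closed (\<phi> s -` K)" for s
    by (intro closed_vimage compact_imp_closed K flow_space_continuous)
  ultimately show ?thesis by (simp only:) (intro closed_INT ballI)
qed

text \<open>Subtracting \<open>mollified_flow\<close> bounds the defect \<open>J\<close> by the
  mollification errors at the two end points plus the commutator error along the trajectory.
  Integrated over \<open>x\<close>, each is a small L^1 norm, enlarged by the flow maps at most by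
  the factor \<open>C\<close>.\<close>

proposition transport_identity:
  assumes t: "0 \<le> t"
  shows "AE x in lborel. (\<forall>s\<in>{0..t}. \<phi> s x \<in> K) \<longrightarrow>
    F (\<phi> t x) - F x = path_integral G t x"
proof -
  define C where "C = exp (L * t) ^ DIM(real ^ 'n)"
  have C: "0 \<le> C" unfolding C_def by simp
  have comp: "compresses C (\<phi> s)" if "s \<in> {0..t}" for s
    unfolding C_def using that by (intro flow_compresses_le) auto
  define A where "A = {x. \<forall>s\<in>{0..t}. \<phi> s x \<in> K}"
  have [measurable]: "A \<in> sets borel" unfolding A_def using confined_closed by (rule borel_closed)
  define J where "J x = ennreal \<bar>F (\<phi> t x) - F x - path_integral G t x\<bar>" for x
  have [measurable]: "J \<in> borel_measurable borel" unfolding J_def by measurable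
  \<comment> \<open>The summands stem from the error at \<open>\<phi> t x\<close>, the error at
    \<open>x\<close>, and the commutator error integrated over the time \<open>t\<close>.\<close>
  define c where "c = C * B + B + t * (C * ((L + N) * B + B))"
  have c: "0 \<le> c" unfolding c_def using C t B(1) L_nonneg N_nonneg by simp
  have main: "(\<integral>\<^sup>+x. indicator A x * J x \<partial>lborel) \<le> ennreal (c * e)" if e: "0 < e" for e
  proof -
    obtain d1 where d1: "d1 > 0" "\<And>h. 0 < h \<Longrightarrow> h \<le> d1 \<Longrightarrow> (\<integral>\<^sup>+x. osc h F x \<partial>lborel) \<le> ennreal (e * V h)"
      using osc_small[OF F e] unfolding V_def by auto
    obtain d2 where d2: "d2 > 0" "\<And>h. 0 < h \<Longrightarrow> h \<le> d2 \<Longrightarrow> (\<integral>\<^sup>+x. osc h G x \<partial>lborel) \<le> ennreal (e * V h)"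
      using osc_small[OF G e] unfolding V_def by auto
    define h where "h = min (min d1 d2) \<delta>"
    have h: "0 < h" "h \<le> d1" "h \<le> d2" "h \<le> \<delta>" using d1 d2 \<delta> unfolding h_def by auto
    note V = V_pos[OF h(1)]
    have scale: "ennreal (r * (B / V h)) * I \<le> ennreal (r * B * e)" if "I \<le> ennreal (e * V h)" "0 \<le> r" for r I
    proof -
      have "ennreal (r * (B / V h)) * I \<le> ennreal (r * (B / V h)) * ennreal (e * V h)"
        using that by (intro mult_left_mono) auto
      also have "\<dots> = ennreal (r * (B / V h) * (e * V h))"
        using that e V B(1) by (intro ennreal_mult[symmetric]) auto
      also have "r * (B / V h) * (e * V h) = r * B * e" using V by simp
      finally show ?thesis .
    qed
    define a where "a x = ennreal \<bar>mollified h x - F x\<bar>" for x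
    \<comment> \<open>The commutator estimate is available on \<open>K\<close> only; for
      \<open>x\<close> in \<open>A\<close> the indicator is 1 along the whole trajectory.\<close>
    define b where "b x = indicator K x * ennreal \<bar>mollified_deriv h x - G x\<bar>" for x
    have [measurable]: "a \<in> borel_measurable borel" "b \<in> borel_measurable borel"
      unfolding a_def b_def by measurable
    have Ia: "(\<integral>\<^sup>+x. a x \<partial>lborel) \<le> ennreal (B * e)"
    proof -
      have "(\<integral>\<^sup>+x. a x \<partial>lborel) \<le> (\<integral>\<^sup>+x. ennreal (B / V h) * osc h F x \<partial>lborel)"
        unfolding a_def by (intro nn_integral_mono mollified_osc h)
      also have "\<dots> = ennreal (B / V h) * (\<integral>\<^sup>+x. osc h F x \<partial>lborel)" by (rule nn_integral_cmult) measurable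
      also have "\<dots> \<le> ennreal (B * e)" using scale[OF d1(2)[OF h(1,2)], of 1] by simp
      finally show ?thesis .
    qed
    have Ib: "(\<integral>\<^sup>+x. b x \<partial>lborel) \<le> ennreal (((L + N) * B + B) * e)"
    proof -
      have "b x \<le> ennreal ((L + N) * (B / V h)) * osc h F x + ennreal (B / V h) * osc h G x" for x
        using commutator_osc[OF _ h(1,4), of x] by (cases "x \<in> K") (auto simp: b_def)
      then have "(\<integral>\<^sup>+x. b x \<partial>lborel) \<le>
          (\<integral>\<^sup>+x. ennreal ((L + N) * (B / V h)) * osc h F x + ennreal (B / V h) * osc h G x \<partial>lborel)"
        by (intro nn_integral_mono)
      also have "\<dots> = ennreal ((L + N) * (B / V h)) * (\<integral>\<^sup>+x. osc h F x \<partial>lborel)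
          + ennreal (B / V h) * (\<integral>\<^sup>+x. osc h G x \<partial>lborel)"
        by (simp add: nn_integral_add nn_integral_cmult)
      also have "\<dots> \<le> ennreal ((L + N) * B * e) + ennreal (B * e)"
        using scale[OF d1(2)[OF h(1,2)], of "L + N"] scale[OF d2(2)[OF h(1,3)], of 1] L_nonneg N_nonneg
        by (intro add_mono) auto
      also have "\<dots> = ennreal (((L + N) * B + B) * e)"
        using L_nonneg N_nonneg B(1) e by (subst ennreal_plus[symmetric]) (auto simp: distrib_right)
      finally show ?thesis .
    qed
    have point: "AE x in lborel. indicator A x * J x \<le>
        a (\<phi> t x) + (a x + (\<integral>\<^sup>+s. indicator {0..t} s * b (\<phi> s x) \<partial>lborel))"
      using flow_integrable_AE[OF t G]
    proof eventually_elim
      case (elim x)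
      show ?case
      proof (cases "x \<in> A")
        case True
        let ?H = "\<lambda>s. mollified_deriv h (\<phi> s x)"
        have [measurable]: "(\<lambda>s. \<phi> s x) \<in> borel_measurable borel" by measurable
        have iH: "integrable lborel (\<lambda>s. indicator {0..t} s * ?H s)"
          by (rule integrable_mult_bounded[OF integrable_real_indicator _ mollified_deriv_bound[OF h(1)]]) (use t in auto)
        have eq: "F (\<phi> t x) - F x - path_integral G t x =
            (mollified h x - F x) - (mollified h (\<phi> t x) - F (\<phi> t x)) +
            (LBINT s. indicator {0..t} s * ?H s - indicator {0..t} s * G (\<phi> s x))"
          unfolding Bochner_Integration.integral_diff[OF iH elim] mollified_flow[OF h(1) t, of x, symmetric] by simp
        have "\<bar>p - q + r\<bar> \<le> \<bar>q\<bar> + (\<bar>p\<bar> + \<bar>r\<bar>)" for p q r :: real by linarith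
        from this[of "mollified h x - F x" "mollified h (\<phi> t x) - F (\<phi> t x)"]
        have "\<bar>F (\<phi> t x) - F x - path_integral G t x\<bar> \<le>
            \<bar>mollified h (\<phi> t x) - F (\<phi> t x)\<bar> + (\<bar>mollified h x - F x\<bar> +
            \<bar>(LBINT s. indicator {0..t} s * ?H s - indicator {0..t} s * G (\<phi> s x))\<bar>)"
          unfolding eq .
        then have "J x \<le> a (\<phi> t x) + (a x + ennreal \<bar>(LBINT s. indicator {0..t} s * ?H s - indicator {0..t} s * G (\<phi> s x))\<bar>)"
          unfolding J_def a_def by (rule ennreal_le_add3) (rule abs_ge_zero)+
        also have "ennreal \<bar>(LBINT s. indicator {0..t} s * ?H s - indicator {0..t} s * G (\<phi> s x))\<bar> \<le>
            (\<integral>\<^sup>+s. ennreal (norm (indicator {0..t} s * ?H s - indicator {0..t} s * G (\<phi> s x))) \<partial>lborel)"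
          using integral_norm_bound_ennreal[OF Bochner_Integration.integrable_diff[OF iH elim]] by simp
        also have "\<dots> = (\<integral>\<^sup>+s. indicator {0..t} s * b (\<phi> s x) \<partial>lborel)"
          using True by (intro nn_integral_cong) (auto simp: indicator_def b_def A_def)
        finally show ?thesis using True by (simp add: add_left_mono)
      qed simp
    qed
    have "(\<integral>\<^sup>+x. indicator A x * J x \<partial>lborel) \<le>
        (\<integral>\<^sup>+x. a (\<phi> t x) + (a x + (\<integral>\<^sup>+s. indicator {0..t} s * b (\<phi> s x) \<partial>lborel)) \<partial>lborel)"
      by (rule nn_integral_mono_AE[OF point])
    also have "\<dots> = (\<integral>\<^sup>+x. a (\<phi> t x) \<partial>lborel) + ((\<integral>\<^sup>+x. a x \<partial>lborel) +
        (\<integral>\<^sup>+x. \<integral>\<^sup>+s. indicator {0..t} s * b (\<phi> s x) \<partial>lborel \<partial>lborel))"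
      by (subst nn_integral_add, measurable, subst nn_integral_add, measurable)
    also have "(\<integral>\<^sup>+x. \<integral>\<^sup>+s. indicator {0..t} s * b (\<phi> s x) \<partial>lborel \<partial>lborel) =
        (\<integral>\<^sup>+s. \<integral>\<^sup>+x. indicator {0..t} s * b (\<phi> s x) \<partial>lborel \<partial>lborel)"
      by (rule lborel_pair.Fubini'[symmetric]) measurable
    also have "\<dots> = (\<integral>\<^sup>+s. indicator {0..t} s * (\<integral>\<^sup>+x. b (\<phi> s x) \<partial>lborel) \<partial>lborel)"
      by (intro nn_integral_cong nn_integral_cmult) measurable
    also have "\<dots> \<le> (\<integral>\<^sup>+s. indicator {0..t} s * ennreal (C * (((L + N) * B + B) * e)) \<partial>lborel)"
    proof (rule nn_integral_mono)
      fix s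
      show "indicator {0..t} s * (\<integral>\<^sup>+x. b (\<phi> s x) \<partial>lborel) \<le> indicator {0..t} s * ennreal (C * (((L + N) * B + B) * e))"
      proof (cases "s \<in> {0..t}")
        case True
        have "(\<integral>\<^sup>+x. b (\<phi> s x) \<partial>lborel) \<le> ennreal C * (\<integral>\<^sup>+x. b x \<partial>lborel)"
          by (rule compresses_nn_integral[OF comp[OF True]]) measurable
        also have "\<dots> \<le> ennreal C * ennreal (((L + N) * B + B) * e)" by (intro mult_left_mono Ib) simp
        also have "\<dots> = ennreal (C * (((L + N) * B + B) * e))"
          using C by (simp add: ennreal_mult')
        finally show ?thesis using True by simp
      qed simp
    qed
    also have "\<dots> = ennreal (t * (C * (((L + N) * B + B) * e)))"
      using t by (simp add: nn_integral_multc ennreal_mult')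
    also have "(\<integral>\<^sup>+x. a (\<phi> t x) \<partial>lborel) \<le> ennreal C * (\<integral>\<^sup>+x. a x \<partial>lborel)"
      using t by (intro compresses_nn_integral comp) auto
    also have "\<dots> \<le> ennreal C * ennreal (B * e)" by (intro mult_left_mono Ia) simp
    also have "\<dots> = ennreal (C * (B * e))" using C by (simp add: ennreal_mult')
    also have "(\<integral>\<^sup>+x. a x \<partial>lborel) \<le> ennreal (B * e)" by (rule Ia)
    also have "ennreal (C * (B * e)) + (ennreal (B * e) + ennreal (t * (C * (((L + N) * B + B) * e)))) = ennreal (c * e)"
      using C t B(1) e L_nonneg N_nonneg unfolding c_def
      by (subst ennreal_plus[symmetric], simp, simp)+ (simp add: algebra_simps)
    finally show ?thesis by (simp add: add_mono)
  qed
  have "(\<integral>\<^sup>+x. indicator A x * J x \<partial>lborel) \<le> 0"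
  proof (rule ennreal_le_epsilon)
    fix e :: real assume "0 < e"
    then have "0 < e / (c + 1)" "c * (e / (c + 1)) \<le> e" using c by (auto simp: field_simps)
    then show "(\<integral>\<^sup>+x. indicator A x * J x \<partial>lborel) \<le> 0 + ennreal e"
      using main[of "e / (c + 1)"] by (auto intro: order_trans ennreal_leI)
  qed
  then have "AE x in lborel. indicator A x * J x = 0"
    by (subst (asm) le_zero_eq, subst (asm) nn_integral_0_iff_AE) auto
  then show ?thesis
    by eventually_elim (auto simp: A_def J_def indicator_def split: if_splits)
qed

end

section \<open>Localization\<close>

locale lipschitz_field =
  fixes X :: "real ^ 'n \<Rightarrow> real ^ 'n" and \<Omega> :: "(real ^ 'n) set"
  assumes open_domain: "open \<Omega>" and local_lip: "local_lipschitz (UNIV :: real set) \<Omega> (\<lambda>_. X)"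

text \<open>Agreement of the fields on an open \<open>V\<close> around \<open>K\<close> lets their
  partial derivatives be compared there, and makes curves in \<open>V\<close> solve both equations
  at once.\<close>

locale cutoff_flow = lipschitz_field X \<Omega> + bounded_lipschitz_flow Y \<phi> L M
  for X Y :: "real ^ 'n \<Rightarrow> real ^ 'n" and \<Omega> \<phi> L M +
  fixes K V :: "(real ^ 'n) set"
  assumes compact_K: "compact K" and open_V: "open V" and K_V: "K \<subseteq> V" and V_domain: "V \<subseteq> \<Omega>"
    and field_eq: "\<And>x. x \<in> V \<Longrightarrow> Y x = X x"

lemma (in lipschitz_field) cutoff_field_exists:
  assumes K: "compact K" "K \<subseteq> \<Omega>"
  shows "\<exists>Y V L M. L-lipschitz_on UNIV Y \<and> (\<forall>x. norm (Y x) \<le> M) \<and> open V \<and> K \<subseteq> V \<and> V \<subseteq> \<Omega> \<and> (\<forall>x\<in>V. Y x = X x)"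
proof (cases "K = {}")
  \<comment> \<open>\<open>infdist\<close> to the empty set is 0 by convention, so the
    neighbourhoods used in the other case make sense only for nonempty \<open>K\<close>.\<close>
  case True
  have "0-lipschitz_on UNIV (\<lambda>_. 0 :: real ^ 'n)" by (rule lipschitz_on_constant)
  then show ?thesis using True
    by (intro exI[of _ "\<lambda>_. 0"] exI[of _ "{}"] exI[of _ 0]) auto
next
  case False
  obtain r where r: "0 < r" "{x. infdist x K \<le> r} \<subseteq> \<Omega>"
    using compact_in_open_separated[OF False K(1) open_domain K(2)] by blast
  define K2 where "K2 = {x. infdist x K \<le> r}"
  have K2: "compact K2" "K2 \<subseteq> \<Omega>" unfolding K2_def using compact_infdist_le[OF False K(1) r(1)] r(2) by auto
  obtain l where l: "l-lipschitz_on K2 X"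
  proof (rule local_lipschitz_compact_implies_lipschitz)
    \<comment> \<open>Freezing the dummy time parameter at 0 makes the time set compact as well, so
      that one constant serves on all of \<open>K2\<close>.\<close>
    show "local_lipschitz {0::real} K2 (\<lambda>_. X)"
      using local_lipschitz_subset[OF local_lip, of "{0}" K2] K2(2) by simp
  qed (use K2 in auto)
  have "compact (X ` K2)" using K2(1) lipschitz_on_continuous_on[OF l] by (intro compact_continuous_image)
  then obtain M where M: "\<And>x. x \<in> K2 \<Longrightarrow> norm (X x) \<le> M" using compact_imp_bounded bounded_iff by (metis imageI)
  \<comment> \<open>A Lipschitz cutoff: 1 up to distance \<open>r / 2\<close> from \<open>K\<close>,
    and 0 from distance \<open>r\<close> on.\<close>
  define \<eta> where "\<eta> x = max 0 (min 1 (2 - 2 * infdist x K / r))" for x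
  have \<eta>01: "0 \<le> \<eta> x" "\<eta> x \<le> 1" for x unfolding \<eta>_def by auto
  have \<eta>0: "\<eta> x = 0" if "x \<notin> K2" for x using that r(1) unfolding \<eta>_def K2_def by (auto simp: field_simps max_def min_def)
  have \<eta>lip: "\<bar>\<eta> x - \<eta> y\<bar> \<le> (2 / r) * dist x y" for x y
  proof -
    have "\<bar>max 0 (min 1 (2 - a)) - max 0 (min 1 (2 - b))\<bar> \<le> \<bar>a - b\<bar>" for a b :: real by (auto simp: max_def min_def)
    then have "\<bar>\<eta> x - \<eta> y\<bar> \<le> \<bar>2 * infdist x K / r - 2 * infdist y K / r\<bar>" unfolding \<eta>_def .
    also have "\<dots> = (2 / r) * \<bar>infdist x K - infdist y K\<bar>"
    proof -
      have "2 * a / r - 2 * b / r = (2 / r) * (a - b)" for a b :: real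
        by (simp add: right_diff_distrib diff_divide_distrib)
      then show ?thesis using r(1) by (simp only: abs_mult) simp
    qed
    also have "\<dots> \<le> (2 / r) * dist x y" using r(1) by (intro mult_left_mono infdist_triangle_abs) auto
    finally show ?thesis .
  qed
  obtain k where "k \<in> K" using False by blast
  then have "k \<in> K2" using r(1) unfolding K2_def by simp
  then have M0: "0 \<le> M" using M norm_ge_zero order_trans by blast
  define Y where "Y x = \<eta> x *\<^sub>R X x" for x
  have Yle: "norm (Y x) \<le> M" for x
  proof (cases "x \<in> K2")
    case True
    have "norm (Y x) \<le> 1 * M" unfolding Y_def norm_scaleR using \<eta>01[of x] M[OF True] M0 by (intro mult_mono) auto
    then show ?thesis by simp
  qed (use M0 in \<open>simp add: Y_def \<eta>0\<close>)
  \<comment> \<open>\<open>X\<close> is controlled on \<open>K2\<close> only, so the increment of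
    \<open>\<eta>\<close> is multiplied by \<open>X\<close> at the point \<open>x\<close> of
    \<open>K2\<close>; off \<open>K2\<close> the field \<open>Y\<close> vanishes.\<close>
  have half: "norm (Y x - Y y) \<le> (l + 2 / r * M) * dist x y" if x: "x \<in> K2" for x y
  proof (cases "y \<in> K2")
    case True
    have "norm (Y x - Y y) = norm (\<eta> y *\<^sub>R (X x - X y) + (\<eta> x - \<eta> y) *\<^sub>R X x)"
      unfolding Y_def by (simp add: algebra_simps)
    also have "\<dots> \<le> \<bar>\<eta> y\<bar> * norm (X x - X y) + \<bar>\<eta> x - \<eta> y\<bar> * norm (X x)"
      by (rule order_trans[OF norm_triangle_ineq]) simp
    also have "\<dots> \<le> 1 * (l * dist x y) + (2 / r * dist x y) * M"
      using lipschitz_onD[OF l x True] \<eta>01[of y] M[OF x] r(1)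
      by (intro add_mono mult_mono \<eta>lip) (auto simp: dist_norm)
    finally show ?thesis by (simp add: algebra_simps)
  next
    case False
    have "norm (Y x - Y y) = \<bar>\<eta> x - \<eta> y\<bar> * norm (X x)" using \<eta>0[OF False] by (simp add: Y_def)
    also have "\<dots> \<le> (2 / r * dist x y) * M" using M[OF x] r(1) by (intro mult_mono \<eta>lip) auto
    also have "\<dots> \<le> l * dist x y + (2 / r * dist x y) * M"
      using lipschitz_on_nonneg[OF l] by simp
    also have "\<dots> = (l + 2 / r * M) * dist x y" by (simp add: algebra_simps)
    finally show ?thesis .
  qed
  have "(l + 2 / r * M)-lipschitz_on UNIV Y"
  proof (rule lipschitz_onI)
    fix x y
    show "dist (Y x) (Y y) \<le> (l + 2 / r * M) * dist x y"
    proof (cases "x \<in> K2 \<or> y \<in> K2")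
      case True
      then show ?thesis using half[of x y] half[of y x] by (auto simp: dist_norm norm_minus_commute)
    next
      case False
      then show ?thesis using \<eta>0 lipschitz_on_nonneg[OF l] r(1) M0 by (simp add: Y_def)
    qed
  qed (use lipschitz_on_nonneg[OF l] r(1) M0 in simp)
  moreover have "open {x. infdist x K < r / 2}"
    by (intro open_Collect_less continuous_intros)
  moreover have "K \<subseteq> {x. infdist x K < r / 2}" using r(1) by auto
  moreover have "{x. infdist x K < r / 2} \<subseteq> \<Omega>" using r by auto
  moreover have "\<forall>x\<in>{x. infdist x K < r / 2}. Y x = X x"
    using r(1) by (auto simp: Y_def \<eta>_def max_def min_def field_simps)
  ultimately show ?thesis using Yle by blast
qed

lemma (in lipschitz_field) cutoff_flow_exists:
  assumes K: "compact K" "K \<subseteq> \<Omega>"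
  shows "\<exists>Y \<phi> L M V. cutoff_flow X Y \<Omega> \<phi> L M K V"
proof -
  obtain Y V L M where Y: "L-lipschitz_on UNIV Y" "\<And>x. norm (Y x) \<le> M"
    and V: "open V" "K \<subseteq> V" "V \<subseteq> \<Omega>" "\<And>x. x \<in> V \<Longrightarrow> Y x = X x"
    using cutoff_field_exists[OF K] by metis
  obtain \<phi> where "bounded_lipschitz_flow Y \<phi> L M" using bounded_lipschitz_flow_exists[OF Y] by blast
  then have "cutoff_flow X Y \<Omega> \<phi> L M K V"
    using lipschitz_field_axioms V K(1) by (auto simp: cutoff_flow_def cutoff_flow_axioms_def)
  then show ?thesis by blast
qed

context cutoff_flow
begin

lemma solution_eq_flow:
  assumes sol: "is_solution X \<Omega> x I \<gamma>" and t: "t \<in> I" and V: "\<And>s. s \<in> closed_segment 0 t \<Longrightarrow> \<gamma> s \<in> V"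
  shows "\<gamma> t = \<phi> t x"
proof -
  have "closed_segment 0 t \<subseteq> I"
    using sol t unfolding is_solution_def is_interval_convex_1 by (auto intro: closed_segment_subset[THEN subsetD])
  then have "(\<gamma> has_vector_derivative Y (\<gamma> s)) (at s)" if "s \<in> closed_segment 0 t" for s
    using sol V[OF that] that field_eq unfolding is_solution_def by auto
  from flow_unique[OF this] show ?thesis using sol unfolding is_solution_def by simp
qed

lemma flow_is_solution:
  assumes "open I" "is_interval I" "0 \<in> I" "\<And>s. s \<in> I \<Longrightarrow> \<phi> s x \<in> V"
  shows "is_solution X \<Omega> x I (\<lambda>s. \<phi> s x)"
proof -
  have "((\<lambda>s. \<phi> s x) has_vector_derivative X (\<phi> s x)) (at s)" if "s \<in> I" for s
    using flow_deriv[of x s] field_eq[OF assms(4)[OF that]] by simp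
  then show ?thesis unfolding is_solution_def using assms V_domain by (auto simp: flow_0)
qed

text \<open>Each \<open>\<phi> t\<close> pulls null sets back to null sets; Fubini turns this into
  statements about almost all pairs and, in the other order, about almost all times on almost every
  trajectory. A Borel null set containing the exceptional points stands in for the possibly
  nonmeasurable \<open>P\<close>.\<close>

lemma AE_flow_pair:
  assumes "AE x in lborel. P x"
  shows "AE p in lborel. P (\<phi> (fst p) (snd p))" "AE x in lborel. AE t in lborel. P (\<phi> t x)"
proof -
  obtain N where N: "N \<in> null_sets lborel" "{x. \<not> P x} \<subseteq> N"
    using assms unfolding eventually_ae_filter by auto
  have [measurable]: "N \<in> sets borel" using N by auto
  have "AE x in lborel. \<phi> t x \<notin> N" for t
    by (rule compresses_AE[OF flow_compresses AE_not_in[OF N(1)]])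
  then have 1: "AE t in lborel. AE x in lborel. \<phi> t x \<notin> N" by simp
  have m: "{p \<in> space (lborel \<Otimes>\<^sub>M lborel). \<phi> (fst p) (snd p) \<notin> N} \<in> sets (lborel \<Otimes>\<^sub>M lborel)"
    by measurable
  have "AE p in (lborel \<Otimes>\<^sub>M lborel). \<phi> (fst p) (snd p) \<notin> N"
    using lborel_pair.AE_pair_measure[OF m] 1 by simp
  then have "AE p in lborel. \<phi> (fst p) (snd p) \<notin> N" unfolding lborel_prod .
  then show "AE p in lborel. P (\<phi> (fst p) (snd p))" by eventually_elim (use N in auto)
  have "AE x in lborel. AE t in lborel. \<phi> t x \<notin> N"
    using lborel_pair.AE_commute[of "\<lambda>t x. \<phi> t x \<notin> N"] m 1 by simp
  then show "AE x in lborel. AE t in lborel. P (\<phi> t x)"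
    by eventually_elim (erule eventually_mono, use N in auto)
qed

end

section \<open>Borel representatives of functions given modulo null sets\<close>

lemma AE_snd:
  fixes P :: "'b::euclidean_space \<Rightarrow> bool"
  assumes "AE x in lborel. P x"
  shows "AE p in (lborel :: ('a::euclidean_space \<times> 'b) measure). P (snd p)"
proof -
  obtain N where N: "N \<in> null_sets lborel" "{x. \<not> P x} \<subseteq> N"
    using assms unfolding eventually_ae_filter by auto
  have [measurable]: "N \<in> sets borel" using N by auto
  have m: "{p \<in> space ((lborel :: 'a measure) \<Otimes>\<^sub>M lborel). snd p \<notin> N} \<in> sets ((lborel :: 'a measure) \<Otimes>\<^sub>M lborel)"
    by measurable
  have "AE p in ((lborel :: 'a measure) \<Otimes>\<^sub>M lborel). snd p \<notin> N"
    using lborel_pair.AE_pair_measure[OF m] AE_not_in[OF N(1)] by simp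
  then have "AE p in (lborel :: ('a \<times> 'b) measure). snd p \<notin> N" unfolding lborel_prod .
  then show ?thesis by eventually_elim (use N in auto)
qed

text \<open>\<open>h\<close> is measurable because Lebesgue measure is complete. This covers
  integrands containing \<open>divergence X\<close>, which are under control only up to a null
  set.\<close>

lemma integral_lebesgue_eq_lborel:
  fixes h h' :: "'a::euclidean_space \<Rightarrow> real"
  assumes h': "h' \<in> borel_measurable borel" and ae: "AE y in lborel. h y = h' y"
  shows "integral\<^sup>L lebesgue h = integral\<^sup>L lborel h'"
proof -
  have ae': "AE y in lebesgue. h' y = h y" using ae by (intro AE_completion) auto
  have m': "h' \<in> borel_measurable lebesgue" using h' by (intro measurable_completion) simp
  have "h \<in> borel_measurable lebesgue"
  proof (rule measurableI)
    fix A :: "real set" assume "A \<in> sets borel"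
    then have 1: "h' -` A \<inter> space lebesgue \<in> sets lebesgue" by (rule measurable_sets[OF m'])
    have 2: "AE y in lebesgue. y \<in> h' -` A \<inter> space lebesgue \<longleftrightarrow> y \<in> h -` A \<inter> space lebesgue"
      using ae' by eventually_elim auto
    show "h -` A \<inter> space lebesgue \<in> sets lebesgue"
      by (rule completion.in_sets_AE[OF 2 1]) simp
  qed simp
  then have "integral\<^sup>L lebesgue h = integral\<^sup>L lebesgue h'"
    using m' ae' by (intro integral_cong_AE) (auto simp: eq_commute)
  also have "\<dots> = integral\<^sup>L lborel h'" using h' by (intro integral_completion) simp
  finally show ?thesis .
qed

text \<open>With a Borel function in place of \<open>f\<close>, compositions with the flow are
  measurable and Fubini applies to them.\<close>

lemma locally_integrable_representative:
  assumes f: "f locally_integrable_on \<Omega>" and K: "compact K" "K \<subseteq> \<Omega>"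
  shows "\<exists>F. integrable lborel F \<and> (AE x in lborel. F x = indicator K x * f x)"
proof -
  have int: "integrable lebesgue (\<lambda>x. indicator K x *\<^sub>R f x)"
    using f K unfolding locally_integrable_on_def set_integrable_def by auto
  then obtain F where F: "F \<in> borel_measurable lborel" "AE x in lborel. indicator K x *\<^sub>R f x = F x"
    using completion_ex_borel_measurable_real[OF borel_measurable_integrable[OF int]] by auto
  have "integrable lebesgue F"
    using int F(2) F(1)
    by (subst integrable_cong_AE[of F lebesgue "\<lambda>x. indicator K x *\<^sub>R f x"])
      (auto intro!: AE_completion measurable_completion borel_measurable_integrable[OF int] elim: eventually_mono simp del: real_scaleR_def)
  then have "integrable lborel F" using F(1) by (simp add: integrable_completion)
  then show ?thesis using F(2) by (intro exI[of _ F]) (auto elim: eventually_mono)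
qed

text \<open>Each diagonal partial derivative has a Borel version bounded by \<open>L\<close>, and
  \<open>D\<close> is their sum; integration by parts is applied coordinate by coordinate.\<close>

lemma lipschitz_divergence:
  fixes Y :: "real ^ 'n \<Rightarrow> real ^ 'n"
  assumes Y: "L-lipschitz_on UNIV Y" and M: "\<And>x. norm (Y x) \<le> M"
  shows "\<exists>D. D \<in> borel_measurable borel \<and> (\<forall>x. \<bar>D x\<bar> \<le> real CARD('n) * L) \<and>
    (AE x in lborel. (\<forall>i. (\<lambda>t. Y (x + t *\<^sub>R axis i 1) $ i) differentiable (at 0)) \<and> D x = divergence Y x) \<and>
    (\<forall>x h. 0 < h \<longrightarrow> (LBINT y. D y * mollifier h (x - y) - Y y \<bullet> mollifier_grad h (x - y)) = 0)"
proof -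
  have Yi: "L-lipschitz_on UNIV (\<lambda>x. Y x $ i)" for i
  proof (rule lipschitz_onI)
    fix x y
    have "dist (Y x $ i) (Y y $ i) \<le> dist (Y x) (Y y)" by (rule dist_vec_nth_le)
    also have "\<dots> \<le> L * dist x y" using lipschitz_onD[OF Y] by simp
    finally show "dist (Y x $ i) (Y y $ i) \<le> L * dist x y" .
  qed (rule lipschitz_on_nonneg[OF Y])
  have "\<exists>D. D \<in> borel_measurable borel \<and> (\<forall>x. \<bar>D x\<bar> \<le> L) \<and>
      (AE x in lborel. ((\<lambda>t. Y (x + t *\<^sub>R axis i 1) $ i) has_real_derivative D x) (at 0))" for i
  proof -
    obtain D where "D \<in> borel_measurable borel" "\<forall>x. \<bar>D x\<bar> \<le> L * norm (axis i 1 :: real ^ 'n)"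
      "AE x in lborel. ((\<lambda>t. Y (x + t *\<^sub>R axis i 1) $ i) has_real_derivative D x) (at 0)"
      by (rule lipschitz_directional_derivative[OF Yi[of i], where e="axis i 1"])
    then show ?thesis by (intro exI[of _ D]) (auto simp: norm_axis_1)
  qed
  then obtain D where D': "\<forall>i. D i \<in> borel_measurable borel \<and> (\<forall>x. \<bar>D i x\<bar> \<le> L) \<and>
      (AE x in lborel. ((\<lambda>t. Y (x + t *\<^sub>R axis i 1) $ i) has_real_derivative D i x) (at 0))"
    using choice[of "\<lambda>i D. D \<in> borel_measurable borel \<and> (\<forall>x. \<bar>D x\<bar> \<le> L) \<and>
      (AE x in lborel. ((\<lambda>t. Y (x + t *\<^sub>R axis i 1) $ i) has_real_derivative D x) (at 0))"] by blast
  have D: "D i \<in> borel_measurable borel" "\<bar>D i x\<bar> \<le> L" for i x using D' by auto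
  have deriv: "AE x in lborel. ((\<lambda>t. Y (x + t *\<^sub>R axis i 1) $ i) has_real_derivative D i x) (at 0)" for i
    using D' by auto
  note [measurable] = D(1)
  let ?D = "\<lambda>x. \<Sum>i\<in>UNIV. D i x"
  have all: "AE x in lborel. \<forall>i. ((\<lambda>t. Y (x + t *\<^sub>R axis i 1) $ i) has_real_derivative D i x) (at 0)"
    using deriv by (simp add: AE_all_countable)
  show ?thesis
  proof (intro exI[of _ ?D] conjI allI impI)
    show "?D \<in> borel_measurable borel" by measurable
    show "\<bar>?D x\<bar> \<le> real CARD('n) * L" for x
      by (rule order_trans[OF sum_abs sum_bounded_above]) (rule D(2))
    show "AE x in lborel. (\<forall>i. (\<lambda>t. Y (x + t *\<^sub>R axis i 1) $ i) differentiable (at 0)) \<and> ?D x = divergence Y x"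
      using all
    proof eventually_elim
      case (elim x)
      have "partial_deriv i (\<lambda>y. Y y $ i) x = D i x" for i using elim by (intro partial_deriv_eqI) auto
      then show ?case using elim unfolding divergence_def by (auto simp: real_differentiable_def)
    qed
    fix x :: "real ^ 'n" and h :: real assume h: "0 < h"
    have Ym: "\<bar>Y y $ i\<bar> \<le> M" for y i using component_le_norm_cart[of "Y y" i] M[of y] by linarith
    note parts = mollifier_integration_by_parts[OF h Yi Ym D(1) deriv, of _ x]
    have "(LBINT y. ?D y * mollifier h (x - y) - Y y \<bullet> mollifier_grad h (x - y)) =
        (LBINT y. (\<Sum>i\<in>UNIV. D i y * mollifier h (x - y) - Y y $ i * mollifier_grad h (x - y) $ i))"
      by (simp add: inner_vec_def sum_subtractf sum_distrib_right)
    also have "\<dots> = (\<Sum>i\<in>UNIV. (LBINT y. D i y * mollifier h (x - y) - Y y $ i * mollifier_grad h (x - y) $ i))"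
      by (rule Bochner_Integration.integral_sum) (rule parts)
    also have "\<dots> = 0" by (intro sum.neutral ballI parts)
    finally show "(LBINT y. ?D y * mollifier h (x - y) - Y y \<bullet> mollifier_grad h (x - y)) = 0" .
  qed
qed

text \<open>\<open>transport_identity\<close> treats one \<open>t\<close> at a time; measurability
  of the set of good pairs upgrades it to almost all \<open>(t, x)\<close>. Both end points of a
  confined trajectory lie in \<open>K\<close>, where \<open>F\<close> may be replaced by
  \<open>f\<close>.\<close>

lemma (in cutoff_flow) transport_AE:
  assumes f: "f locally_integrable_on \<Omega>" and Xf: "is_distributional_derivative X \<Omega> f Xf"
  shows "\<exists>G. integrable lborel G \<and> (AE x in lborel. x \<in> K \<longrightarrow> G x = Xf x) \<and>
    (AE p in lborel. 0 \<le> fst p \<and> (\<forall>s\<in>{0..fst p}. \<phi> s (snd p) \<in> K) \<longrightarrow>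
      f (\<phi> (fst p) (snd p)) - f (snd p) = path_integral G (fst p) (snd p))"
proof (cases "K = {}")
  case True
  then show ?thesis by (intro exI[of _ "\<lambda>_. 0"]) auto
next
  case False
  have gl: "Xf locally_integrable_on \<Omega>" using Xf unfolding is_distributional_derivative_def by simp
  obtain \<delta> where \<delta>: "0 < \<delta>" "{x. infdist x K \<le> \<delta>} \<subseteq> V"
    using compact_in_open_separated[OF False compact_K open_V K_V] by blast
  \<comment> \<open>The margin \<open>\<delta>\<close> keeps the supports of mollifiers centred in
    \<open>K\<close> inside \<open>K'\<close>, where \<open>Y = X\<close> and, up to null sets,
    \<open>F = f\<close> and \<open>G = Xf\<close>.\<close>
  define K' where "K' = {x. infdist x K \<le> \<delta>}"
  have K': "compact K'" "K' \<subseteq> V" "K' \<subseteq> \<Omega>" "K \<subseteq> K'"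
    unfolding K'_def using compact_infdist_le[OF False compact_K \<delta>(1)] \<delta> V_domain by auto
  obtain F where repF: "integrable lborel F" "AE x in lborel. F x = indicator K' x * f x"
    using locally_integrable_representative[OF f K'(1,3)] by blast
  obtain G where repG: "integrable lborel G" "AE x in lborel. G x = indicator K' x * Xf x"
    using locally_integrable_representative[OF gl K'(1,3)] by blast
  obtain D where D: "D \<in> borel_measurable borel" "\<And>x. \<bar>D x\<bar> \<le> real CARD('n) * L"
    "AE x in lborel. (\<forall>i. (\<lambda>t. Y (x + t *\<^sub>R axis i 1) $ i) differentiable (at 0)) \<and> D x = divergence Y x"
    "\<And>x h. 0 < h \<Longrightarrow> (LBINT y. D y * mollifier h (x - y) - Y y \<bullet> mollifier_grad h (x - y)) = 0"
    using lipschitz_divergence[OF lip bound] by blast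
  have div_eq: "divergence X y = divergence Y y" if "y \<in> V" for y
    unfolding divergence_def partial_deriv_def
  proof (intro sum.cong refl deriv_cong_ev)
    fix i :: 'n
    have "isCont (\<lambda>t. y + t *\<^sub>R axis i 1) (0::real)" by (intro continuous_intros)
    then have "\<forall>\<^sub>F t in nhds (0::real). y + t *\<^sub>R axis i 1 \<in> V"
      using open_V that by (simp add: continuous_within tendsto_def eventually_nhds_conv_at)
    then show "\<forall>\<^sub>F t in nhds 0. X (y + t *\<^sub>R axis i 1) $ i = Y (y + t *\<^sub>R axis i 1) $ i"
      by eventually_elim (simp add: field_eq)
  qed
  note [measurable] = D(1) borel_measurable_integrable[OF repF(1), simplified] borel_measurable_integrable[OF repG(1), simplified]
    borel_measurable_continuous_onI[OF lipschitz_on_continuous_on[OF lip]]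
  interpret transport Y \<phi> L M F G D "real CARD('n) * L" K \<delta>
  proof
    fix x h assume x: "x \<in> K" and h: "0 < h" "h \<le> \<delta>"
    have ball: "cball x h \<subseteq> K'"
    proof
      fix y assume "y \<in> cball x h"
      then show "y \<in> K'" using infdist_le[OF x, of y] h(2) by (simp add: K'_def dist_commute)
    qed
    have out: "mollifier h (x - y) = 0" "mollifier_grad h (x - y) = 0" if "y \<notin> K'" for y
    proof -
      have "h \<le> norm (x - y)" using that ball by (force simp: dist_norm)
      then show "mollifier h (x - y) = 0" "mollifier_grad h (x - y) = 0" using mollifier_outside[OF h(1)] by auto
    qed
    let ?u = "\<lambda>y. mollifier h (x - y)"
    have tf: "test_function \<Omega> ?u" by (rule test_function_mollifier[OF h(1)]) (use ball K' in blast)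
    have ap: "apply_field X ?u y = - (X y \<bullet> mollifier_grad h (x - y))" for y
      unfolding apply_field_def by (simp add: partial_deriv_mollifier inner_vec_def sum_negf)
    have "(LINT y:\<Omega>|lebesgue. Xf y * ?u y) = (LBINT y. G y * ?u y)"
      unfolding set_lebesgue_integral_def
    proof (rule integral_lebesgue_eq_lborel)
      show "AE y in lborel. indicator \<Omega> y *\<^sub>R (Xf y * ?u y) = G y * ?u y"
        using repG(2)
      proof eventually_elim
        case (elim y)
        then show ?case using out[of y] subsetD[OF K'(3), of y] by (cases "y \<in> K'") auto
      qed
    qed measurable
    moreover have "(LINT y:\<Omega>|lebesgue. f y * apply_field X ?u y) = (LBINT y. - (F y * (Y y \<bullet> mollifier_grad h (x - y))))"
      unfolding set_lebesgue_integral_def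
    proof (rule integral_lebesgue_eq_lborel)
      show "AE y in lborel. indicator \<Omega> y *\<^sub>R (f y * apply_field X ?u y) = - (F y * (Y y \<bullet> mollifier_grad h (x - y)))"
        using repF(2)
      proof eventually_elim
        case (elim y)
        then show ?case using out[of y] subsetD[OF K'(2), of y] subsetD[OF K'(3), of y] field_eq[of y] by (cases "y \<in> K'") (auto simp: ap)
      qed
    qed measurable
    moreover have "(LINT y:\<Omega>|lebesgue. f y * ?u y * divergence X y) = (LBINT y. F y * (?u y * D y))"
      unfolding set_lebesgue_integral_def
    proof (rule integral_lebesgue_eq_lborel)
      show "AE y in lborel. indicator \<Omega> y *\<^sub>R (f y * ?u y * divergence X y) = F y * (?u y * D y)"
        using repF(2) D(3)
      proof eventually_elim
        case (elim y)
        then show ?case using out[of y] subsetD[OF K'(2), of y] subsetD[OF K'(3), of y] div_eq[of y] by (cases "y \<in> K'") auto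
      qed
    qed measurable
    ultimately show "(LBINT y. G y * ?u y) =
        (LBINT y. F y * (Y y \<bullet> mollifier_grad h (x - y))) - (LBINT y. F y * (?u y * D y))"
      using Xf tf unfolding is_distributional_derivative_def by simp
  qed (use repF(1) repG(1) D compact_K \<delta>(1) in auto)
  \<comment> \<open>Rescaling time to \<open>r\<close> in \<open>{0..1}\<close> writes confinement
    as an intersection of closed sets of pairs over an index set independent of the time.\<close>
  let ?Q = "\<lambda>p. 0 \<le> fst p \<and> (\<forall>r\<in>{0..1}. \<phi> (r * fst p) (snd p) \<in> K) \<longrightarrow>
      F (\<phi> (fst p) (snd p)) - F (snd p) = path_integral G (fst p) (snd p)"
  have conf: "(\<forall>r\<in>{0..1}. \<phi> (r * t) x \<in> K) \<longleftrightarrow> (\<forall>s\<in>{0..t}. \<phi> s x \<in> K)" if "0 \<le> t" for t x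
  proof -
    have "s \<in> (\<lambda>r. r * t) ` {0..1}" if "s \<in> {0..t}" for s
      using that \<open>0 \<le> t\<close> by (cases "t = 0") (auto intro!: image_eqI[of _ _ "s / t"])
    moreover have "r * t \<in> {0..t}" if "r \<in> {0..1}" for r
      using that \<open>0 \<le> t\<close> by (auto intro: mult_left_le_one_le)
    ultimately show ?thesis by blast
  qed
  have "closed {p. \<forall>r\<in>{0..1}. \<phi> (r * fst p) (snd p) \<in> K}"
  proof -
    have "continuous_on UNIV (\<lambda>p. \<phi> (r * fst p) (snd p))" for r
    proof -
      have "continuous_on UNIV (\<lambda>p. (\<lambda>(t, x). \<phi> t x) (r * fst p, snd p))"
        by (rule continuous_on_compose2[OF flow_continuous]) (auto intro!: continuous_intros)
      then show ?thesis by simp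
    qed
    then have "closed ((\<lambda>p. \<phi> (r * fst p) (snd p)) -` K)" for r
      by (intro closed_vimage compact_imp_closed compact_K)
    moreover have "{p. \<forall>r\<in>{0..1}. \<phi> (r * fst p) (snd p) \<in> K} = (\<Inter>r\<in>{0..1}. (\<lambda>p. \<phi> (r * fst p) (snd p)) -` K)" by auto
    ultimately show ?thesis by (simp only:) (intro closed_INT ballI)
  qed
  moreover define Z where "Z = {p. \<forall>r\<in>{0..1}. \<phi> (r * fst p) (snd p) \<in> K}"
  ultimately have [measurable]: "Z \<in> sets (borel \<Otimes>\<^sub>M borel)"
    unfolding borel_prod by (intro borel_closed) simp
  \<comment> \<open>The interval depends on \<open>p\<close>; as a product of indicators of fixed
    half-lines, its indicator is jointly measurable.\<close>
  have "indicator {0..fst p} s = indicator {0..} s * (indicator {0..} (fst p - s) :: real)" for p :: "real \<times> (real ^ 'n)" and s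
    by (auto simp: indicator_def)
  then have "(\<lambda>p. path_integral G (fst p) (snd p)) =
      (\<lambda>p. (LBINT s. indicator {0..} s * indicator {0..} (fst p - s) * G (\<phi> s (snd p))))" by simp
  also have "\<dots> \<in> borel_measurable (borel \<Otimes>\<^sub>M borel)" by measurable
  finally have [measurable]: "(\<lambda>p. path_integral G (fst p) (snd p)) \<in> borel_measurable (borel \<Otimes>\<^sub>M borel)" .
  have "{p \<in> space (lborel \<Otimes>\<^sub>M lborel). 0 \<le> fst p \<and> p \<in> Z \<longrightarrow>
      F (\<phi> (fst p) (snd p)) - F (snd p) = path_integral G (fst p) (snd p)} \<in> sets (lborel \<Otimes>\<^sub>M lborel)"
    by measurable
  then have "{p \<in> space (lborel \<Otimes>\<^sub>M lborel). ?Q p} \<in> sets (lborel \<Otimes>\<^sub>M lborel)"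
    unfolding Z_def mem_Collect_eq .
  moreover have "AE t in lborel. AE x in lborel. ?Q (t, x)"
  proof (rule AE_I2)
    fix t :: real
    show "AE x in lborel. ?Q (t, x)"
    proof (cases "0 \<le> t")
      case True
      then show ?thesis using transport_identity[OF True] conf[OF True] by simp
    qed simp
  qed
  ultimately have "AE p in (lborel \<Otimes>\<^sub>M lborel). ?Q p" by (rule lborel_pair.AE_pair_measure)
  then have Q: "AE p in lborel. ?Q p" unfolding lborel_prod .
  have FK: "AE x in lborel. x \<in> K \<longrightarrow> F x = f x" using repF(2) by eventually_elim (use K'(4) in auto)
  have GK: "AE x in lborel. x \<in> K \<longrightarrow> G x = Xf x" using repG(2) by eventually_elim (use K'(4) in auto)
  have "AE p in lborel. 0 \<le> fst p \<and> (\<forall>s\<in>{0..fst p}. \<phi> s (snd p) \<in> K) \<longrightarrow>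
      f (\<phi> (fst p) (snd p)) - f (snd p) = path_integral G (fst p) (snd p)"
    using Q AE_flow_pair(1)[OF FK] AE_snd[OF FK]
  proof eventually_elim
    case (elim p)
    show ?case
    proof
      assume a: "0 \<le> fst p \<and> (\<forall>s\<in>{0..fst p}. \<phi> s (snd p) \<in> K)"
      then have "\<phi> (fst p) (snd p) \<in> K" "\<phi> 0 (snd p) \<in> K" by auto
      then show "f (\<phi> (fst p) (snd p)) - f (snd p) = path_integral G (fst p) (snd p)"
        using elim a conf[of "fst p" "snd p"] by (simp add: flow_0)
    qed
  qed
  then show ?thesis using repG(1) GK by blast
qed

section \<open>The maximal flow\<close>

context lipschitz_field
begin

abbreviation gradient_bound ::
  "(real ^ 'n \<Rightarrow> real) \<Rightarrow> (real ^ 'n \<Rightarrow> real) \<Rightarrow> real \<times> (real ^ 'n) \<Rightarrow> bool" where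
  "gradient_bound f h p \<equiv> ennreal \<bar>f (flow X \<Omega> (fst p) (snd p)) - f (snd p)\<bar>
     \<le> (\<integral>\<^sup>+s\<in>{0..fst p}. ennreal (h (flow X \<Omega> s (snd p))) \<partial>lebesgue)"

lemma solution_segment:
  assumes "is_solution X \<Omega> x I \<gamma>" "t \<in> I"
  shows "closed_segment 0 t \<subseteq> I" "compact (\<gamma> ` closed_segment 0 t)" "\<gamma> ` closed_segment 0 t \<subseteq> \<Omega>"
proof -
  show sub: "closed_segment 0 t \<subseteq> I"
    using assms unfolding is_solution_def is_interval_convex_1 by (intro closed_segment_subset) auto
  have "continuous_on (closed_segment 0 t) \<gamma>"
  proof (intro continuous_at_imp_continuous_on ballI)
    fix s assume "s \<in> closed_segment 0 t"
    then have "(\<gamma> has_vector_derivative X (\<gamma> s)) (at s)" using assms(1) sub unfolding is_solution_def by blast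
    then show "isCont \<gamma> s" by (rule has_vector_derivative_continuous)
  qed
  then show "compact (\<gamma> ` closed_segment 0 t)" by (intro compact_continuous_image compact_segment)
  show "\<gamma> ` closed_segment 0 t \<subseteq> \<Omega>" using assms(1) sub unfolding is_solution_def by blast
qed

text \<open>Up to time \<open>t\<close> both curves run in a compact subset of
  \<open>\<Omega>\<close>, near which \<open>X\<close> agrees with a globally Lipschitz field; both
  then follow the flow of that field.\<close>

lemma solution_unique:
  assumes \<gamma>: "is_solution X \<Omega> x I \<gamma>" "t \<in> I" and \<delta>: "is_solution X \<Omega> x J \<delta>" "t \<in> J"
  shows "\<gamma> t = \<delta> t"
proof -
  let ?K = "\<gamma> ` closed_segment 0 t \<union> \<delta> ` closed_segment 0 t"
  have "compact ?K" "?K \<subseteq> \<Omega>" using solution_segment[OF \<gamma>] solution_segment[OF \<delta>] by auto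
  then obtain Y \<phi> L M V where "cutoff_flow X Y \<Omega> \<phi> L M ?K V" using cutoff_flow_exists by blast
  then interpret cutoff_flow X Y \<Omega> \<phi> L M ?K V .
  have "\<gamma> t = \<phi> t x" by (rule solution_eq_flow[OF \<gamma>]) (use K_V in blast)
  moreover have "\<delta> t = \<phi> t x" by (rule solution_eq_flow[OF \<delta>]) (use K_V in blast)
  ultimately show ?thesis by simp
qed

lemma solution_cong:
  assumes sol: "is_solution X \<Omega> x I \<gamma>" and eq: "\<And>t. t \<in> I \<Longrightarrow> \<delta> t = \<gamma> t"
  shows "is_solution X \<Omega> x I \<delta>"
proof -
  have "(\<delta> has_vector_derivative X (\<delta> t)) (at t)" if t: "t \<in> I" for t
  proof -
    have "(\<gamma> has_vector_derivative X (\<delta> t)) (at t)" "open I"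
      using sol t eq[OF t] unfolding is_solution_def by auto
    then show ?thesis
      by (rule has_vector_derivative_transform_within_open[OF _ _ t]) (simp add: eq)
  qed
  then show ?thesis using sol eq unfolding is_solution_def by auto
qed

lemma local_solution_exists:
  assumes "x \<in> \<Omega>"
  shows "\<exists>I \<gamma>. is_solution X \<Omega> x I \<gamma>"
proof -
  obtain Y \<phi> L M V where "cutoff_flow X Y \<Omega> \<phi> L M {x} V"
    using cutoff_flow_exists[of "{x}"] assms by auto
  then interpret cutoff_flow X Y \<Omega> \<phi> L M "{x}" V .
  have "continuous_on UNIV (\<lambda>s. \<phi> s x)"
    by (intro continuous_at_imp_continuous_on ballI has_vector_derivative_continuous[OF flow_deriv])
  then have "open ((\<lambda>s. \<phi> s x) -` V)" using open_V by (rule open_vimage[rotated])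
  moreover have "0 \<in> (\<lambda>s. \<phi> s x) -` V" using K_V by (simp add: flow_0)
  ultimately obtain e where e: "e > 0" "ball 0 e \<subseteq> (\<lambda>s. \<phi> s x) -` V"
    using open_contains_ball by blast
  have "is_solution X \<Omega> x (ball 0 e) (\<lambda>s. \<phi> s x)"
    by (rule flow_is_solution) (use e in \<open>auto simp: is_interval_convex_1\<close>)
  then show ?thesis by blast
qed

text \<open>Uniqueness makes all solutions compatible, so they glue on the union of their intervals,
  which is connected because every interval contains 0.\<close>

lemma largest_solution_exists:
  assumes x: "x \<in> \<Omega>"
  shows "\<exists>I \<gamma>. is_solution X \<Omega> x I \<gamma> \<and> (\<forall>J \<delta>. is_solution X \<Omega> x J \<delta> \<longrightarrow> J \<subseteq> I \<and> (\<forall>t\<in>J. \<delta> t = \<gamma> t))"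
proof -
  define I where "I = \<Union>{J. \<exists>\<delta>. is_solution X \<Omega> x J \<delta>}"
  define \<gamma> where "\<gamma> t = (SOME y. \<exists>J \<delta>. is_solution X \<Omega> x J \<delta> \<and> t \<in> J \<and> y = \<delta> t)" for t
  have eq: "\<delta> t = \<gamma> t" if "is_solution X \<Omega> x J \<delta>" "t \<in> J" for J \<delta> t
  proof -
    have "\<exists>J \<delta>. is_solution X \<Omega> x J \<delta> \<and> t \<in> J \<and> \<gamma> t = \<delta> t"
      unfolding \<gamma>_def by (rule someI_ex) (use that in blast)
    then show ?thesis using solution_unique[OF that] by metis
  qed
  have sub: "J \<subseteq> I" if "is_solution X \<Omega> x J \<delta>" for J \<delta> unfolding I_def using that by blast
  obtain J0 \<delta>0 where J0: "is_solution X \<Omega> x J0 \<delta>0" using local_solution_exists[OF x] by blast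
  have "is_solution X \<Omega> x I \<gamma>"
    unfolding is_solution_def
  proof (intro conjI ballI)
    show "open I" unfolding I_def by (intro open_Union) (auto simp: is_solution_def)
    have "connected I" unfolding I_def
      by (rule connected_Union) (auto simp: is_solution_def is_interval_connected_1)
    then show "is_interval I" by (simp add: is_interval_connected_1)
    have 0: "0 \<in> J0" using J0 by (simp add: is_solution_def)
    then show "0 \<in> I" using sub[OF J0] by blast
    show "\<gamma> 0 = x" using eq[OF J0 0] J0 by (simp add: is_solution_def)
    fix t assume "t \<in> I"
    then obtain J \<delta> where J: "is_solution X \<Omega> x J \<delta>" "t \<in> J" unfolding I_def by blast
    have "is_solution X \<Omega> x J \<gamma>" by (rule solution_cong[OF J(1)]) (use eq[OF J(1)] in simp)
    then show "\<gamma> t \<in> \<Omega>" "(\<gamma> has_vector_derivative X (\<gamma> t)) (at t)"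
      using J(2) by (auto simp: is_solution_def)
  qed
  then show ?thesis using eq sub by blast
qed

text \<open>The largest solution is maximal, and any maximal solution extends to it and so has the
  same interval. This gives the definite descriptions \<open>flow_interval\<close> and
  \<open>flow\<close> their intended values.\<close>

lemma flow_is_largest_solution:
  assumes x: "x \<in> \<Omega>"
  shows "is_solution X \<Omega> x (flow_interval X \<Omega> x) (\<lambda>t. flow X \<Omega> t x)"
    and "is_solution X \<Omega> x J \<delta> \<Longrightarrow> J \<subseteq> flow_interval X \<Omega> x"
    and "is_solution X \<Omega> x J \<delta> \<Longrightarrow> t \<in> J \<Longrightarrow> flow X \<Omega> t x = \<delta> t"
proof -
  obtain I \<gamma> where I: "is_solution X \<Omega> x I \<gamma>"
    and largest: "\<And>J \<delta>. is_solution X \<Omega> x J \<delta> \<Longrightarrow> J \<subseteq> I" "\<And>J \<delta> t. is_solution X \<Omega> x J \<delta> \<Longrightarrow> t \<in> J \<Longrightarrow> \<delta> t = \<gamma> t"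
    using largest_solution_exists[OF x] by blast
  have max: "is_maximal_solution X \<Omega> x I \<gamma>"
    unfolding is_maximal_solution_def using I largest(1) by blast
  have uniq: "J = I" if "is_maximal_solution X \<Omega> x J \<delta>" for J \<delta>
  proof -
    have sol: "is_solution X \<Omega> x J \<delta>" using that unfolding is_maximal_solution_def by blast
    have "\<forall>t\<in>J. \<gamma> t = \<delta> t" using largest(2)[OF sol] by auto
    then show ?thesis using that I largest(1)[OF sol] unfolding is_maximal_solution_def by blast
  qed
  have int: "flow_interval X \<Omega> x = I"
    unfolding flow_interval_def using max uniq by (intro the_equality) blast+
  have flow: "flow X \<Omega> t x = \<gamma> t" if "t \<in> I" for t
    unfolding flow_def
  proof (rule the_equality)
    show "\<exists>I' \<gamma>'. is_maximal_solution X \<Omega> x I' \<gamma>' \<and> t \<in> I' \<and> \<gamma> t = \<gamma>' t" using max that by blast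
    fix y assume "\<exists>I' \<gamma>'. is_maximal_solution X \<Omega> x I' \<gamma>' \<and> t \<in> I' \<and> y = \<gamma>' t"
    then obtain I' \<gamma>' where "is_solution X \<Omega> x I' \<gamma>'" "t \<in> I'" "y = \<gamma>' t"
      unfolding is_maximal_solution_def by blast
    then show "y = \<gamma> t" using largest(2) by simp
  qed
  show "is_solution X \<Omega> x (flow_interval X \<Omega> x) (\<lambda>t. flow X \<Omega> t x)"
    unfolding int by (rule solution_cong[OF I flow])
  show "J \<subseteq> flow_interval X \<Omega> x" if "is_solution X \<Omega> x J \<delta>" using largest(1)[OF that] int by simp
  show "flow X \<Omega> t x = \<delta> t" if "is_solution X \<Omega> x J \<delta>" "t \<in> J"
    using largest[OF that(1)] flow[of t] that(2) by (auto dest: subsetD)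
qed

lemma flow_domain_posD:
  assumes "(t, x) \<in> flow_domain_pos X \<Omega>"
  shows "x \<in> \<Omega>" "t \<in> flow_interval X \<Omega> x" "0 < t"
  using assms unfolding flow_domain_pos_def flow_domain_def by auto

lemma flow_domain_posI:
  "x \<in> \<Omega> \<Longrightarrow> t \<in> flow_interval X \<Omega> x \<Longrightarrow> 0 < t \<Longrightarrow> (t, x) \<in> flow_domain_pos X \<Omega>"
  unfolding flow_domain_pos_def flow_domain_def by auto

end

lemma (in cutoff_flow) flow_eq_cutoff:
  assumes tx: "(t, x) \<in> flow_domain_pos X \<Omega>" and K: "\<And>s. s \<in> {0..t} \<Longrightarrow> flow X \<Omega> s x \<in> K" and s: "s \<in> {0..t}"
  shows "flow X \<Omega> s x = \<phi> s x"
proof -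
  note d = flow_domain_posD[OF tx]
  note sol = flow_is_largest_solution(1)[OF d(1)]
  have "closed_segment 0 t = {0..t}" using d(3) by (simp add: closed_segment_eq_real_ivl)
  then have "s \<in> flow_interval X \<Omega> x" using solution_segment(1)[OF sol d(2)] s by blast
  then show ?thesis
  proof (rule solution_eq_flow[OF sol])
    fix r assume "r \<in> closed_segment 0 s"
    then have "r \<in> {0..t}" using s by (simp add: closed_segment_eq_real_ivl)
    then show "flow X \<Omega> r x \<in> V" using K K_V by blast
  qed
qed

text \<open>For almost every starting point, \<open>G\<close> and \<open>Xf\<close> agree at almost
  all times spent in \<open>K\<close>; the bound is then the transport identity with the absolute
  value moved inside the integral.\<close>

lemma (in cutoff_flow) upper_gradient_confined:
  assumes f: "f locally_integrable_on \<Omega>" and Xf: "is_distributional_derivative X \<Omega> f Xf"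
  shows "AE p in lborel. p \<in> flow_domain_pos X \<Omega> \<and> (\<forall>s\<in>{0..fst p}. flow X \<Omega> s (snd p) \<in> K) \<longrightarrow>
    gradient_bound f (\<lambda>x. \<bar>Xf x\<bar>) p"
proof -
  obtain G where G: "integrable lborel G" "AE x in lborel. x \<in> K \<longrightarrow> G x = Xf x"
    and tr: "AE p in lborel. 0 \<le> fst p \<and> (\<forall>s\<in>{0..fst p}. \<phi> s (snd p) \<in> K) \<longrightarrow>
      f (\<phi> (fst p) (snd p)) - f (snd p) = path_integral G (fst p) (snd p)"
    using transport_AE[OF f Xf] by blast
  show ?thesis
    using tr AE_snd[OF AE_flow_pair(2)[OF G(2)]]
  proof eventually_elim
    case (elim p)
    show ?case
    proof
      assume a: "p \<in> flow_domain_pos X \<Omega> \<and> (\<forall>s\<in>{0..fst p}. flow X \<Omega> s (snd p) \<in> K)"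
      let ?t = "fst p" and ?x = "snd p"
      have t: "0 < ?t" using a flow_domain_posD(3)[of ?t ?x] by simp
      have eq: "flow X \<Omega> s ?x = \<phi> s ?x" if "s \<in> {0..?t}" for s
        using flow_eq_cutoff[of ?t ?x s] a that by simp
      then have conf: "\<forall>s\<in>{0..?t}. \<phi> s ?x \<in> K" using a by auto
      have "ennreal \<bar>f (flow X \<Omega> ?t ?x) - f ?x\<bar> = ennreal \<bar>path_integral G ?t ?x\<bar>"
        using elim(1) conf t eq[of ?t] by simp
      also have "\<dots> \<le> (\<integral>\<^sup>+s. ennreal (norm (indicator {0..?t} s * G (\<phi> s ?x))) \<partial>lborel)"
      \<comment> \<open>Without integrability the Bochner integral is 0 by convention, and the
        inequality is trivial.\<close>
      proof (cases "integrable lborel (\<lambda>s. indicator {0..?t} s * G (\<phi> s ?x))")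
        case True
        from integral_norm_bound_ennreal[OF True] show ?thesis by simp
      qed (simp add: not_integrable_integral_eq)
      also have "\<dots> = (\<integral>\<^sup>+s. ennreal \<bar>Xf (flow X \<Omega> s ?x)\<bar> * indicator {0..?t} s \<partial>lborel)"
      proof (rule nn_integral_cong_AE)
        show "AE s in lborel. ennreal (norm (indicator {0..?t} s * G (\<phi> s ?x))) =
            ennreal \<bar>Xf (flow X \<Omega> s ?x)\<bar> * indicator {0..?t} s"
          using elim(2)
        proof eventually_elim
          case (elim s)
          then show ?case using conf eq[of s] by (cases "s \<in> {0..?t}") auto
        qed
      qed
      finally show "ennreal \<bar>f (flow X \<Omega> ?t ?x) - f ?x\<bar>
          \<le> (\<integral>\<^sup>+s\<in>{0..?t}. ennreal \<bar>Xf (flow X \<Omega> s ?x)\<bar> \<partial>lebesgue)"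
        by (simp add: nn_integral_completion)
    qed
  qed
qed

section \<open>Minimality\<close>

text \<open>The averages \<open>1/t \<integral>\<^sub>0\<^sup>t D (\<phi> s x) ds\<close> tend to \<open>D\<close> in \<open>L\<^sup>1\<close> as \<open>t \<rightarrow> 0\<close>.\<close>

lemma (in bounded_lipschitz_flow) nonpos_of_flow_integrals:
  fixes D :: "'a \<Rightarrow> real"
  assumes D: "integrable lborel D" and [measurable]: "A \<in> sets borel" and T: "0 < T"
    and ae: "AE p in lborel. 0 < fst p \<and> fst p < T \<and> snd p \<in> A \<longrightarrow>
      path_integral D (fst p) (snd p) \<le> 0"
  shows "AE x in lborel. x \<in> A \<longrightarrow> D x \<le> 0"
proof -
  have [measurable]: "D \<in> borel_measurable borel" using borel_measurable_integrable[OF D] by simp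
  let ?P = "\<lambda>t x. 0 < t \<and> t < T \<and> x \<in> A \<longrightarrow> path_integral D t x \<le> 0"
  have "AE p in lborel \<Otimes>\<^sub>M lborel. ?P (fst p) (snd p)" unfolding lborel_prod using ae .
  then have ae_t: "AE t in lborel. AE x in lborel. ?P t x"
    using lborel_pair.AE_pair[of "\<lambda>p. ?P (fst p) (snd p)"] by simp
  define C where "C = exp (L * T) ^ DIM('a)"
  have C: "0 \<le> C" unfolding C_def by simp
  have main: "(\<integral>\<^sup>+x. indicator A x * ennreal (D x) \<partial>lborel) \<le> ennreal e" if e: "0 < e" for e
  proof -
    obtain d where d: "d > 0" "\<And>\<psi>. compresses C \<psi> \<Longrightarrow> (\<forall>x. dist (\<psi> x) x \<le> d) \<Longrightarrow>
        (\<integral>\<^sup>+x. ennreal \<bar>D (\<psi> x) - D x\<bar> \<partial>lborel) \<le> ennreal e"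
      using compresses_near_identity[OF D e C] by auto
    \<comment> \<open>Up to time \<open>T'\<close> the flow moves points by at most
      \<open>M * T' \<le> d\<close>; the added 1 avoids division by zero.\<close>
    define T' where "T' = min T (d / (M + 1))"
    have M1: "0 < M + 1" using M_nonneg by simp
    have T': "0 < T'" "T' \<le> T" using T d(1) M1 unfolding T'_def by auto
    have MT': "M * T' \<le> d"
    proof -
      have "M * T' \<le> (M + 1) * (d / (M + 1))"
        using M_nonneg T' unfolding T'_def by (intro mult_mono) auto
      then show ?thesis using M1 by simp
    qed
    \<comment> \<open>The hypothesis holds for almost all \<open>t\<close>, and an interval of
      positive length is not null, so a usable \<open>t\<close> exists.\<close>
    have "\<exists>t. 0 < t \<and> t < T' \<and> (AE x in lborel. ?P t x)"
    proof (rule ccontr)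
      assume "\<nexists>t. 0 < t \<and> t < T' \<and> (AE x in lborel. ?P t x)"
      then have "AE t in lborel. t \<notin> {0<..<T'}" using ae_t by (auto elim: eventually_mono)
      then have "{0<..<T'} \<in> null_sets lborel" by (subst AE_iff_null_sets) simp_all
      then show False using T'(1) by (simp add: null_sets_def)
    qed
    then obtain t where t: "0 < t" "t < T'" and Pt: "AE x in lborel. ?P t x" by blast
    have near: "(\<integral>\<^sup>+x. ennreal \<bar>D (\<phi> s x) - D x\<bar> \<partial>lborel) \<le> ennreal e" if s: "s \<in> {0..t}" for s
    proof (rule d(2))
      show "compresses C (\<phi> s)" unfolding C_def using s t T' by (intro flow_compresses_le) auto
      show "\<forall>x. dist (\<phi> s x) x \<le> d"
      proof
        fix x
        have "dist (\<phi> s x) x \<le> M * \<bar>s\<bar>" by (rule flow_near)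
        also have "\<dots> \<le> M * T'" using s t M_nonneg by (intro mult_left_mono) auto
        finally show "dist (\<phi> s x) x \<le> d" using MT' by simp
      qed
    qed
    let ?w = "\<lambda>x s. indicator {0..t} s * ennreal \<bar>D (\<phi> s x) - D x\<bar>"
    \<comment> \<open>Subtracting the nonpositive path integral from \<open>t * D x\<close> leaves
      the deviation of \<open>D\<close> from \<open>D x\<close> along the trajectory.
      \<open>ennreal (D x)\<close> is the positive part of \<open>D\<close>, whose integral over
      \<open>A\<close> is to vanish.\<close>
    have point: "AE x in lborel. indicator A x * (ennreal t * ennreal (D x)) \<le> (\<integral>\<^sup>+s. ?w x s \<partial>lborel)"
      using Pt flow_integrable_AE[OF less_imp_le[OF t(1)] D]
    proof eventually_elim
      case (elim x)
      show ?case
      proof (cases "x \<in> A")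
        case True
        have i: "integrable lborel (\<lambda>s. indicator {0..t} s * D x)"
          using t by (intro integrable_mult_left integrable_real_indicator) auto
        have "t * D x = (LBINT s. indicator {0..t} s * D x)" using t by simp
        also have "\<dots> \<le> (LBINT s. indicator {0..t} s * D x) - path_integral D t x"
          using elim(1) True t T' by simp
        also have "\<dots> = (LBINT s. indicator {0..t} s * D x - indicator {0..t} s * D (\<phi> s x))"
          by (rule Bochner_Integration.integral_diff[OF i elim(2), symmetric])
        finally have "ennreal (t * D x) \<le> ennreal (norm (LBINT s. indicator {0..t} s * D x - indicator {0..t} s * D (\<phi> s x)))"
          by (intro ennreal_leI) simp
        also have "\<dots> \<le> (\<integral>\<^sup>+s. ennreal (norm (indicator {0..t} s * D x - indicator {0..t} s * D (\<phi> s x))) \<partial>lborel)"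
          by (rule integral_norm_bound_ennreal[OF Bochner_Integration.integrable_diff[OF i elim(2)]])
        also have "\<dots> = (\<integral>\<^sup>+s. ?w x s \<partial>lborel)"
          by (intro nn_integral_cong) (auto simp: indicator_def abs_minus_commute)
        finally show ?thesis using True t by (simp add: ennreal_mult')
      qed simp
    qed
    have "ennreal t * (\<integral>\<^sup>+x. indicator A x * ennreal (D x) \<partial>lborel) =
        (\<integral>\<^sup>+x. indicator A x * (ennreal t * ennreal (D x)) \<partial>lborel)"
      by (subst nn_integral_cmult[symmetric]) (auto simp: mult_ac)
    also have "\<dots> \<le> (\<integral>\<^sup>+x. \<integral>\<^sup>+s. ?w x s \<partial>lborel \<partial>lborel)"
      by (rule nn_integral_mono_AE[OF point])
    also have "\<dots> = (\<integral>\<^sup>+s. \<integral>\<^sup>+x. ?w x s \<partial>lborel \<partial>lborel)"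
      by (rule lborel_pair.Fubini') measurable
    also have "\<dots> = (\<integral>\<^sup>+s. indicator {0..t} s * (\<integral>\<^sup>+x. ennreal \<bar>D (\<phi> s x) - D x\<bar> \<partial>lborel) \<partial>lborel)"
      by (intro nn_integral_cong nn_integral_cmult) measurable
    also have "\<dots> \<le> (\<integral>\<^sup>+s. indicator {0..t} s * ennreal e \<partial>lborel)"
      by (intro nn_integral_mono) (use near in \<open>auto simp: indicator_def\<close>)
    also have "\<dots> = ennreal t * ennreal e" using t by (simp add: nn_integral_multc)
    finally have "inverse (ennreal t) * (ennreal t * (\<integral>\<^sup>+x. indicator A x * ennreal (D x) \<partial>lborel)) \<le>
        inverse (ennreal t) * (ennreal t * ennreal e)" by (rule mult_left_mono) simp
    moreover have "inverse (ennreal t) * (ennreal t * z) = z" for z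
    proof -
      have "inverse (ennreal t) * ennreal t = 1"
        using t by (simp add: inverse_ennreal ennreal_mult'[symmetric])
      then show ?thesis by (simp add: mult.assoc[symmetric])
    qed
    ultimately show ?thesis by simp
  qed
  have "(\<integral>\<^sup>+x. indicator A x * ennreal (D x) \<partial>lborel) \<le> 0"
    by (rule ennreal_le_epsilon) (use main in simp)
  then have "AE x in lborel. indicator A x * ennreal (D x) = 0"
    by (subst (asm) le_zero_eq, subst (asm) nn_integral_0_iff_AE) auto
  then show ?thesis
    by eventually_elim (auto simp: indicator_def ennreal_eq_0_iff split: if_splits)
qed

lemma (in cutoff_flow) upper_gradient_minimal_confined:
  assumes f: "f locally_integrable_on \<Omega>" and Xf: "is_distributional_derivative X \<Omega> f Xf"
    and h: "is_upper_gradient X \<Omega> f h" and A: "compact A" "A \<subseteq> interior K"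
  shows "AE x in lborel. x \<in> A \<longrightarrow> \<bar>Xf x\<bar> \<le> h x"
proof (cases "A = {}")
  case False
  obtain \<delta> where \<delta>: "0 < \<delta>" "{x. infdist x A \<le> \<delta>} \<subseteq> interior K"
    using compact_in_open_separated[OF False A(1) open_interior A(2)] by blast
  \<comment> \<open>Within this time a trajectory starting in \<open>A\<close> moves by at most
    \<open>\<delta>\<close> and so stays in \<open>K\<close>.\<close>
  define T where "T = \<delta> / (M + 1)"
  have M1: "0 < M + 1" using M_nonneg by simp
  have T: "0 < T" unfolding T_def using \<delta>(1) M1 by simp
  have inK: "\<phi> s x \<in> K" if "x \<in> A" "\<bar>s\<bar> < T" for s x
  proof -
    have "infdist (\<phi> s x) A \<le> dist (\<phi> s x) x" by (rule infdist_le[OF that(1)])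
    also have "\<dots> \<le> M * \<bar>s\<bar>" by (rule flow_near)
    also have "\<dots> \<le> (M + 1) * T" using that(2) M_nonneg by (intro mult_mono) auto
    also have "\<dots> = \<delta>" unfolding T_def using M1 by simp
    finally show ?thesis using \<delta>(2) interior_subset by blast
  qed
  have K\<Omega>: "K \<subseteq> \<Omega>" using K_V V_domain by blast
  have AK: "A \<subseteq> K" using A(2) interior_subset by blast
  have sol: "is_solution X \<Omega> x {-T<..<T} (\<lambda>s. \<phi> s x)" if "x \<in> A" for x
    by (rule flow_is_solution) (use T inK[OF that] K_V in \<open>auto simp: abs_less_iff is_interval_oo\<close>)
  obtain G where G: "integrable lborel G" "AE x in lborel. x \<in> K \<longrightarrow> G x = Xf x"
    and tr: "AE p in lborel. 0 \<le> fst p \<and> (\<forall>s\<in>{0..fst p}. \<phi> s (snd p) \<in> K) \<longrightarrow>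
      f (\<phi> (fst p) (snd p)) - f (snd p) = path_integral G (fst p) (snd p)"
    using transport_AE[OF f Xf] by blast
  have hl: "h locally_integrable_on \<Omega>" and h0: "AE x in lborel. x \<in> \<Omega> \<longrightarrow> 0 \<le> h x"
    and hu: "AE p in lborel. p \<in> flow_domain_pos X \<Omega> \<longrightarrow>
      ennreal \<bar>f (flow X \<Omega> (fst p) (snd p)) - f (snd p)\<bar>
         \<le> (\<integral>\<^sup>+s\<in>{0..fst p}. ennreal (h (flow X \<Omega> s (snd p))) \<partial>lborel)"
    using h unfolding is_upper_gradient_def AE_completion_iff
    by (auto simp: case_prod_beta nn_integral_completion)
  obtain H0 where H0: "integrable lborel H0" "AE x in lborel. H0 x = indicator K x * h x"
    using locally_integrable_representative[OF hl compact_K K\<Omega>] by blast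
  \<comment> \<open>\<open>h\<close> is nonnegative only almost everywhere. Truncation does not
    change \<open>ennreal (h x)\<close>, and it makes the nonnegative integral of \<open>H\<close>
    along a trajectory equal to the Bochner integral.\<close>
  define H where "H x = max 0 (H0 x)" for x
  have H: "integrable lborel H" unfolding H_def using H0(1) by (intro integrable_max) auto
  have HK: "AE x in lborel. x \<in> K \<longrightarrow> ennreal (h x) = ennreal (H x)"
    using H0(2) by eventually_elim (auto simp: H_def max_def ennreal_neg)
  have [measurable]: "A \<in> sets borel" using A(1) by (rule borel_compact)
  note iG = flow_integrable_AE[OF less_imp_le[OF T] G(1)] and iH = flow_integrable_AE[OF less_imp_le[OF T] H]
  have restrict: "integrable lborel (\<lambda>s. indicator {0..t} s * E s)"
    if "integrable lborel (\<lambda>s. indicator {0..T} s * E s)" "t < T" for t and E :: "real \<Rightarrow> real"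
  proof -
    have "integrable lborel (\<lambda>s. (indicator {0..T} s * E s) * indicator {0..t} s)"
      by (rule integrable_mult_bounded[OF that(1), where c=1]) auto
    moreover have "(indicator {0..T} s * E s) * indicator {0..t} s = indicator {0..t} s * E s" for s
      using that(2) by (auto simp: indicator_def)
    ultimately show ?thesis by simp
  qed
  have main: "AE p in lborel. 0 < fst p \<and> fst p < T \<and> snd p \<in> A \<longrightarrow>
      integrable lborel (\<lambda>s. indicator {0..fst p} s * G (\<phi> s (snd p))) \<and>
      integrable lborel (\<lambda>s. indicator {0..fst p} s * H (\<phi> s (snd p))) \<and>
      \<bar>path_integral G (fst p) (snd p)\<bar> \<le> path_integral H (fst p) (snd p)"
    using tr hu AE_snd[OF AE_flow_pair(2)[OF HK]] AE_snd[OF iG] AE_snd[OF iH]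
  proof eventually_elim
    case (elim p)
    show ?case
    proof
      let ?t = "fst p" and ?x = "snd p"
      assume a: "0 < ?t \<and> ?t < T \<and> ?x \<in> A"
      have x\<Omega>: "?x \<in> \<Omega>" using a AK K\<Omega> by blast
      have fl: "flow X \<Omega> s ?x = \<phi> s ?x" if "s \<in> {0..?t}" for s
        using flow_is_largest_solution(3)[OF x\<Omega> sol, of s] a that by simp
      have "?t \<in> flow_interval X \<Omega> ?x"
        using flow_is_largest_solution(2)[OF x\<Omega> sol] a by auto
      then have dom: "p \<in> flow_domain_pos X \<Omega>" using flow_domain_posI[OF x\<Omega>, of ?t] a by simp
      have conf: "\<forall>s\<in>{0..?t}. \<phi> s ?x \<in> K" using inK a by auto
      have intG: "integrable lborel (\<lambda>s. indicator {0..?t} s * G (\<phi> s ?x))"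
        and intH: "integrable lborel (\<lambda>s. indicator {0..?t} s * H (\<phi> s ?x))"
        using restrict[OF elim(4)] restrict[OF elim(5)] a by auto
      have Hnn: "0 \<le> path_integral H ?t ?x"
        by (intro Bochner_Integration.integral_nonneg) (auto simp: H_def)
      have "ennreal \<bar>path_integral G ?t ?x\<bar> = ennreal \<bar>f (flow X \<Omega> ?t ?x) - f ?x\<bar>"
        using elim(1) conf a fl[of ?t] by simp
      also have "\<dots> \<le> (\<integral>\<^sup>+s\<in>{0..?t}. ennreal (h (flow X \<Omega> s ?x)) \<partial>lborel)"
        using elim(2) dom by blast
      also have "\<dots> = (\<integral>\<^sup>+s. ennreal (indicator {0..?t} s * H (\<phi> s ?x)) \<partial>lborel)"
      proof (rule nn_integral_cong_AE)
        show "AE s in lborel. ennreal (h (flow X \<Omega> s ?x)) * indicator {0..?t} s = ennreal (indicator {0..?t} s * H (\<phi> s ?x))"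
          using elim(3)
        proof eventually_elim
          case (elim s)
          then show ?case using conf fl[of s] by (cases "s \<in> {0..?t}") auto
        qed
      qed
      also have "\<dots> = ennreal (path_integral H ?t ?x)"
        by (rule nn_integral_eq_integral[OF intH]) (auto simp: H_def)
      finally have "\<bar>path_integral G ?t ?x\<bar> \<le> path_integral H ?t ?x"
        using Hnn by simp
      then show "integrable lborel (\<lambda>s. indicator {0..?t} s * G (\<phi> s ?x)) \<and>
        integrable lborel (\<lambda>s. indicator {0..?t} s * H (\<phi> s ?x)) \<and>
        \<bar>path_integral G ?t ?x\<bar> \<le> path_integral H ?t ?x"
        using intG intH by blast
    qed
  qed
  \<comment> \<open>The two signs of \<open>G\<close> are treated separately and combined into the
    absolute value.\<close>
  have "AE x in lborel. x \<in> A \<longrightarrow> G x - H x \<le> 0"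
  proof (rule nonpos_of_flow_integrals[OF Bochner_Integration.integrable_diff[OF G(1) H] _ T])
    show "AE p in lborel. 0 < fst p \<and> fst p < T \<and> snd p \<in> A \<longrightarrow>
        (LBINT s. indicator {0..fst p} s * (G (\<phi> s (snd p)) - H (\<phi> s (snd p)))) \<le> 0"
      using main by eventually_elim (auto simp: right_diff_distrib)
  qed simp
  moreover have "AE x in lborel. x \<in> A \<longrightarrow> - G x - H x \<le> 0"
  proof (rule nonpos_of_flow_integrals[OF Bochner_Integration.integrable_diff[OF integrable_minus[OF G(1)] H] _ T])
    show "AE p in lborel. 0 < fst p \<and> fst p < T \<and> snd p \<in> A \<longrightarrow>
        (LBINT s. indicator {0..fst p} s * (- G (\<phi> s (snd p)) - H (\<phi> s (snd p)))) \<le> 0"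
      using main by eventually_elim (auto simp: right_diff_distrib)
  qed simp
  ultimately show ?thesis
    using G(2) HK h0
  proof eventually_elim
    case (elim x)
    show ?case
    proof
      assume x: "x \<in> A"
      then have "x \<in> K" "x \<in> \<Omega>" using AK K\<Omega> by auto
      moreover have "0 \<le> H x" by (simp add: H_def)
      ultimately show "\<bar>Xf x\<bar> \<le> h x" using elim x by auto
    qed
  qed
qed simp

theorem theorem1p3:
  fixes X :: "real ^ 'n \<Rightarrow> real ^ 'n" and \<Omega> :: "(real ^ 'n) set"
    and f Xf :: "real ^ 'n \<Rightarrow> real"
  assumes "open \<Omega>"
    and "local_lipschitz (UNIV :: real set) \<Omega> (\<lambda>_. X)"
    and "f locally_integrable_on \<Omega>"
    and "is_distributional_derivative X \<Omega> f Xf"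
  shows "is_upper_gradient X \<Omega> f (\<lambda>x. \<bar>Xf x\<bar>) \<and>
    (\<forall>h. is_upper_gradient X \<Omega> f h \<longrightarrow> (AE x in lebesgue. x \<in> \<Omega> \<longrightarrow> \<bar>Xf x\<bar> \<le> h x))"
proof -
  interpret lipschitz_field X \<Omega> using assms(1,2) by unfold_locales
  \<comment> \<open>A trajectory over \<open>{0..t}\<close> is compact, so some \<open>C n\<close>
    contains it, and only countably many null sets are discarded. For minimality on
    \<open>C n\<close> the cutoff is made around \<open>C (Suc n)\<close>, whose interior contains
    \<open>C n\<close>.\<close>
  obtain C where C: "\<And>n. compact (C n)" "\<And>n. C n \<subseteq> \<Omega>" "\<And>n. C n \<subseteq> interior (C (Suc n))"
    "\<Union>(range C) = \<Omega>" "\<And>K. compact K \<Longrightarrow> K \<subseteq> \<Omega> \<Longrightarrow> \<exists>N. \<forall>n\<ge>N. K \<subseteq> C n"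
    by (rule open_Union_compact_subsets[OF assms(1)]) blast
  have "AE p in lborel. p \<in> flow_domain_pos X \<Omega> \<and> (\<forall>s\<in>{0..fst p}. flow X \<Omega> s (snd p) \<in> C n) \<longrightarrow>
    gradient_bound f (\<lambda>x. \<bar>Xf x\<bar>) p" for n
    using cutoff_flow_exists[OF C(1,2), of n] cutoff_flow.upper_gradient_confined[OF _ assms(3,4)] by blast
  then have "AE p in lborel. \<forall>n. p \<in> flow_domain_pos X \<Omega> \<and> (\<forall>s\<in>{0..fst p}. flow X \<Omega> s (snd p) \<in> C n) \<longrightarrow>
    gradient_bound f (\<lambda>x. \<bar>Xf x\<bar>) p"
    unfolding AE_all_countable by blast
  then have ug: "AE p in lborel. p \<in> flow_domain_pos X \<Omega> \<longrightarrow>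
    gradient_bound f (\<lambda>x. \<bar>Xf x\<bar>) p"
  proof eventually_elim
    case (elim p)
    show ?case
    proof
      assume p: "p \<in> flow_domain_pos X \<Omega>"
      have d: "snd p \<in> \<Omega>" "fst p \<in> flow_interval X \<Omega> (snd p)" "0 < fst p"
        using flow_domain_posD[of "fst p" "snd p"] p by auto
      have seg: "closed_segment 0 (fst p) = {0..fst p}" using d(3) by (simp add: closed_segment_eq_real_ivl)
      obtain n where "\<forall>m\<ge>n. (\<lambda>t. flow X \<Omega> t (snd p)) ` {0..fst p} \<subseteq> C m"
        using C(5)[OF solution_segment(2,3)[OF flow_is_largest_solution(1)[OF d(1)] d(2)]] unfolding seg by blast
      then have "(\<lambda>t. flow X \<Omega> t (snd p)) ` {0..fst p} \<subseteq> C n" by simp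
      then have "\<forall>s\<in>{0..fst p}. flow X \<Omega> s (snd p) \<in> C n" by blast
      then show "gradient_bound f (\<lambda>x. \<bar>Xf x\<bar>) p"
        using elim p by blast
    qed
  qed
  have loc: "(\<lambda>x. \<bar>Xf x\<bar>) locally_integrable_on \<Omega>"
    using assms(4) unfolding is_distributional_derivative_def locally_integrable_on_def
    by (auto intro: set_integrable_abs)
  have "is_upper_gradient X \<Omega> f (\<lambda>x. \<bar>Xf x\<bar>)"
    unfolding is_upper_gradient_def AE_completion_iff using loc ug by (simp add: case_prod_beta)
  moreover have "AE x in lebesgue. x \<in> \<Omega> \<longrightarrow> \<bar>Xf x\<bar> \<le> h x" if h: "is_upper_gradient X \<Omega> f h" for h
  proof -
    have "AE x in lborel. x \<in> C n \<longrightarrow> \<bar>Xf x\<bar> \<le> h x" for n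
      using cutoff_flow_exists[OF C(1,2), of "Suc n"]
        cutoff_flow.upper_gradient_minimal_confined[OF _ assms(3,4) h C(1) C(3)] by blast
    then have "AE x in lborel. \<forall>n. x \<in> C n \<longrightarrow> \<bar>Xf x\<bar> \<le> h x" unfolding AE_all_countable by blast
    then have "AE x in lborel. x \<in> \<Omega> \<longrightarrow> \<bar>Xf x\<bar> \<le> h x"
      by eventually_elim (use C(4) in blast)
    then show ?thesis by (rule AE_completion)
  qed
  ultimately show ?thesis by blast
qed

end
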